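(* Let $n\ge 2$, let $A$ be a commutative associative unital algebra over $\mathbb{C}$, let $\mathbf{B}$ be a basis of $A$ (as a complex vector space), and let $m\in\mathbb{Z}_{>0}$. Then the set $$\left\{q(\varphi_1,\ldots,\varphi_n)\,w_{m\omega_1}\ \bigg|\ \varphi_1,\ldots,\varphi_n\in\mathcal{F}(\mathbf{B}),\ \sum_{i=1}^n|\varphi_i|=m\right\}$$ is a basis for the global Weyl module $W_A(m\omega_1)$ of $\mathfrak{sl}_n\otimes A$.
   Context: Lie algebra: $\mathfrak{sl}_n$ is the Lie algebra of complex traceless $n\times n$ matrices with commutator bracket; $e_{i,j}$ denotes the matrix unit. For $1\le i\le n-1$: $h_i=e_{i,i}-e_{i+1,i+1}$, $x_i=e_{i,i+1}$, $x_{-i}=e_{i+1,i}$. $\mathfrak{h}=\mathrm{span}\{h_1,\dots,h_{n-1}\}$ and $\mathfrak{n}^+$ is the span of the $e_{i,j}$ with $i<j$. The fundamental weights $\omega_1,\dots,\omega_{n-1}\in\mathfrak{h}^*$ are given by $\omega_i(h_j)=\delta_{i,j}$, and $P^+$ is their $\mathbb{Z}_{\ge0}$-span. Map algebra: $\mathfrak{sl}_n\otimes A$ is the Lie algebra (tensor product over $\mathbb{C}$) with bracket $[z\otimes a,w\otimes b]=[z,w]\otimes ab$; $\mathbf{U}(\mathfrak{sl}_n\otimes A)$ is its universal enveloping algebra. Global Weyl module: for $\lambda\in P^+$, $W_A(\lambda)$ is the $\mathfrak{sl}_n\otimes A$-module generated by a vector $w_\lambda$ (the highest weight vector) with defining relations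 $(x\otimes a)w_\lambda=0$, $(h\otimes 1)w_\lambda=\lambda(h)w_\lambda$, $(x_{-i}\otimes1)^{\lambda(h_i)+1}w_\lambda=0$ for all $a\in A$, $x\in\mathfrak{n}^+$, $h\in\mathfrak{h}$, $1\le i\le n-1$. Multisets: for a set $S$, $\mathcal{F}(S)$ is the set of finitely supported functions $\chi:S\to\mathbb{Z}_{\ge0}$, an abelian monoid under addition, with $|\chi|=\sum_{s\in S}\chi(s)$. Write $\mathcal{F}=\mathcal{F}(A)$, and regard $\mathcal{F}(\mathbf{B})\subseteq\mathcal{F}$ via extension by zero. For $\chi\in\mathcal{F}$, $\mathcal{F}(\chi)=\{\psi\in\mathcal{F}\mid\psi(a)\le\chi(a)\ \forall a\in A\}$; for $\psi\in\mathcal{F}(\chi)$, $\chi-\psi$ is the pointwise difference. For $a\in A$, $\chi_a$ is the characteristic function of $\{a\}$; in particular $\chi_1$ is that of $\{1_A\}$. Define $\pi(\psi)=\prod_{a\in A}a^{\psi(a)}$ (with $\pi(0)=1$) and $\mathcal{M}(\psi)=|\psi|!/\prod_{a\in A}\psi(a)!$. Elements $q_i$: for $1\le i\le n-1$ and $\varphi,\chi\in\mathcal{F}$, define $q_i(\varphi,\chi)\in\mathbf{U}(\mathfrak{sl}_n\otimes A)$ recursively by $q_i(0,0)=1$; for $\chi\ne0$, $$q_i(0,\chi)=-\frac1{|\chi|}\sum_{0\ne\psi\in\mathcal{F}(\chi)}\mathcal{M}(\psi)(h_i\otimes\pi(\psi))\,q_i(0,\chi-\psi);$$ and for $\varphi\neq0$,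 $$q_i(\varphi,\chi)=-\frac1{|\varphi|}\sum_{\psi\in\mathcal{F}(\chi)}\ \sum_{d\in\mathrm{supp}\,\varphi}\mathcal{M}(\psi)(x_{-i}\otimes d\,\pi(\psi))\,q_i(\varphi-\chi_d,\chi-\psi).$$ Elements $q$: for $\varphi_1,\dots,\varphi_n\in\mathcal{F}$, $$q(\varphi_1,\dots,\varphi_n)=q_{n-1}(\varphi_n,\varphi_{n-1})\,q_{n-2}\big((|\varphi_n|+|\varphi_{n-1}|)\chi_1,\varphi_{n-2}\big)\cdots q_2\Big(\Big(\sum_{j=3}^n|\varphi_j|\Big)\chi_1,\varphi_2\Big)\,q_1\Big(\Big(\sum_{j=2}^n|\varphi_j|\Big)\chi_1,\varphi_1\Big),$$ that is, $q_{n-1}(\varphi_n,\varphi_{n-1})$ followed by the factors $q_i\big((\sum_{j=i+1}^n|\varphi_j|)\chi_1,\varphi_i\big)$ for $i=n-2,n-3,\dots,1$ in this order (for $n=2$, $q(\varphi_1,\varphi_2)=q_1(\varphi_2,\varphi_1)$). *)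

theory Defs
  imports
    "Jordan_Normal_Form.VS_Connect"
    "HOL-Algebra.QuotRing"
    "HOL-Library.Poly_Mapping"
    "HOL-Library.Multiset"
begin

text \<open>
  Complex vector spaces and algebras are \<open>module\<close> records over \<^term>\<open>class_ring :: complex ring\<close>.
  The ring fields \<open>mult\<close> and \<open>one\<close> carry no information where only the vector space is meant.
\<close>

text \<open>
  If \<open>M\<close> is an algebra and \<open>N\<close> a two-sided ideal, this is the quotient algebra; if \<open>N\<close> is only a
  subspace, it is the quotient space and its multiplication is meaningless.
\<close>

definition quotient_mod :: "('k, 'v, 'm) module_scheme \<Rightarrow> 'v set \<Rightarrow> ('k, 'v set) module"
  where "quotient_mod M N =
    \<lparr>carrier = a_rcosets\<^bsub>M\<^esub> N, mult = rcoset_mult M N, one = N +>\<^bsub>M\<^esub> \<one>\<^bsub>M\<^esub>,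
     zero = N, add = set_add M, smult = (\<lambda>c X. \<Union>x\<in>X. N +>\<^bsub>M\<^esub> (c \<odot>\<^bsub>M\<^esub> x))\<rparr>"

definition free_space :: "'x set \<Rightarrow> (complex, 'x \<Rightarrow>\<^sub>0 complex) module"
  where "free_space X =
    \<lparr>carrier = {p. Poly_Mapping.keys p \<subseteq> X}, mult = undefined, one = undefined,
     zero = 0, add = (+), smult = (\<lambda>c. Poly_Mapping.map ((*) c))\<rparr>"

definition tensor_relations ::
    "(complex, 'v, 'm) module_scheme \<Rightarrow> (complex, 'w, 'l) module_scheme \<Rightarrow> ('v \<times> 'w \<Rightarrow>\<^sub>0 complex) set"
  where "tensor_relations V W =
      {Poly_Mapping.single (x \<oplus>\<^bsub>V\<^esub> y, a) 1 - Poly_Mapping.single (x, a) 1 - Poly_Mapping.single (y, a) 1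
        | x y a. x \<in> carrier V \<and> y \<in> carrier V \<and> a \<in> carrier W}
    \<union> {Poly_Mapping.single (x, a \<oplus>\<^bsub>W\<^esub> b) 1 - Poly_Mapping.single (x, a) 1 - Poly_Mapping.single (x, b) 1
        | x a b. x \<in> carrier V \<and> a \<in> carrier W \<and> b \<in> carrier W}
    \<union> {Poly_Mapping.single (c \<odot>\<^bsub>V\<^esub> x, a) 1 - Poly_Mapping.single (x, a) c
        | c x a. x \<in> carrier V \<and> a \<in> carrier W}
    \<union> {Poly_Mapping.single (x, c \<odot>\<^bsub>W\<^esub> a) 1 - Poly_Mapping.single (x, a) c
        | c x a. x \<in> carrier V \<and> a \<in> carrier W}"

definition tensor_null ::
    "(complex, 'v, 'm) module_scheme \<Rightarrow> (complex, 'w, 'l) module_scheme \<Rightarrow> ('v \<times> 'w \<Rightarrow>\<^sub>0 complex) set"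
  where "tensor_null V W =
    LinearCombinations.module.span class_ring (free_space (carrier V \<times> carrier W)) (tensor_relations V W)"

definition tensor_space ::
    "(complex, 'v, 'm) module_scheme \<Rightarrow> (complex, 'w, 'l) module_scheme
      \<Rightarrow> (complex, ('v \<times> 'w \<Rightarrow>\<^sub>0 complex) set) module"
  where "tensor_space V W = quotient_mod (free_space (carrier V \<times> carrier W)) (tensor_null V W)"

definition pure_tensor ::
    "(complex, 'v, 'm) module_scheme \<Rightarrow> (complex, 'w, 'l) module_scheme
      \<Rightarrow> 'v \<Rightarrow> 'w \<Rightarrow> ('v \<times> 'w \<Rightarrow>\<^sub>0 complex) set"
  where "pure_tensor V W x a =
    tensor_null V W +>\<^bsub>free_space (carrier V \<times> carrier W)\<^esub> Poly_Mapping.single (x, a) 1"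

record ('k, 'g) lie_algebra = "('k, 'g) module" +
  bracket :: "'g \<Rightarrow> 'g \<Rightarrow> 'g"

definition sl :: "nat \<Rightarrow> (complex, complex mat) lie_algebra"
  where "sl n =
    \<lparr>carrier = {M \<in> carrier_mat n n. (\<Sum>k<n. M $$ (k, k)) = 0}, mult = undefined, one = undefined,
     zero = 0\<^sub>m n n, add = (+), smult = (\<cdot>\<^sub>m), bracket = (\<lambda>X Y. X * Y - Y * X)\<rparr>"

text \<open>The bilinear extension of \<open>[z \<otimes> a, w \<otimes> b] = [z, w] \<otimes> ab\<close> to formal combinations of pairs.\<close>

definition formal_bracket ::
    "(complex, 'g, 'l) lie_algebra_scheme \<Rightarrow> (complex, 'a, 'm) module_scheme
      \<Rightarrow> ('g \<times> 'a \<Rightarrow>\<^sub>0 complex) \<Rightarrow> ('g \<times> 'a \<Rightarrow>\<^sub>0 complex) \<Rightarrow> ('g \<times> 'a \<Rightarrow>\<^sub>0 complex)"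
  where "formal_bracket L A p q =
    (\<Sum>(z, a)\<in>Poly_Mapping.keys p. \<Sum>(w, b)\<in>Poly_Mapping.keys q.
      Poly_Mapping.single (bracket L z w, a \<otimes>\<^bsub>A\<^esub> b)
        (Poly_Mapping.lookup p (z, a) * Poly_Mapping.lookup q (w, b)))"

definition map_algebra ::
    "(complex, 'g, 'l) lie_algebra_scheme \<Rightarrow> (complex, 'a, 'm) module_scheme
      \<Rightarrow> (complex, ('g \<times> 'a \<Rightarrow>\<^sub>0 complex) set) lie_algebra"
  where "map_algebra L A =
    \<lparr>carrier = carrier (tensor_space L A), mult = undefined, one = undefined,
     zero = zero (tensor_space L A), add = add (tensor_space L A), smult = smult (tensor_space L A),
     bracket = (\<lambda>X Y. \<Union>p\<in>X. \<Union>q\<in>Y.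
       tensor_null L A +>\<^bsub>free_space (carrier L \<times> carrier A)\<^esub> formal_bracket L A p q)\<rparr>"

text \<open>
  With words as exponents, the convolution product of finitely supported functions makes
  \<open>'x free_word \<Rightarrow>\<^sub>0 complex\<close> the free associative algebra on \<open>'x\<close>.
\<close>

datatype 'x free_word = Word (letters: "'x list")

instantiation free_word :: (type) monoid_add
begin

definition zero_free_word :: "'a free_word" where "0 = Word []"

definition plus_free_word :: "'a free_word \<Rightarrow> 'a free_word \<Rightarrow> 'a free_word"
  where "u + v = Word (letters u @ letters v)"

instance by standard (simp_all add: zero_free_word_def plus_free_word_def)

end

definition free_algebra :: "'x set \<Rightarrow> (complex, 'x free_word \<Rightarrow>\<^sub>0 complex) module"
  where "free_algebra X =
    \<lparr>carrier = {p. \<forall>u\<in>Poly_Mapping.keys p. set (letters u) \<subseteq> X}, mult = (*), one = 1,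
     zero = 0, add = (+), smult = (\<lambda>c. Poly_Mapping.map ((*) c))\<rparr>"

definition free_gen :: "'x \<Rightarrow> ('x free_word \<Rightarrow>\<^sub>0 complex)"
  where "free_gen x = Poly_Mapping.single (Word [x]) 1"

definition enveloping_relations ::
    "(complex, 'g, 'l) lie_algebra_scheme \<Rightarrow> ('g free_word \<Rightarrow>\<^sub>0 complex) set"
  where "enveloping_relations L =
      {free_gen (x \<oplus>\<^bsub>L\<^esub> y) - free_gen x - free_gen y | x y. x \<in> carrier L \<and> y \<in> carrier L}
    \<union> {free_gen (c \<odot>\<^bsub>L\<^esub> x) - Poly_Mapping.map ((*) c) (free_gen x) | c x. x \<in> carrier L}
    \<union> {free_gen x * free_gen y - free_gen y * free_gen x - free_gen (bracket L x y)
        | x y. x \<in> carrier L \<and> y \<in> carrier L}"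

definition enveloping_ideal ::
    "(complex, 'g, 'l) lie_algebra_scheme \<Rightarrow> ('g free_word \<Rightarrow>\<^sub>0 complex) set"
  where "enveloping_ideal L = genideal (free_algebra (carrier L)) (enveloping_relations L)"

definition enveloping_algebra ::
    "(complex, 'g, 'l) lie_algebra_scheme \<Rightarrow> (complex, ('g free_word \<Rightarrow>\<^sub>0 complex) set) module"
  where "enveloping_algebra L = quotient_mod (free_algebra (carrier L)) (enveloping_ideal L)"

definition enveloping_map ::
    "(complex, 'g, 'l) lie_algebra_scheme \<Rightarrow> 'g \<Rightarrow> ('g free_word \<Rightarrow>\<^sub>0 complex) set"
  where "enveloping_map L x = enveloping_ideal L +>\<^bsub>free_algebra (carrier L)\<^esub> free_gen x"

text \<open>Matrices are indexed from 0 in the library; the index arguments below start from 1.\<close>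

definition e_mat :: "nat \<Rightarrow> nat \<Rightarrow> nat \<Rightarrow> complex mat"
  where "e_mat n i j = mat n n (\<lambda>(r, c). if Suc r = i \<and> Suc c = j then 1 else 0)"

definition h_mat :: "nat \<Rightarrow> nat \<Rightarrow> complex mat"
  where "h_mat n i = e_mat n i i - e_mat n (i + 1) (i + 1)"

definition x_minus :: "nat \<Rightarrow> nat \<Rightarrow> complex mat"
  where "x_minus n i = e_mat n (i + 1) i"

definition cartan :: "nat \<Rightarrow> complex mat set"
  where "cartan n = LinearCombinations.module.span class_ring (sl n) (h_mat n ` {1..n - 1})"

definition n_plus :: "nat \<Rightarrow> complex mat set"
  where "n_plus n =
    LinearCombinations.module.span class_ring (sl n) {e_mat n i j | i j. 1 \<le> i \<and> i < j \<and> j \<le> n}"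

text \<open>
  A weight is a function on matrices of which only the restriction to the Cartan subalgebra matters.
  On it, the following is the linear functional dual to the \<open>h_mat n j\<close>.
\<close>

definition fundamental_weight :: "nat \<Rightarrow> complex mat \<Rightarrow> complex"
  where "fundamental_weight i h = (\<Sum>k<i. h $$ (k, k))"

lemma fundamental_weight_h_mat:
  assumes "i \<in> {1..n - 1}" "j \<in> {1..n - 1}"
  shows "fundamental_weight i (h_mat n j) = (if i = j then 1 else 0)"
proof -
  have "fundamental_weight i (h_mat n j) =
      (\<Sum>k<i. (if k = j - 1 then 1 else 0) - (if k = j then 1 else 0))"
    unfolding fundamental_weight_def h_mat_def e_mat_def
    using assms by (intro sum.cong) auto
  also have "\<dots> = (if j - 1 < i then 1 else 0) - (if j < i then 1 else 0)"
    by (simp add: sum_subtractf)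
  also have "\<dots> = (if i = j then 1 else 0)"
    using assms by auto
  finally show ?thesis .
qed

lemma fundamental_weight_linear:
  assumes "i \<le> n" "X \<in> carrier_mat n n" "Y \<in> carrier_mat n n"
  shows "fundamental_weight i (c \<cdot>\<^sub>m X + Y) = c * fundamental_weight i X + fundamental_weight i Y"
  using assms by (simp add: fundamental_weight_def sum.distrib sum_distrib_left)

abbreviation sl_map :: "nat \<Rightarrow> (complex, 'a, 'm) module_scheme
    \<Rightarrow> (complex, (complex mat \<times> 'a \<Rightarrow>\<^sub>0 complex) set) lie_algebra"
  where "sl_map n A \<equiv> map_algebra (sl n) A"

type_synonym 'a U_elem = "((complex mat \<times> 'a \<Rightarrow>\<^sub>0 complex) set free_word \<Rightarrow>\<^sub>0 complex) set"

abbreviation U_sl :: "nat \<Rightarrow> (complex, 'a, 'm) module_scheme \<Rightarrow> (complex, 'a U_elem) module"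
  where "U_sl n A \<equiv> enveloping_algebra (sl_map n A)"

definition U_tensor ::
    "nat \<Rightarrow> (complex, 'a, 'm) module_scheme \<Rightarrow> complex mat \<Rightarrow> 'a \<Rightarrow> 'a U_elem"
  where "U_tensor n A z a = enveloping_map (sl_map n A) (pure_tensor (sl n) A z a)"

definition left_ideal :: "'u set \<Rightarrow> ('u, 'm) ring_scheme \<Rightarrow> bool"
  where "left_ideal J R \<longleftrightarrow>
    additive_subgroup J R \<and> (\<forall>u\<in>carrier R. \<forall>x\<in>J. u \<otimes>\<^bsub>R\<^esub> x \<in> J)"

definition gen_left_ideal :: "('u, 'm) ring_scheme \<Rightarrow> 'u set \<Rightarrow> 'u set"
  where "gen_left_ideal R S = \<Inter>{J. left_ideal J R \<and> S \<subseteq> J}"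

text \<open>
  The module with generator \<open>w\<close> and defining relations \<open>u w = 0\<close>, for \<open>u\<close> in a set \<open>S\<close>, is the
  quotient of the enveloping algebra by the left ideal generated by \<open>S\<close>, with \<open>w\<close> the class of 1.
  The relation \<open>(x\<^sub>-\<^sub>i \<otimes> 1)\<^bsup>\<lambda>(h\<^sub>i)+1\<^esup> w = 0\<close> makes sense since \<open>\<lambda>(h\<^sub>i)\<close> is a natural number \<open>k\<close> for
  dominant \<open>\<lambda>\<close>.
\<close>

definition weyl_relations ::
    "nat \<Rightarrow> (complex, 'a, 'm) module_scheme \<Rightarrow> (complex mat \<Rightarrow> complex) \<Rightarrow> 'a U_elem set"
  where "weyl_relations n A lam =
      {U_tensor n A x a | x a. x \<in> n_plus n \<and> a \<in> carrier A}
    \<union> {U_tensor n A h \<one>\<^bsub>A\<^esub> \<ominus>\<^bsub>U_sl n A\<^esub> (lam h \<odot>\<^bsub>U_sl n A\<^esub> \<one>\<^bsub>U_sl n A\<^esub>) | h. h \<in> cartan n}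
    \<union> {U_tensor n A (x_minus n i) \<one>\<^bsub>A\<^esub> [^]\<^bsub>U_sl n A\<^esub> (k + 1)
        | i k :: nat. i \<in> {1..n - 1} \<and> lam (h_mat n i) = of_nat k}"

definition weyl_ideal ::
    "nat \<Rightarrow> (complex, 'a, 'm) module_scheme \<Rightarrow> (complex mat \<Rightarrow> complex) \<Rightarrow> 'a U_elem set"
  where "weyl_ideal n A lam = gen_left_ideal (U_sl n A) (weyl_relations n A lam)"

definition global_weyl_module ::
    "nat \<Rightarrow> (complex, 'a, 'm) module_scheme \<Rightarrow> (complex mat \<Rightarrow> complex)
      \<Rightarrow> (complex, 'a U_elem set) module"
  where "global_weyl_module n A lam = quotient_mod (U_sl n A) (weyl_ideal n A lam)"

definition weyl_vector ::
    "nat \<Rightarrow> (complex, 'a, 'm) module_scheme \<Rightarrow> (complex mat \<Rightarrow> complex) \<Rightarrow> 'a U_elem set"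
  where "weyl_vector n A lam = weyl_ideal n A lam +>\<^bsub>U_sl n A\<^esub> \<one>\<^bsub>U_sl n A\<^esub>"

definition weyl_act ::
    "nat \<Rightarrow> (complex, 'a, 'm) module_scheme \<Rightarrow> (complex mat \<Rightarrow> complex)
      \<Rightarrow> 'a U_elem \<Rightarrow> 'a U_elem set \<Rightarrow> 'a U_elem set"
  where "weyl_act n A lam u X = (\<Union>v\<in>X. weyl_ideal n A lam +>\<^bsub>U_sl n A\<^esub> (u \<otimes>\<^bsub>U_sl n A\<^esub> v))"

text \<open>
  Finitely supported functions to the natural numbers are multisets: \<open>\<psi> \<subseteq># \<chi>\<close> is the pointwise
  order, \<open>{#d#}\<close> the characteristic function of \<open>d\<close>, and \<open>replicate_mset k \<one>\<close> is \<open>k\<close> times that of 1.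
\<close>

definition mset_prod :: "('a, 'm) ring_scheme \<Rightarrow> 'a multiset \<Rightarrow> 'a"
  where "mset_prod A \<psi> = (\<Otimes>\<^bsub>A\<^esub>a\<in>set_mset \<psi>. a [^]\<^bsub>A\<^esub> count \<psi> a)"

definition multinom :: "'a multiset \<Rightarrow> complex"
  where "multinom \<psi> = fact (size \<psi>) / (\<Prod>a\<in>set_mset \<psi>. fact (count \<psi> a))"

text \<open>Unlike the library's congruence rule for \<open>finsum\<close>, this one has no closure premise.\<close>

lemma foldSetD_cong:
  assumes "(S, y) \<in> foldSetD D f e" "\<And>x z. x \<in> S \<Longrightarrow> f x z = g x z"
  shows "(S, y) \<in> foldSetD D g e"
  using assms
proof (induction rule: foldSetD.induct)
  case emptyI
  show ?case using emptyI.hyps by (rule foldSetD.emptyI)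
next
  case (insertI x S y)
  have "(insert x S, g x y) \<in> foldSetD D g e"
    using insertI by (intro foldSetD.insertI) auto
  moreover have "f x y = g x y"
    using insertI.prems by simp
  ultimately show ?case by simp
qed

lemma finsum_cong_plain [fundef_cong]:
  fixes f g :: "'i \<Rightarrow> 'v"
  assumes "G = H" "S = T" "\<And>x. x \<in> T \<Longrightarrow> f x = g x"
  shows "finsum G f S = finsum H g T"
proof -
  have "(T, y) \<in> foldSetD D (\<lambda>x. M (f x)) e \<longleftrightarrow> (T, y) \<in> foldSetD D (\<lambda>x. M (g x)) e"
    for D e y and M :: "'v \<Rightarrow> 'v \<Rightarrow> 'v"
    using assms(3) by (auto intro: foldSetD_cong)
  then show ?thesis
    by (simp add: assms(1,2) finsum_def finprod_def foldD_def comp_def)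
qed

function q_elem ::
    "nat \<Rightarrow> (complex, 'a, 'm) module_scheme \<Rightarrow> nat \<Rightarrow> 'a multiset \<Rightarrow> 'a multiset \<Rightarrow> 'a U_elem"
  where "q_elem n A i \<phi> \<chi> =
    (if \<phi> = {#} then
       if \<chi> = {#} then \<one>\<^bsub>U_sl n A\<^esub>
       else (- 1 / of_nat (size \<chi>)) \<odot>\<^bsub>U_sl n A\<^esub>
         (\<Oplus>\<^bsub>U_sl n A\<^esub>\<psi>\<in>{\<psi>. \<psi> \<noteq> {#} \<and> \<psi> \<subseteq># \<chi>}.
            (multinom \<psi> \<odot>\<^bsub>U_sl n A\<^esub> U_tensor n A (h_mat n i) (mset_prod A \<psi>))
              \<otimes>\<^bsub>U_sl n A\<^esub> q_elem n A i {#} (\<chi> - \<psi>))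
     else (- 1 / of_nat (size \<phi>)) \<odot>\<^bsub>U_sl n A\<^esub>
       (\<Oplus>\<^bsub>U_sl n A\<^esub>\<psi>\<in>{\<psi>. \<psi> \<subseteq># \<chi>}. \<Oplus>\<^bsub>U_sl n A\<^esub>d\<in>set_mset \<phi>.
          (multinom \<psi> \<odot>\<^bsub>U_sl n A\<^esub> U_tensor n A (x_minus n i) (d \<otimes>\<^bsub>A\<^esub> mset_prod A \<psi>))
            \<otimes>\<^bsub>U_sl n A\<^esub> q_elem n A i (\<phi> - {#d#}) (\<chi> - \<psi>)))"
  by pat_completeness auto
termination
proof (relation "measure (\<lambda>(n, A, i, \<phi>, \<chi>). size \<phi> + size \<chi>)", goal_cases)
  case 1
  show ?case by simp
next
  case (2 n A i \<phi> \<chi> \<psi>)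
  then show ?case
    by (auto simp: size_Diff_submset nonempty_has_size size_mset_mono diff_less)
next
  case (3 n A i \<phi> \<chi> \<psi> d)
  then show ?case
    by (auto simp: size_Diff_submset nonempty_has_size size_Diff_singleton
        intro!: add_less_le_mono)
qed

declare q_elem.simps [simp del]

definition q_prod ::
    "nat \<Rightarrow> (complex, 'a, 'm) module_scheme \<Rightarrow> (nat \<Rightarrow> 'a multiset) \<Rightarrow> 'a U_elem"
  where "q_prod n A \<phi> =
    q_elem n A (n - 1) (\<phi> n) (\<phi> (n - 1)) \<otimes>\<^bsub>U_sl n A\<^esub>
    foldr (\<lambda>i u. q_elem n A i (replicate_mset (\<Sum>j = i + 1..n. size (\<phi> j)) \<one>\<^bsub>A\<^esub>) (\<phi> i) \<otimes>\<^bsub>U_sl n A\<^esub> u)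
      (rev [1..<n - 1]) \<one>\<^bsub>U_sl n A\<^esub>"

end

theory Submission imports Defs begin

text \<open>
  Let \<open>V\<close> be the space of column vectors with basis \<open>v\<^sub>1, \<dots>, v\<^sub>n\<close>. The global Weyl module of weight
  \<open>m\<omega>\<^sub>1\<close> is the symmetric power \<open>S\<^sup>m(V \<otimes> A)\<close>: the forms of degree \<open>m\<close> in the letters \<open>v\<^sub>i \<otimes> b\<close> with
  \<open>b \<in> B\<close>, where \<open>e\<^sub>i\<^sub>j \<otimes> a\<close> acts as the derivation that takes \<open>v\<^sub>j \<otimes> c\<close> to \<open>v\<^sub>i \<otimes> ac\<close> and kills
  \<open>v\<^sub>k \<otimes> c\<close> for \<open>k \<noteq> j\<close>, and where the generator \<open>w\<close> becomes \<open>(v\<^sub>1 \<otimes> 1)\<^sup>m\<close>. In this picture \<open>q(\<phi>\<^sub>1, \<dots>, \<phi>\<^sub>n) w\<close> is a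
  non-zero multiple of the monomial with exponent \<open>\<phi>\<^sub>i(b)\<close> at \<open>v\<^sub>i \<otimes> b\<close>, so the theorem says that the
  monomials of degree \<open>m\<close> are a basis of the forms of degree \<open>m\<close>.

  The vector \<open>(v\<^sub>1 \<otimes> 1)\<^sup>m\<close> satisfies the defining relations of \<open>w\<close> (\<open>V_hw\<close>), so the universal property
  (\<open>act_L\<close>) gives an equivariant map from the Weyl module to the forms. The main point is that this
  map is injective (\<open>L_iff\<close>), and for this an equivariant map \<open>\<Psi>\<close> in the other direction is built.

  The action on the Weyl module extends from \<open>sl\<^sub>n \<otimes> A\<close> to \<open>gl\<^sub>n \<otimes> A\<close>: the vector \<open>(h\<^sub>1 \<otimes> a) w\<close> satisfies
  the defining relations of \<open>w\<close> as well (\<open>hw_vector_h\<close>), hence \<open>w \<mapsto> (h\<^sub>1 \<otimes> a) w\<close> extends to an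
  endomorphism, and this is how the identity matrix times \<open>a\<close> acts. The choice is such that
  \<open>e\<^sub>i\<^sub>j \<otimes> a\<close> kills \<open>w\<close> for all \<open>i\<close> and all \<open>j \<ge> 2\<close>, the diagonal case included (\<open>E_kills_w0\<close>).
  What remains are the \<open>e\<^sub>i\<^sub>1 \<otimes> a\<close>. They span a copy of \<open>V \<otimes> A\<close>, closed under the associative product,
  and in particular a pre-Lie algebra. For a module over such an algebra the rule
  \<open>\<Psi>(x f) = x \<Psi>(f) - \<Psi>(D\<^sub>x f)\<close>, where the derivation \<open>D\<^sub>x\<close> extends \<open>y \<mapsto> x \<circ> y\<close>, defines without ambiguity
  a map from polynomials with \<open>\<Psi>(1) = w\<close> (\<open>symm_map_var\<close>). It follows that \<open>e\<^sub>i\<^sub>j \<otimes> a\<close> acts on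
  \<open>\<Psi>(f)\<close> through the derivation of \<open>f\<close> alone when \<open>j \<ge> 2\<close> (\<open>E_Psi_pos\<close>), and with the additional term
  \<open>\<Psi>((v\<^sub>i \<otimes> a) f)\<close> when \<open>j = 1\<close> (\<open>E_Psi_0\<close>). The relation \<open>(x\<^sub>-\<^sub>1 \<otimes> 1)\<^bsup>m+1\<^esup> w = 0\<close> says that \<open>\<Psi>\<close> kills
  \<open>(v\<^sub>2 \<otimes> 1)\<^bsup>m+1\<^esup>\<close>; polarization with the operators \<open>e\<^sub>i\<^sub>2 \<otimes> b\<close> then shows that it kills all forms of degree
  \<open>m + 1\<close> (\<open>Psi_vanish\<close>). So the additional term is absent in degree \<open>m\<close>, where \<open>\<Psi>\<close> is therefore
  equivariant (\<open>E_Psi\<close>). Since it takes \<open>(v\<^sub>1 \<otimes> 1)\<^sup>m\<close> to \<open>m! w\<close> (\<open>Psi_lin_one_power_m\<close>), an element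
  of the enveloping algebra that kills \<open>(v\<^sub>1 \<otimes> 1)\<^sup>m\<close> also kills \<open>w\<close>.

  The action of \<open>q\<^sub>i(\<phi>, \<chi>)\<close> on divided powers of \<open>v\<^sub>i \<otimes> 1\<close> is found by solving the recursion that defines
  it (\<open>q_recursion_solution\<close>): up to sign, it turns \<open>|\<phi>|\<close> of the factors into the letters \<open>v\<^sub>i\<^sub>+\<^sub>1 \<otimes> d\<close>
  with \<open>d\<close> in \<open>\<phi>\<close>, and \<open>|\<chi>|\<close> of them into the letters \<open>v\<^sub>i \<otimes> c\<close> with \<open>c\<close> in \<open>\<chi>\<close>. All other terms of the
  recursion cancel in pairs (\<open>telescoping\<close>).
\<close>


section \<open>Linear maps on finitely supported functions\<close>

abbreviation pm_scale :: "complex \<Rightarrow> ('k \<Rightarrow>\<^sub>0 complex) \<Rightarrow> ('k \<Rightarrow>\<^sub>0 complex)"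
  where "pm_scale c \<equiv> Poly_Mapping.map ((*) c)"

lemma lookup_pm_scale [simp]:
  "Poly_Mapping.lookup (pm_scale c p) k = c * Poly_Mapping.lookup p k"
  by (simp add: Poly_Mapping.map.rep_eq when_def)

interpretation pm: vector_space "pm_scale :: complex \<Rightarrow> ('k \<Rightarrow>\<^sub>0 complex) \<Rightarrow> _"
  by unfold_locales (auto intro!: poly_mapping_eqI simp: lookup_add algebra_simps)

lemma linearI:
  assumes "vector_space s" "vector_space t" "\<And>x y. f (x + y) = f x + f y" "\<And>c x. f (s c x) = t c (f x)"
  shows "Vector_Spaces.linear s t f"
  using assms by (auto simp: Vector_Spaces.linear_iff)

context
  fixes s :: "complex \<Rightarrow> 'v::ab_group_add \<Rightarrow> 'v" and t :: "complex \<Rightarrow> 'w::ab_group_add \<Rightarrow> 'w" and f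
  assumes f: "Vector_Spaces.linear s t f"
begin
interpretation Vector_Spaces.linear s t f by (fact f)
lemma lin_add: "f (x + y) = f x + f y" by (fact add)
lemma lin_scale: "f (s c x) = t c (f x)" by (fact scale)
lemma lin_zero: "f 0 = 0" by (fact zero)
lemma lin_diff: "f (x - y) = f x - f y" by (fact diff)
lemma lin_neg: "f (- x) = - f x" by (fact neg)
lemma lin_sum: "f (sum g S) = (\<Sum>x\<in>S. f (g x))" by (fact sum)
end

lemmas linear_simps = lin_add lin_scale lin_zero lin_diff lin_neg lin_sum

lemma lin_comp:
  assumes "Vector_Spaces.linear s t f" "Vector_Spaces.linear t u g"
  shows "Vector_Spaces.linear s u (\<lambda>x. g (f x))"
  using Vector_Spaces.linear_compose[OF assms] by (simp add: comp_def)

lemma lin_minus: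
  assumes "Vector_Spaces.linear s t f" "Vector_Spaces.linear s t g"
  shows "Vector_Spaces.linear s t (\<lambda>x. f x - g x)"
proof -
  interpret vector_space_pair s t
    using assms by (simp add: Vector_Spaces.linear_iff vector_space_pair_def)
  show ?thesis using assms by (rule linear_compose_sub)
qed

lemma lin_plus:
  assumes "Vector_Spaces.linear s t f" "Vector_Spaces.linear s t g"
  shows "Vector_Spaces.linear s t (\<lambda>x. f x + g x)"
proof -
  interpret vector_space_pair s t
    using assms by (simp add: Vector_Spaces.linear_iff vector_space_pair_def)
  show ?thesis using assms by (rule linear_compose_add)
qed

lemma pm_decompose:
  "p = (\<Sum>k\<in>Poly_Mapping.keys p. pm_scale (Poly_Mapping.lookup p k) (Poly_Mapping.single k 1))"
proof (rule poly_mapping_eqI)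
  fix k
  show "Poly_Mapping.lookup p k = Poly_Mapping.lookup
    (\<Sum>k\<in>Poly_Mapping.keys p. pm_scale (Poly_Mapping.lookup p k) (Poly_Mapping.single k 1)) k"
    by (simp add: lookup_sum lookup_single when_def if_distrib in_keys_iff cong: if_cong)
qed

text \<open>
  The functions \<open>single k 1\<close> span, so a linear map is determined by its values on them. This is the
  workhorse for the identities between operators below.
\<close>

lemma linear_pm_eq:
  assumes "Vector_Spaces.linear pm_scale sc f" "Vector_Spaces.linear pm_scale sc g"
    and "\<And>k. k \<in> Poly_Mapping.keys p \<Longrightarrow> f (Poly_Mapping.single k 1) = g (Poly_Mapping.single k 1)"
  shows "f p = g p"
proof -
  have expand: "h p = (\<Sum>k\<in>Poly_Mapping.keys p. sc (Poly_Mapping.lookup p k) (h (Poly_Mapping.single k 1)))"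
    if "Vector_Spaces.linear pm_scale sc h" for h
    by (subst (1) pm_decompose) (simp only: lin_sum[OF that] lin_scale[OF that])
  have "f p = (\<Sum>k\<in>Poly_Mapping.keys p. sc (Poly_Mapping.lookup p k) (f (Poly_Mapping.single k 1)))"
    by (rule expand) fact
  also have "\<dots> = (\<Sum>k\<in>Poly_Mapping.keys p. sc (Poly_Mapping.lookup p k) (g (Poly_Mapping.single k 1)))"
    using assms(3) by simp
  also have "\<dots> = g p"
    by (rule expand[symmetric]) fact
  finally show ?thesis .
qed

lemma pm_induct:
  assumes "P 0" "\<And>k. k \<in> Poly_Mapping.keys p \<Longrightarrow> P (Poly_Mapping.single k 1)"
    and "\<And>c q. P q \<Longrightarrow> P (pm_scale c q)" "\<And>q r. P q \<Longrightarrow> P r \<Longrightarrow> P (q + r)"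
  shows "P p"
proof -
  have "P (\<Sum>k\<in>S. pm_scale (Poly_Mapping.lookup p k) (Poly_Mapping.single k 1))"
    if "finite S" "S \<subseteq> Poly_Mapping.keys p" for S
    using that
  proof (induction S)
    case (insert x F)
    then show ?case
      using assms(3)[OF assms(2)[of x], of "Poly_Mapping.lookup p x"] assms(4) by simp
  qed (simp add: assms(1))
  from this[of "Poly_Mapping.keys p"] show ?thesis by (subst pm_decompose) auto
qed

definition lin_ext :: "(complex \<Rightarrow> 'w \<Rightarrow> 'w) \<Rightarrow> ('k \<Rightarrow> 'w) \<Rightarrow> ('k \<Rightarrow>\<^sub>0 complex) \<Rightarrow> 'w::ab_group_add"
  where "lin_ext sc g p = (\<Sum>k\<in>Poly_Mapping.keys p. sc (Poly_Mapping.lookup p k) (g k))"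

lemma lin_ext_superset:
  assumes "vector_space sc" "finite S" "Poly_Mapping.keys p \<subseteq> S"
  shows "lin_ext sc g p = (\<Sum>k\<in>S. sc (Poly_Mapping.lookup p k) (g k))"
proof -
  interpret vector_space sc by fact
  show ?thesis
    unfolding lin_ext_def using assms by (intro sum.mono_neutral_left) (auto simp: in_keys_iff)
qed

lemma linear_lin_ext:
  assumes "vector_space sc"
  shows "Vector_Spaces.linear pm_scale sc (lin_ext sc g)"
proof -
  interpret vector_space sc by fact
  show ?thesis
  proof (rule linearI)
    fix p q :: "'b \<Rightarrow>\<^sub>0 complex" and c
    let ?S = "Poly_Mapping.keys p \<union> Poly_Mapping.keys q"
    have "lin_ext sc g (p + q) = (\<Sum>k\<in>?S. sc (Poly_Mapping.lookup (p + q) k) (g k))"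
      by (rule lin_ext_superset) (use assms Poly_Mapping.keys_add[of p q] in auto)
    also have "\<dots> = lin_ext sc g p + lin_ext sc g q"
      by (simp add: lin_ext_superset[OF assms, of ?S] lookup_add scale_left_distrib sum.distrib)
    finally show "lin_ext sc g (p + q) = lin_ext sc g p + lin_ext sc g q" .
    have "Poly_Mapping.keys (pm_scale c p) \<subseteq> Poly_Mapping.keys p"
      by (auto simp: in_keys_iff)
    then show "lin_ext sc g (pm_scale c p) = sc c (lin_ext sc g p)"
      by (simp add: lin_ext_superset[OF assms, of "Poly_Mapping.keys p"] scale_sum_right)
  qed unfold_locales
qed

lemma lin_ext_single:
  assumes "vector_space sc"
  shows "lin_ext sc g (Poly_Mapping.single k c) = sc c (g k)"
proof -
  interpret vector_space sc by fact
  show ?thesis by (simp add: lin_ext_superset[OF assms, of "{k}"])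
qed

lemma pm_scale_mult_left: "pm_scale c p * q = pm_scale c (p * q)"
  for p q :: "'k::monoid_add \<Rightarrow>\<^sub>0 complex"
  by (simp add: mult_map_scale_conv_mult mult.assoc)

lemma pm_scale_mult_right: "p * pm_scale c q = pm_scale c (p * q)"
  for p q :: "'k::monoid_add \<Rightarrow>\<^sub>0 complex"
proof -
  have "p * Poly_Mapping.single 0 c = Poly_Mapping.single 0 c * p"
    by (rule linear_pm_eq[of pm_scale "\<lambda>p. p * Poly_Mapping.single 0 c" "\<lambda>p. Poly_Mapping.single 0 c * p" p])
      (auto intro!: linearI pm.vector_space_axioms
        simp: distrib_left distrib_right pm_scale_mult_left mult_single mult_map_scale_conv_mult mult.commute[of _ c]
        simp flip: mult.assoc)
  then show ?thesis by (simp add: mult_map_scale_conv_mult flip: mult.assoc)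
qed

lemma linear_mult_left: "Vector_Spaces.linear pm_scale pm_scale (\<lambda>q. p * q)"
  for p :: "'k::monoid_add \<Rightarrow>\<^sub>0 complex"
  by (intro linearI pm.vector_space_axioms) (auto simp: distrib_left pm_scale_mult_right)

lemma linear_mult_right: "Vector_Spaces.linear pm_scale pm_scale (\<lambda>q. q * p)"
  for p :: "'k::monoid_add \<Rightarrow>\<^sub>0 complex"
  by (intro linearI pm.vector_space_axioms) (auto simp: distrib_right pm_scale_mult_left)

section \<open>Polynomials and derivations\<close>

text \<open>With multisets as exponents, the convolution product is the product of polynomials.\<close>

type_synonym 'x mpoly = "'x multiset \<Rightarrow>\<^sub>0 complex"

abbreviation monomial :: "'x multiset \<Rightarrow> 'x mpoly"
  where "monomial \<mu> \<equiv> Poly_Mapping.single \<mu> 1"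

abbreviation var :: "'x \<Rightarrow> 'x mpoly"
  where "var x \<equiv> monomial {#x#}"

lemma monomial_add_mset: "monomial (add_mset x \<mu>) = var x * monomial \<mu>"
  by (simp add: mult_single)

lemma monomial_empty [simp]: "monomial {#} = 1"
  by (metis single_one zero_multiset_def)

definition derivation :: "('x mpoly \<Rightarrow> 'x mpoly) \<Rightarrow> bool"
  where "derivation \<delta> \<longleftrightarrow> Vector_Spaces.linear pm_scale pm_scale \<delta> \<and>
    (\<forall>p q. \<delta> (p * q) = \<delta> p * q + p * \<delta> q)"

lemma derivation_linear: "derivation \<delta> \<Longrightarrow> Vector_Spaces.linear pm_scale pm_scale \<delta>"
  by (simp add: derivation_def)

lemma derivation_mult: "derivation \<delta> \<Longrightarrow> \<delta> (p * q) = \<delta> p * q + p * \<delta> q"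
  by (simp add: derivation_def)

lemma derivationI:
  assumes "\<And>p q. \<delta> (p + q) = \<delta> p + \<delta> q" "\<And>c p. \<delta> (pm_scale c p) = pm_scale c (\<delta> p)"
    "\<And>p q. \<delta> (p * q) = \<delta> p * q + p * \<delta> q"
  shows "derivation \<delta>"
  unfolding derivation_def using assms by (auto intro!: linearI pm.vector_space_axioms)

lemmas derivation_simps = linear_simps[OF derivation_linear] derivation_mult

lemma derivation_one: "derivation \<delta> \<Longrightarrow> \<delta> 1 = 0"
  using derivation_mult[of \<delta> 1 1] by simp

lemma derivation_eqI:
  assumes "derivation \<delta>" "derivation \<epsilon>" "\<And>x. \<delta> (var x) = \<epsilon> (var x)"
  shows "\<delta> p = \<epsilon> p"
proof (rule linear_pm_eq[of pm_scale \<delta> \<epsilon> p])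
  show "\<delta> (monomial \<mu>) = \<epsilon> (monomial \<mu>)" for \<mu>
  proof (induction \<mu>)
    case (add x \<mu>)
    then show ?case
      by (simp add: monomial_add_mset[of x \<mu>] derivation_mult assms)
  qed (simp add: derivation_one assms)
qed (use assms in \<open>auto simp: derivation_linear\<close>)

lemma derivation_commutator:
  assumes "derivation \<delta>" "derivation \<epsilon>"
  shows "derivation (\<lambda>p. \<delta> (\<epsilon> p) - \<epsilon> (\<delta> p))"
  by (rule derivationI)
    (simp_all add: derivation_simps[OF assms(1)] derivation_simps[OF assms(2)] algebra_simps
      pm.scale_right_diff_distrib)

lemma derivation_add: "derivation \<delta> \<Longrightarrow> derivation \<epsilon> \<Longrightarrow> derivation (\<lambda>p. \<delta> p + \<epsilon> p)"
  by (rule derivationI) (simp_all add: derivation_simps algebra_simps pm.scale_right_distrib)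

lemma derivation_diff: "derivation \<delta> \<Longrightarrow> derivation \<epsilon> \<Longrightarrow> derivation (\<lambda>p. \<delta> p - \<epsilon> p)"
  by (rule derivationI) (simp_all add: derivation_simps algebra_simps pm.scale_right_diff_distrib)

lemma derivation_scale: "derivation \<delta> \<Longrightarrow> derivation (\<lambda>p. pm_scale c (\<delta> p))"
  by (rule derivationI)
    (simp_all add: derivation_simps algebra_simps pm.scale_right_distrib
      pm_scale_mult_left pm_scale_mult_right)

lemma derivation_zero: "derivation (\<lambda>p. 0)"
  by (rule derivationI) auto

lemma derivation_sum: "(\<And>i. i \<in> S \<Longrightarrow> derivation (\<delta> i)) \<Longrightarrow> derivation (\<lambda>p. \<Sum>i\<in>S. \<delta> i p)"
  by (induction S rule: infinite_finite_induct) (auto intro!: derivation_zero derivation_add)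

lemma derivation_power: "derivation \<delta> \<Longrightarrow> \<delta> (p ^ Suc k) = of_nat (Suc k) * (p ^ k * \<delta> p)"
  by (induction k) (simp_all add: derivation_simps algebra_simps)

lemma derivation_prod_mset:
  "derivation \<delta> \<Longrightarrow> \<delta> (\<Prod>c\<in>#\<chi>. u c) = (\<Sum>c\<in>#\<chi>. \<delta> (u c) * (\<Prod>c\<in>#\<chi> - {#c#}. u c))"
proof (induction \<chi>)
  case empty then show ?case by (simp add: derivation_one)
next
  case (add x \<chi>)
  have "(\<Sum>c\<in>#\<chi>. \<delta> (u c) * (\<Prod>c\<in>#add_mset x \<chi> - {#c#}. u c)) =
      (\<Sum>c\<in>#\<chi>. u x * (\<delta> (u c) * (\<Prod>c\<in>#\<chi> - {#c#}. u c)))"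
    by (intro arg_cong[of _ _ sum_mset] image_mset_cong)
      (auto simp: algebra_simps dest!: multi_member_split)
  then show ?case using add by (simp add: derivation_mult sum_mset_distrib_left image_mset.compositionality comp_def)
qed

text \<open>
  The derivation that takes the letter \<open>x\<close> to \<open>d x\<close>; the sum over \<open>\<mu>\<close> is the Leibniz rule.
\<close>

definition deriv :: "('x \<Rightarrow> 'x mpoly) \<Rightarrow> 'x mpoly \<Rightarrow> 'x mpoly"
  where "deriv d = lin_ext pm_scale (\<lambda>\<mu>. \<Sum>x\<in>#\<mu>. d x * monomial (\<mu> - {#x#}))"

lemma derivation_deriv: "derivation (deriv d)"
proof -
  note l = linear_lin_ext[OF pm.vector_space_axioms]
  have s: "deriv d (monomial \<mu>) = (\<Sum>x\<in>#\<mu>. d x * monomial (\<mu> - {#x#}))" for \<mu>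
    unfolding deriv_def by (simp add: lin_ext_single pm.vector_space_axioms)
  have L: "Vector_Spaces.linear pm_scale pm_scale (deriv d)"
    unfolding deriv_def by (rule l)
  have *: "(\<Sum>x\<in>#\<mu>. d x * monomial (\<mu> + \<nu> - {#x#})) = deriv d (monomial \<mu>) * monomial \<nu>" for \<mu> \<nu>
    unfolding s sum_mset_distrib_right
    by (intro arg_cong[of _ _ sum_mset] image_mset_cong)
      (auto simp: mult.assoc mult_single dest!: multi_member_split)
  have mm: "deriv d (monomial \<mu> * monomial \<nu>) = deriv d (monomial \<mu>) * monomial \<nu> + monomial \<mu> * deriv d (monomial \<nu>)" for \<mu> \<nu>
  proof -
    have "deriv d (monomial \<mu> * monomial \<nu>) = deriv d (monomial (\<mu> + \<nu>))" by (simp add: mult_single)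
    also have "\<dots> = (\<Sum>x\<in>#\<mu>. d x * monomial (\<mu> + \<nu> - {#x#})) + (\<Sum>x\<in>#\<nu>. d x * monomial (\<nu> + \<mu> - {#x#}))"
      by (simp add: s add.commute)
    finally show ?thesis using *[of \<mu> \<nu>] *[of \<nu> \<mu>] by (simp add: mult.commute)
  qed
  have m1: "deriv d (monomial \<mu> * q) = deriv d (monomial \<mu>) * q + monomial \<mu> * deriv d q" for \<mu> q
    by (rule linear_pm_eq[of pm_scale "\<lambda>q. deriv d (monomial \<mu> * q)" "\<lambda>q. deriv d (monomial \<mu>) * q + monomial \<mu> * deriv d q"])
      (auto intro!: linearI pm.vector_space_axioms simp: linear_simps[OF L] distrib_left distrib_right
        pm_scale_mult_left pm_scale_mult_right pm.scale_right_distrib mm)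
  have "deriv d (p * q) = deriv d p * q + p * deriv d q" for p q
    by (rule linear_pm_eq[of pm_scale "\<lambda>p. deriv d (p * q)" "\<lambda>p. deriv d p * q + p * deriv d q"])
      (auto intro!: linearI pm.vector_space_axioms simp: linear_simps[OF L] distrib_left distrib_right
        pm_scale_mult_left pm_scale_mult_right pm.scale_right_distrib m1)
  with L show ?thesis by (simp add: derivation_def)
qed

lemma deriv_var [simp]: "deriv d (var x) = d x"
  unfolding deriv_def by (simp add: lin_ext_single pm.vector_space_axioms)

definition homogeneous :: "nat \<Rightarrow> 'x mpoly \<Rightarrow> bool"
  where "homogeneous r p \<longleftrightarrow> (\<forall>\<mu>\<in>Poly_Mapping.keys p. size \<mu> = r)"

lemma homogeneous_zero [simp]: "homogeneous r 0"
  by (simp add: homogeneous_def)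

lemma homogeneous_mono [simp]: "homogeneous r (monomial \<mu>) \<longleftrightarrow> size \<mu> = r"
  by (auto simp: homogeneous_def)

lemma homogeneous_add: "homogeneous r p \<Longrightarrow> homogeneous r q \<Longrightarrow> homogeneous r (p + q)"
  using Poly_Mapping.keys_add[of p q] by (auto simp: homogeneous_def)

lemma homogeneous_scale: "homogeneous r p \<Longrightarrow> homogeneous r (pm_scale c p)"
  by (auto simp: homogeneous_def in_keys_iff)

lemma homogeneous_sum: "(\<And>i. i \<in> S \<Longrightarrow> homogeneous r (f i)) \<Longrightarrow> homogeneous r (sum f S)"
  by (induction S rule: infinite_finite_induct) (auto intro: homogeneous_add)

lemma homogeneous_mult: "homogeneous r p \<Longrightarrow> homogeneous s q \<Longrightarrow> homogeneous (r + s) (p * q)"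
  using keys_mult[of p q] by (fastforce simp: homogeneous_def)

lemma homogeneous_one [simp]: "homogeneous 0 1"
  by (metis homogeneous_mono monomial_empty size_empty)

lemma homogeneous_power: "homogeneous r p \<Longrightarrow> homogeneous (k * r) (p ^ k)"
  by (induction k) (auto intro!: homogeneous_mult)

lemma homogeneous_lin_ext:
  assumes "\<And>k. homogeneous r (g k)" shows "homogeneous r (lin_ext pm_scale g p)"
  unfolding lin_ext_def by (intro homogeneous_sum homogeneous_scale assms)

lemma homogeneous_deriv:
  assumes "\<And>x. homogeneous 1 (d x)" "homogeneous r p"
  shows "homogeneous r (deriv d p)"
proof -
  have "homogeneous r (deriv d (monomial \<mu>))" if "size \<mu> = r" for \<mu>
    using that
  proof (induction \<mu> arbitrary: r)
    case empty
    then show ?case using derivation_one[OF derivation_deriv, of d] by simp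
  next
    case (add x \<mu>)
    then obtain s where r: "r = Suc s" "size \<mu> = s" by auto
    have "homogeneous (1 + s) (d x * monomial \<mu>)" "homogeneous (1 + s) (var x * deriv d (monomial \<mu>))"
      using add r assms(1) by (auto intro!: homogeneous_mult simp del: One_nat_def)
    then show ?case
      using r by (simp add: monomial_add_mset[of x \<mu>] derivation_mult[OF derivation_deriv] homogeneous_add)
  qed
  note * = this
  have "deriv d p = (\<Sum>\<mu>\<in>Poly_Mapping.keys p. pm_scale (Poly_Mapping.lookup p \<mu>) (deriv d (monomial \<mu>)))"
    by (subst pm_decompose) (simp only: linear_simps[OF derivation_linear[OF derivation_deriv]])
  also have "homogeneous r \<dots>"
    using assms(2) * by (intro homogeneous_sum homogeneous_scale) (auto simp: homogeneous_def)
  finally show ?thesis .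
qed



section \<open>Symmetrization over pre-Lie algebras\<close>

definition linear_form :: "('x \<Rightarrow>\<^sub>0 complex) \<Rightarrow> 'x mpoly"
  where "linear_form = lin_ext pm_scale var"

lemma linear_linear_form: "Vector_Spaces.linear pm_scale pm_scale linear_form"
  unfolding linear_form_def by (rule linear_lin_ext[OF pm.vector_space_axioms])

lemma linear_form_single: "linear_form (Poly_Mapping.single x c) = pm_scale c (var x)"
  unfolding linear_form_def by (simp add: lin_ext_single pm.vector_space_axioms)

lemma homogeneous_linear_form: "homogeneous 1 (linear_form q)"
  unfolding linear_form_def by (rule homogeneous_lin_ext) simp

text \<open>
  The letters are a basis of a pre-Lie algebra with product \<open>circ\<close>, acting by \<open>op\<close> through the
  Lie bracket \<open>x \<circ> y - y \<circ> x\<close>. The last axiom is the left-symmetry of the associator,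
  \<open>x \<circ> (y \<circ> z) - (x \<circ> y) \<circ> z = y \<circ> (x \<circ> z) - (y \<circ> x) \<circ> z\<close>, with vectors written as linear
  forms, so that the left multiplication by \<open>x\<close> becomes a derivation.
\<close>

locale pre_lie_module = vector_space sc
  for sc :: "complex \<Rightarrow> 'w::ab_group_add \<Rightarrow> 'w" +
  fixes circ :: "'x \<Rightarrow> 'x \<Rightarrow> ('x \<Rightarrow>\<^sub>0 complex)"
    and op :: "'x \<Rightarrow> 'w \<Rightarrow> 'w"
    and w0 :: 'w
  assumes op_linear: "Vector_Spaces.linear sc sc (op x)"
    and op_commutator: "op x (op y v) - op y (op x v) =
      lin_ext sc (\<lambda>z. op z v) (circ x y) - lin_ext sc (\<lambda>z. op z v) (circ y x)"
    and pre_lie: "deriv (\<lambda>v. linear_form (circ x v)) (linear_form (circ y z))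
        - deriv (\<lambda>v. linear_form (circ y v)) (linear_form (circ x z))
      = lin_ext pm_scale (\<lambda>u. linear_form (circ u z)) (circ x y)
        - lin_ext pm_scale (\<lambda>u. linear_form (circ u z)) (circ y x)"
begin

definition D :: "'x \<Rightarrow> 'x mpoly \<Rightarrow> 'x mpoly"
  where "D x = deriv (\<lambda>y. linear_form (circ x y))"

lemma derivation_D: "derivation (D x)"
  by (simp add: D_def derivation_deriv)

lemmas linear_D = derivation_linear[OF derivation_D]

lemma D_var [simp]: "D x (var y) = linear_form (circ x y)"
  by (simp add: D_def)

lemma homogeneous_D: "homogeneous r p \<Longrightarrow> homogeneous r (D x p)"
  unfolding D_def by (intro homogeneous_deriv homogeneous_linear_form)

lemma derivation_lin_ext_D: "derivation (\<lambda>p. lin_ext pm_scale (\<lambda>z. D z p) q)"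
  unfolding lin_ext_def by (intro derivation_sum derivation_scale derivation_D)

text \<open>
  Left multiplications of a pre-Lie algebra represent its Lie algebra. Both sides are derivations, so
  it suffices to compare them on letters, where this is the pre-Lie identity.
\<close>

lemma D_commutator:
  "D x (D y p) - D y (D x p) =
    lin_ext pm_scale (\<lambda>z. D z p) (circ x y) - lin_ext pm_scale (\<lambda>z. D z p) (circ y x)"
proof (rule derivation_eqI[where p = p])
  show "derivation (\<lambda>p. D x (D y p) - D y (D x p))"
    by (intro derivation_commutator derivation_D)
  show "derivation (\<lambda>p. lin_ext pm_scale (\<lambda>z. D z p) (circ x y) - lin_ext pm_scale (\<lambda>z. D z p) (circ y x))"
    by (intro derivation_diff derivation_lin_ext_D)
  show "D x (D y (var v)) - D y (D x (var v)) =
    lin_ext pm_scale (\<lambda>z. D z (var v)) (circ x y) - lin_ext pm_scale (\<lambda>z. D z (var v)) (circ y x)" for v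
    using pre_lie[of x y v] by (simp only: D_var) (simp only: D_def)
qed

text \<open>
  A form of degree \<open>r + 1\<close> is reduced to forms of degree \<open>r\<close> by splitting off an arbitrary letter from
  each monomial. The recursion runs over the degree, because \<open>D x\<close> changes the monomial but not its
  degree.
\<close>

primrec symm_map_aux :: "nat \<Rightarrow> 'x multiset \<Rightarrow> 'w" where
  "symm_map_aux 0 \<mu> = w0"
| "symm_map_aux (Suc r) \<mu> = (let x = (SOME x. x \<in># \<mu>) in
     op x (symm_map_aux r (\<mu> - {#x#})) - lin_ext sc (symm_map_aux r) (D x (monomial (\<mu> - {#x#}))))"

definition symm_map :: "'x mpoly \<Rightarrow> 'w"
  where "symm_map = lin_ext sc (\<lambda>\<mu>. symm_map_aux (size \<mu>) \<mu>)"

lemma linear_symm_map: "Vector_Spaces.linear pm_scale sc symm_map"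
  unfolding symm_map_def by (rule linear_lin_ext[OF vector_space_axioms])

lemma symm_map_one: "symm_map 1 = w0"
  unfolding symm_map_def monomial_empty[symmetric] by (simp only: lin_ext_single[OF vector_space_axioms]) simp

lemma symm_map_homogeneous:
  "homogeneous r p \<Longrightarrow> symm_map p = lin_ext sc (symm_map_aux r) p"
  unfolding symm_map_def lin_ext_def homogeneous_def by (intro sum.cong) auto

lemma symm_map_mono_choice:
  assumes "\<mu> \<noteq> {#}"
  shows "\<exists>x\<in>#\<mu>. symm_map (monomial \<mu>) =
    op x (symm_map (monomial (\<mu> - {#x#}))) - symm_map (D x (monomial (\<mu> - {#x#})))"
proof -
  define x where "x = (SOME x. x \<in># \<mu>)"
  have x: "x \<in># \<mu>"
    unfolding x_def by (rule someI_ex) (use assms in auto)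
  then obtain r where r: "size \<mu> = Suc r" "size (\<mu> - {#x#}) = r"
    by (metis size_Suc_Diff1)
  have h: "homogeneous r (D x (monomial (\<mu> - {#x#})))"
    by (rule homogeneous_D) (simp add: r)
  show ?thesis
    by (rule bexI[OF _ x])
      (simp add: symm_map_homogeneous[OF h], simp add: symm_map_def lin_ext_single[OF vector_space_axioms] r Let_def flip: x_def)
qed

text \<open>
  The defining rule in degree \<open>r\<close>, extended by linearity to all forms of this degree and to
  combinations of letters.
\<close>

lemma symm_map_rule_linear:
  assumes "\<And>x \<mu>. size \<mu> = r \<Longrightarrow>
      symm_map (var x * monomial \<mu>) = op x (symm_map (monomial \<mu>)) - symm_map (D x (monomial \<mu>))"
    and "homogeneous r p"
  shows "symm_map (var x * p) = op x (symm_map p) - symm_map (D x p)"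
    and "symm_map (linear_form q * p) =
      lin_ext sc (\<lambda>z. op z (symm_map p)) q - symm_map (lin_ext pm_scale (\<lambda>z. D z p) q)"
proof -
  note ext = linear_lin_ext[OF vector_space_axioms] linear_lin_ext[OF pm.vector_space_axioms]
  show *: "symm_map (var x * p) = op x (symm_map p) - symm_map (D x p)" for x
  proof (rule linear_pm_eq[of sc "\<lambda>p. symm_map (var x * p)" "\<lambda>p. op x (symm_map p) - symm_map (D x p)" p])
    show "Vector_Spaces.linear pm_scale sc (\<lambda>p. symm_map (var x * p))"
      by (rule lin_comp[OF linear_mult_left linear_symm_map])
    show "Vector_Spaces.linear pm_scale sc (\<lambda>p. op x (symm_map p) - symm_map (D x p))"
      by (rule lin_minus[OF lin_comp[OF linear_symm_map op_linear] lin_comp[OF linear_D linear_symm_map]])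
  qed (use assms in \<open>auto simp: homogeneous_def\<close>)
  show "symm_map (linear_form q * p) =
      lin_ext sc (\<lambda>z. op z (symm_map p)) q - symm_map (lin_ext pm_scale (\<lambda>z. D z p) q)"
  proof (rule linear_pm_eq[of sc "\<lambda>q. symm_map (linear_form q * p)"
        "\<lambda>q. lin_ext sc (\<lambda>z. op z (symm_map p)) q - symm_map (lin_ext pm_scale (\<lambda>z. D z p) q)" q])
    show "Vector_Spaces.linear pm_scale sc (\<lambda>q. symm_map (linear_form q * p))"
      by (rule lin_comp[OF lin_comp[OF linear_linear_form linear_mult_right] linear_symm_map])
    show "Vector_Spaces.linear pm_scale sc
        (\<lambda>q. lin_ext sc (\<lambda>z. op z (symm_map p)) q - symm_map (lin_ext pm_scale (\<lambda>z. D z p) q))"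
      by (rule lin_minus[OF ext(1) lin_comp[OF ext(2) linear_symm_map]])
    show "symm_map (linear_form (Poly_Mapping.single k 1) * p) =
        lin_ext sc (\<lambda>z. op z (symm_map p)) (Poly_Mapping.single k 1) -
        symm_map (lin_ext pm_scale (\<lambda>z. D z p) (Poly_Mapping.single k 1))" for k
      by (simp add: linear_form_single * lin_ext_single[OF vector_space_axioms]
          lin_ext_single[OF pm.vector_space_axioms] del: map_single)
  qed
qed

text \<open>
  The value on a monomial does not depend on the letter that was split off. If \<open>y\<close> was chosen and \<open>x\<close> is
  another letter, both are split off in either order by the induction hypothesis; the two results
  differ by \<open>[x, y] \<Psi> - \<Psi> [D\<^sub>x, D\<^sub>y]\<close> and by the same expression for the vector
  \<open>x \<circ> y - y \<circ> x\<close>, and these cancel.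
\<close>

lemma symm_map_var_mono:
  "size \<mu> = r \<Longrightarrow> symm_map (var x * monomial \<mu>) = op x (symm_map (monomial \<mu>)) - symm_map (D x (monomial \<mu>))"
proof (induction r arbitrary: x \<mu> rule: less_induct)
  case (less r)
  note [simp] = linear_simps[OF linear_symm_map] linear_simps[OF op_linear]
  obtain y where y: "y \<in># add_mset x \<mu>"
    and eq: "symm_map (monomial (add_mset x \<mu>)) = op y (symm_map (monomial (add_mset x \<mu> - {#y#})))
      - symm_map (D y (monomial (add_mset x \<mu> - {#y#})))"
    using symm_map_mono_choice[OF add_mset_not_empty, of x \<mu>] by blast
  show ?case
  proof (cases "y = x")
    case True
    with eq show ?thesis by (simp flip: monomial_add_mset)
  next
    case False
    with y obtain \<xi> where \<mu>: "\<mu> = add_mset y \<xi>"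
      by (auto dest: multi_member_split)
    define s where "s = size \<xi>"
    have s: "s < r" using less.prems \<mu> by (simp add: s_def)
    have IH: "symm_map (var x * p) = op x (symm_map p) - symm_map (D x p)"
      "symm_map (linear_form q * p) =
        lin_ext sc (\<lambda>z. op z (symm_map p)) q - symm_map (lin_ext pm_scale (\<lambda>z. D z p) q)"
      if "homogeneous s p" for x p q
      using symm_map_rule_linear(1)[of s p x] symm_map_rule_linear(2)[of s p q] less.IH[OF s] that
      by blast+
    let ?m = "monomial \<xi>"
    have hm: "homogeneous s ?m" by (simp add: s_def)
    have one: "symm_map (var x * (D y ?m) + linear_form (circ y x) * ?m) = op x (symm_map (D y ?m))
        - symm_map (D x (D y ?m)) + lin_ext sc (\<lambda>z. op z (symm_map ?m)) (circ y x)
        - symm_map (lin_ext pm_scale (\<lambda>z. D z ?m) (circ y x))" for x y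
      by (simp add: IH(1)[OF homogeneous_D[OF hm]] IH(2)[OF hm])
    have two: "op y (symm_map (var x * ?m)) - symm_map (D y (var x * ?m)) =
        op y (op x (symm_map ?m)) - op y (symm_map (D x ?m)) - (op x (symm_map (D y ?m))
        - symm_map (D x (D y ?m)) + lin_ext sc (\<lambda>z. op z (symm_map ?m)) (circ y x)
        - symm_map (lin_ext pm_scale (\<lambda>z. D z ?m) (circ y x)))" for x y
      by (subst one[symmetric])
        (simp add: derivation_mult[OF derivation_D] IH(1)[OF hm] add.commute)
    have "symm_map (D x (D y ?m)) - symm_map (D y (D x ?m)) =
        symm_map (lin_ext pm_scale (\<lambda>z. D z ?m) (circ x y)) - symm_map (lin_ext pm_scale (\<lambda>z. D z ?m) (circ y x))"
      using arg_cong[OF D_commutator[of x y ?m], of symm_map] by simp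
    then have "op y (symm_map (var x * ?m)) - symm_map (D y (var x * ?m)) =
        op x (symm_map (var y * ?m)) - symm_map (D x (var y * ?m))"
      unfolding two using op_commutator[of x y "symm_map ?m"] by (simp add: algebra_simps)
    moreover have "monomial (add_mset x \<mu> - {#y#}) = var x * ?m"
      using \<mu> False monomial_add_mset[of x \<xi>] by simp
    ultimately show ?thesis
      using eq monomial_add_mset[of x \<mu>] monomial_add_mset[of y \<xi>] unfolding \<mu> by (simp only:)
  qed
qed

text \<open>
  For the free module of rank one over the enveloping algebra this map is the isomorphism of Oudom and
  Guin between the symmetric algebra of a pre-Lie algebra and its enveloping algebra.
\<close>

theorem symm_map_var: "symm_map (var x * p) = op x (symm_map p) - symm_map (D x p)"
proof (rule linear_pm_eq[of sc "\<lambda>p. symm_map (var x * p)" "\<lambda>p. op x (symm_map p) - symm_map (D x p)" p])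
  show "Vector_Spaces.linear pm_scale sc (\<lambda>p. symm_map (var x * p))"
    by (rule lin_comp[OF linear_mult_left linear_symm_map])
  show "Vector_Spaces.linear pm_scale sc (\<lambda>p. op x (symm_map p) - symm_map (D x p))"
    by (rule lin_minus[OF lin_comp[OF linear_symm_map op_linear] lin_comp[OF linear_D linear_symm_map]])
qed (rule symm_map_var_mono[OF refl])

end



section \<open>Polynomials on \<open>V \<otimes> A\<close>\<close>

locale based_algebra =
  fixes A :: "(complex, 'a) module" and B :: "'a set"
  assumes algebra_A: "algebra (class_ring :: complex ring) A"
    and basis_B: "vectorspace.basis (class_ring :: complex ring) A B"
begin

sublocale A: algebra "class_ring :: complex ring" A
  by (rule algebra_A)

lemma vectorspace_A: "vectorspace (class_ring :: complex ring) A"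
  by (simp add: vectorspace_def A.module class_field)

sublocale A: vectorspace "class_ring :: complex ring" A
  by (rule vectorspace_A)

lemma A_closed [simp, intro]:
  "a \<in> carrier A \<Longrightarrow> b \<in> carrier A \<Longrightarrow> a \<oplus>\<^bsub>A\<^esub> b \<in> carrier A"
  "a \<in> carrier A \<Longrightarrow> b \<in> carrier A \<Longrightarrow> a \<otimes>\<^bsub>A\<^esub> b \<in> carrier A"
  "a \<in> carrier A \<Longrightarrow> c \<odot>\<^bsub>A\<^esub> a \<in> carrier A"
  "\<one>\<^bsub>A\<^esub> \<in> carrier A" "\<zero>\<^bsub>A\<^esub> \<in> carrier A"
  using A.smult_closed[of c a] by auto

lemma B_carrier: "B \<subseteq> carrier A" and B_indpt: "A.lin_indpt B" and B_span: "A.span B = carrier A"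
  using basis_B by (auto simp: A.basis_def)

lemma B_carrier' [simp, intro]: "b \<in> B \<Longrightarrow> b \<in> carrier A"
  using B_carrier by auto

lemma carrier_induct [consumes 1, case_names zero basis add smult]:
  assumes "a \<in> carrier A" and zero: "P \<zero>\<^bsub>A\<^esub>" and basis: "\<And>b. b \<in> B \<Longrightarrow> P b"
    and add: "\<And>a b. a \<in> carrier A \<Longrightarrow> b \<in> carrier A \<Longrightarrow> P a \<Longrightarrow> P b \<Longrightarrow> P (a \<oplus>\<^bsub>A\<^esub> b)"
    and smult: "\<And>c a. a \<in> carrier A \<Longrightarrow> P a \<Longrightarrow> P (c \<odot>\<^bsub>A\<^esub> a)"
  shows "P a"
proof -
  have "submodule class_ring {a \<in> carrier A. P a} A"
    by (intro submodule.intro A.module) (auto intro: zero add smult)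
  moreover have "B \<subseteq> {a \<in> carrier A. P a}"
    using basis by auto
  ultimately have "A.span B \<subseteq> {a \<in> carrier A. P a}"
    by (intro A.span_is_subset)
  then show ?thesis using assms(1) B_span by auto
qed

definition eval_coords :: "('a \<Rightarrow>\<^sub>0 complex) \<Rightarrow> 'a"
  where "eval_coords p = A.lincomb (Poly_Mapping.lookup p) (Poly_Mapping.keys p)"

lemma eval_coords_superset:
  assumes "finite S" "Poly_Mapping.keys p \<subseteq> S" "S \<subseteq> carrier A"
  shows "eval_coords p = A.lincomb (Poly_Mapping.lookup p) S"
  unfolding eval_coords_def A.lincomb_def
  by (intro A.add.finprod_mono_neutral_cong_left) (use assms A.smult_l_null in \<open>auto simp: in_keys_iff\<close>)

lemma eval_coords_add:
  assumes "Poly_Mapping.keys p \<subseteq> B" "Poly_Mapping.keys q \<subseteq> B"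
  shows "eval_coords (p + q) = eval_coords p \<oplus>\<^bsub>A\<^esub> eval_coords q"
proof -
  let ?S = "Poly_Mapping.keys p \<union> Poly_Mapping.keys q"
  have S: "finite ?S" "?S \<subseteq> carrier A" using assms by auto
  have "eval_coords (p + q) = A.lincomb (Poly_Mapping.lookup (p + q)) ?S"
    using S Poly_Mapping.keys_add[of p q] by (intro eval_coords_superset)
  also have "\<dots> = A.lincomb (Poly_Mapping.lookup p) ?S \<oplus>\<^bsub>A\<^esub> A.lincomb (Poly_Mapping.lookup q) ?S"
    using A.lincomb_sum[OF S, of "Poly_Mapping.lookup p" "Poly_Mapping.lookup q"]
    by (simp add: lookup_add[abs_def])
  finally show ?thesis
    using S by (simp add: eval_coords_superset[of ?S])
qed

lemma eval_coords_scale: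
  assumes "Poly_Mapping.keys p \<subseteq> B"
  shows "eval_coords (pm_scale c p) = c \<odot>\<^bsub>A\<^esub> eval_coords p"
proof -
  have S: "finite (Poly_Mapping.keys p)" "Poly_Mapping.keys p \<subseteq> carrier A" using assms by auto
  have "eval_coords (pm_scale c p) = A.lincomb (Poly_Mapping.lookup (pm_scale c p)) (Poly_Mapping.keys p)"
    using S by (intro eval_coords_superset) (auto simp: in_keys_iff)
  also have "\<dots> = c \<odot>\<^bsub>A\<^esub> eval_coords p"
    using A.lincomb_smult[OF S(2), of "Poly_Mapping.lookup p" c]
    by (simp add: eval_coords_def lookup_pm_scale[abs_def])
  finally show ?thesis .
qed

lemma eval_coords_eq_0:
  assumes "Poly_Mapping.keys p \<subseteq> B" "eval_coords p = \<zero>\<^bsub>A\<^esub>"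
  shows "p = 0"
proof (rule ccontr)
  assume "p \<noteq> 0"
  then obtain b where "b \<in> Poly_Mapping.keys p" by fastforce
  then have "A.lin_dep B"
    unfolding A.lin_dep_def using assms
    by (intro exI[of _ "Poly_Mapping.keys p"] exI[of _ "Poly_Mapping.lookup p"] exI[of _ b])
      (auto simp: eval_coords_def in_keys_iff)
  with B_indpt show False by simp
qed

lemma keys_pm_scale: "Poly_Mapping.keys (pm_scale c p) \<subseteq> Poly_Mapping.keys p"
  by (auto simp: in_keys_iff)

lemma eval_coords_inj:
  assumes "Poly_Mapping.keys p \<subseteq> B" "Poly_Mapping.keys q \<subseteq> B" "eval_coords p = eval_coords q"
  shows "p = q"
proof -
  have k: "Poly_Mapping.keys (p - q) \<subseteq> B"
    using keys_diff[of p q] assms by blast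
  have c: "eval_coords r \<in> carrier A" if "Poly_Mapping.keys r \<subseteq> B" for r
    unfolding eval_coords_def using that by (intro A.lincomb_closed) auto
  have "eval_coords (p - q) \<oplus>\<^bsub>A\<^esub> eval_coords q = eval_coords q"
    using eval_coords_add[OF k assms(2)] assms(3) by (simp only: diff_add_cancel)
  then have "eval_coords (p - q) = \<zero>\<^bsub>A\<^esub>"
    by (metis A.add.r_cancel_one' A.add.m_comm c[OF k] c[OF assms(2)])
  then have "p - q = 0" by (rule eval_coords_eq_0[OF k])
  then show ?thesis by simp
qed

definition coords :: "'a \<Rightarrow> ('a \<Rightarrow>\<^sub>0 complex)"
  where "coords a = (THE p. Poly_Mapping.keys p \<subseteq> B \<and> eval_coords p = a)"

lemma coords_eqI: "Poly_Mapping.keys p \<subseteq> B \<Longrightarrow> eval_coords p = a \<Longrightarrow> coords a = p"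
  unfolding coords_def using eval_coords_inj by (intro the_equality) auto

lemma eval_coords_single: "b \<in> B \<Longrightarrow> eval_coords (Poly_Mapping.single b 1) = b"
  by (simp add: eval_coords_def A.lincomb_def A.smult_one[simplified])

lemma coords_basis: "b \<in> B \<Longrightarrow> coords b = Poly_Mapping.single b 1"
  by (intro coords_eqI eval_coords_single) auto

lemma eval_coords_0: "eval_coords 0 = \<zero>\<^bsub>A\<^esub>"
  by (simp add: eval_coords_def A.lincomb_def)

lemma eval_coords_coords: "a \<in> carrier A \<Longrightarrow> Poly_Mapping.keys (coords a) \<subseteq> B \<and> eval_coords (coords a) = a"
proof -
  assume "a \<in> carrier A"
  then have "\<exists>p. Poly_Mapping.keys p \<subseteq> B \<and> eval_coords p = a"
  proof (induction rule: carrier_induct)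
    case zero
    then show ?case by (intro exI[of _ 0]) (simp add: eval_coords_0)
  next
    case (basis b)
    then show ?case by (intro exI[of _ "Poly_Mapping.single b 1"]) (simp add: eval_coords_single)
  next
    case (add a b)
    then obtain p q where "Poly_Mapping.keys p \<subseteq> B" "Poly_Mapping.keys q \<subseteq> B"
      "eval_coords p = a" "eval_coords q = b" by auto
    then show ?case
      using Poly_Mapping.keys_add[of p q] by (intro exI[of _ "p + q"]) (auto simp: eval_coords_add)
  next
    case (smult c a)
    then obtain p where "Poly_Mapping.keys p \<subseteq> B" "eval_coords p = a" by auto
    then show ?case
      using keys_pm_scale[of c p] by (intro exI[of _ "pm_scale c p"]) (auto simp: eval_coords_scale)
  qed
  then show ?thesis using coords_eqI by auto
qed

lemma coords_add:
  "a \<in> carrier A \<Longrightarrow> b \<in> carrier A \<Longrightarrow> coords (a \<oplus>\<^bsub>A\<^esub> b) = coords a + coords b"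
  using eval_coords_coords[of a] eval_coords_coords[of b] Poly_Mapping.keys_add[of "coords a" "coords b"]
  by (intro coords_eqI) (auto simp: eval_coords_add)

lemma coords_smult: "a \<in> carrier A \<Longrightarrow> coords (c \<odot>\<^bsub>A\<^esub> a) = pm_scale c (coords a)"
  using eval_coords_coords[of a] keys_pm_scale[of c "coords a"]
  by (intro coords_eqI) (auto simp: eval_coords_scale)

lemma coords_zero: "coords \<zero>\<^bsub>A\<^esub> = 0"
  by (intro coords_eqI) (auto simp: eval_coords_0)

text \<open>
  The vector \<open>v\<^sub>i \<otimes> a\<close> in the basis of the letters \<open>(i, b)\<close>, \<open>b \<in> B\<close>, with \<open>v\<^sub>i\<close> numbered from 0.
\<close>

definition letters_of :: "nat \<Rightarrow> 'a \<Rightarrow> (nat \<times> 'a \<Rightarrow>\<^sub>0 complex)"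
  where "letters_of i a = lin_ext pm_scale (\<lambda>b. Poly_Mapping.single (i, b) 1) (coords a)"

lemma letters_of_simps:
  "a \<in> carrier A \<Longrightarrow> b \<in> carrier A \<Longrightarrow> letters_of i (a \<oplus>\<^bsub>A\<^esub> b) = letters_of i a + letters_of i b"
  "a \<in> carrier A \<Longrightarrow> letters_of i (c \<odot>\<^bsub>A\<^esub> a) = pm_scale c (letters_of i a)"
  "b \<in> B \<Longrightarrow> letters_of i b = Poly_Mapping.single (i, b) 1"
  "letters_of i \<zero>\<^bsub>A\<^esub> = 0"
  unfolding letters_of_def
  by (simp_all add: coords_add coords_smult coords_basis coords_zero
      linear_simps[OF linear_lin_ext[OF pm.vector_space_axioms]] lin_ext_single[OF pm.vector_space_axioms])

definition lin :: "nat \<Rightarrow> 'a \<Rightarrow> (nat \<times> 'a) mpoly"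
  where "lin i a = linear_form (letters_of i a)"

lemma lin_simps:
  "a \<in> carrier A \<Longrightarrow> b \<in> carrier A \<Longrightarrow> lin i (a \<oplus>\<^bsub>A\<^esub> b) = lin i a + lin i b"
  "a \<in> carrier A \<Longrightarrow> lin i (c \<odot>\<^bsub>A\<^esub> a) = pm_scale c (lin i a)"
  "b \<in> B \<Longrightarrow> lin i b = var (i, b)"
  "lin i \<zero>\<^bsub>A\<^esub> = 0"
  unfolding lin_def
  by (simp_all add: letters_of_simps linear_simps[OF linear_linear_form] linear_form_single)

lemma homogeneous_lin: "homogeneous 1 (lin i a)"
  unfolding lin_def by (rule homogeneous_linear_form)

text \<open>
  The operator \<open>e\<^sub>i\<^sub>j \<otimes> a\<close>, which takes \<open>v\<^sub>j \<otimes> b\<close> to \<open>v\<^sub>i \<otimes> ab\<close>, with indices from 0. Pairs \<open>(j, b)\<close>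
  with \<open>b\<close> outside the basis are letters of the type that stand for no vector; they are sent to 0.
\<close>

definition Der :: "nat \<Rightarrow> nat \<Rightarrow> 'a \<Rightarrow> (nat \<times> 'a) mpoly \<Rightarrow> (nat \<times> 'a) mpoly"
  where "Der i j a = deriv (\<lambda>(k, b). if k = j \<and> b \<in> B then lin i (a \<otimes>\<^bsub>A\<^esub> b) else 0)"

lemma derivation_Der: "derivation (Der i j a)"
  unfolding Der_def by (rule derivation_deriv)

lemmas Der_linear = derivation_linear[OF derivation_Der]
lemmas Der_simps = derivation_simps[OF derivation_Der]

lemma Der_var: "Der i j a (var (k, b)) = (if k = j \<and> b \<in> B then lin i (a \<otimes>\<^bsub>A\<^esub> b) else 0)"
  by (simp add: Der_def)

lemma homogeneous_Der: "homogeneous r p \<Longrightarrow> homogeneous r (Der i j a p)"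
  unfolding Der_def by (intro homogeneous_deriv) (auto intro: homogeneous_lin split: prod.split simp del: One_nat_def)

lemma Der_lin:
  assumes "c \<in> carrier A" "a \<in> carrier A"
  shows "Der i j a (lin k c) = (if k = j then lin i (a \<otimes>\<^bsub>A\<^esub> c) else 0)"
  using assms(1)
proof (induction rule: carrier_induct)
  case zero
  then show ?case using assms by (simp add: lin_simps Der_simps)
next
  case (basis b)
  then show ?case by (simp add: lin_simps Der_var)
next
  case (add c d)
  then show ?case using assms by (simp add: lin_simps Der_simps A.r_distr)
next
  case (smult z c)
  have "a \<otimes>\<^bsub>A\<^esub> (z \<odot>\<^bsub>A\<^esub> c) = z \<odot>\<^bsub>A\<^esub> (a \<otimes>\<^bsub>A\<^esub> c)"
    using A.smult_assoc2[of z c a] smult assms by (simp add: A.m_comm)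
  then show ?case using smult assms by (simp add: lin_simps Der_simps)
qed

lemma Der_add:
  assumes "a \<in> carrier A" "b \<in> carrier A"
  shows "Der i j (a \<oplus>\<^bsub>A\<^esub> b) p = Der i j a p + Der i j b p"
proof (rule derivation_eqI[OF derivation_Der derivation_add[OF derivation_Der derivation_Der]])
  fix x show "Der i j (a \<oplus>\<^bsub>A\<^esub> b) (var x) = Der i j a (var x) + Der i j b (var x)"
    using assms by (cases x) (simp add: Der_var A.l_distr lin_simps)
qed

lemma Der_smult:
  assumes "a \<in> carrier A"
  shows "Der i j (c \<odot>\<^bsub>A\<^esub> a) p = pm_scale c (Der i j a p)"
proof (rule derivation_eqI[OF derivation_Der derivation_scale[OF derivation_Der]])
  fix x show "Der i j (c \<odot>\<^bsub>A\<^esub> a) (var x) = pm_scale c (Der i j a (var x))"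
    using assms A.smult_assoc2[of c a] by (cases x) (auto simp: Der_var lin_simps)
qed

lemma Der_commutator:
  assumes "a \<in> carrier A" "b \<in> carrier A"
  shows "Der i j a (Der k l b p) - Der k l b (Der i j a p) =
    (if j = k then Der i l (a \<otimes>\<^bsub>A\<^esub> b) p else 0) - (if l = i then Der k j (b \<otimes>\<^bsub>A\<^esub> a) p else 0)"
proof -
  let ?R = "\<lambda>p. (if j = k then Der i l (a \<otimes>\<^bsub>A\<^esub> b) p else 0) - (if l = i then Der k j (b \<otimes>\<^bsub>A\<^esub> a) p else 0)"
  have *: "derivation (\<lambda>p. if Q then \<delta> p else 0)" if "derivation \<delta>" for Q and \<delta> :: "(nat \<times> 'a) mpoly \<Rightarrow> _"
    using that derivation_zero by (cases Q) auto
  have d: "derivation ?R" by (intro derivation_diff * derivation_Der)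
  show ?thesis
  proof (rule derivation_eqI[OF derivation_commutator[OF derivation_Der derivation_Der] d])
    fix x
    show "Der i j a (Der k l b (var x)) - Der k l b (Der i j a (var x)) = ?R (var x)"
      using assms by (cases x) (auto simp: Der_var Der_lin A.m_assoc linear_simps(3)[OF Der_linear])
  qed
qed

end



section \<open>Symmetrization over \<open>gl\<^sub>n \<otimes> A\<close>\<close>

lemma (in based_algebra) lin_ext_letters_of:
  assumes "vector_space s" "a \<in> carrier A"
    and "\<And>a b. a \<in> carrier A \<Longrightarrow> b \<in> carrier A \<Longrightarrow> h (a \<oplus>\<^bsub>A\<^esub> b) = h a + h b"
    and "\<And>c a. a \<in> carrier A \<Longrightarrow> h (c \<odot>\<^bsub>A\<^esub> a) = s c (h a)"
    and "\<And>b. b \<in> B \<Longrightarrow> g (i, b) = h b"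
  shows "lin_ext s g (letters_of i a) = h a"
  using assms(2)
proof (induction rule: carrier_induct)
  case zero
  have "h (\<zero>\<^bsub>A\<^esub> \<oplus>\<^bsub>A\<^esub> \<zero>\<^bsub>A\<^esub>) = h \<zero>\<^bsub>A\<^esub> + h \<zero>\<^bsub>A\<^esub>" by (intro assms) auto
  then show ?case by (simp add: letters_of_simps linear_simps(3)[OF linear_lin_ext[OF assms(1)]])
next
  case (basis b)
  interpret vector_space s by fact
  show ?case using basis by (simp add: letters_of_simps lin_ext_single[OF assms(1)] assms(5))
qed (simp_all add: letters_of_simps linear_simps[OF linear_lin_ext[OF assms(1)]] assms(3,4))

text \<open>
  A module over \<open>gl\<^sub>n \<otimes> A\<close>, where \<open>E i j a\<close> is the action of \<open>e\<^sub>i\<^sub>j \<otimes> a\<close> with indices from 0, with a vector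
  that is killed by all \<open>e\<^sub>i\<^sub>j \<otimes> a\<close> outside the first column. For a highest weight vector of \<open>sl\<^sub>n \<otimes> A\<close>
  this amounts to a choice of the action of the scalar matrices.
\<close>

locale gl_module = based_algebra A B + vector_space sc
  for A :: "(complex, 'a) module" and B :: "'a set"
    and sc :: "complex \<Rightarrow> 'w::ab_group_add \<Rightarrow> 'w" +
  fixes n m :: nat and E :: "nat \<Rightarrow> nat \<Rightarrow> 'a \<Rightarrow> 'w \<Rightarrow> 'w" and w0 :: 'w
  assumes n_ge_2: "n \<ge> 2"
    and E_linear: "i < n \<Longrightarrow> j < n \<Longrightarrow> a \<in> carrier A \<Longrightarrow> Vector_Spaces.linear sc sc (E i j a)"
    and E_add: "i < n \<Longrightarrow> j < n \<Longrightarrow> a \<in> carrier A \<Longrightarrow> b \<in> carrier A \<Longrightarrow>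
      E i j (a \<oplus>\<^bsub>A\<^esub> b) v = E i j a v + E i j b v"
    and E_smult: "i < n \<Longrightarrow> j < n \<Longrightarrow> a \<in> carrier A \<Longrightarrow> E i j (c \<odot>\<^bsub>A\<^esub> a) v = sc c (E i j a v)"
    and E_commutator: "i < n \<Longrightarrow> j < n \<Longrightarrow> k < n \<Longrightarrow> l < n \<Longrightarrow> a \<in> carrier A \<Longrightarrow> b \<in> carrier A \<Longrightarrow>
      E i j a (E k l b v) - E k l b (E i j a v) =
      (if j = k then E i l (a \<otimes>\<^bsub>A\<^esub> b) v else 0) - (if l = i then E k j (b \<otimes>\<^bsub>A\<^esub> a) v else 0)"
    and E_kills: "i < n \<Longrightarrow> 0 < j \<Longrightarrow> j < n \<Longrightarrow> a \<in> carrier A \<Longrightarrow> E i j a w0 = 0"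
    and E_weight: "E 0 0 \<one>\<^bsub>A\<^esub> w0 = sc (of_nat m) w0"
    and E_nilpotent: "(E 1 0 \<one>\<^bsub>A\<^esub> ^^ Suc m) w0 = 0"
begin

text \<open>
  The letters that stand for basis vectors of \<open>V \<otimes> A\<close>. All others act by 0 and multiply to 0, so that
  the pre-Lie identities hold on the whole type.
\<close>

definition valid :: "nat \<times> 'a \<Rightarrow> bool"
  where "valid x \<longleftrightarrow> fst x < n \<and> snd x \<in> B"

text \<open>
  The letter \<open>(i, b)\<close> stands for \<open>e\<^sub>i\<^sub>0 \<otimes> b\<close>, and this is the associative product
  \<open>(e\<^sub>i\<^sub>0 \<otimes> a)(e\<^sub>k\<^sub>0 \<otimes> b)\<close>.
\<close>

definition circ :: "nat \<times> 'a \<Rightarrow> nat \<times> 'a \<Rightarrow> (nat \<times> 'a \<Rightarrow>\<^sub>0 complex)"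
  where "circ x y = (if valid x \<and> valid y \<and> fst y = 0 then letters_of (fst x) (snd x \<otimes>\<^bsub>A\<^esub> snd y) else 0)"

definition opr :: "nat \<times> 'a \<Rightarrow> 'w \<Rightarrow> 'w"
  where "opr x v = (if valid x then E (fst x) 0 (snd x) v else 0)"

lemma n_pos [simp]: "0 < n" "Suc 0 < n"
  using n_ge_2 by auto

lemma E_letters_of: "i < n \<Longrightarrow> a \<in> carrier A \<Longrightarrow> lin_ext sc (\<lambda>z. opr z v) (letters_of i a) = E i 0 a v"
  by (rule lin_ext_letters_of[OF vector_space_axioms]) (auto simp: E_add E_smult opr_def valid_def)

lemma deriv_circ: "deriv (\<lambda>y. linear_form (circ x y)) p =
    (if valid x then Der (fst x) 0 (snd x) p else 0)"
proof -
  have "derivation (\<lambda>p. if valid x then Der (fst x) 0 (snd x) p else 0)"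
    using derivation_zero derivation_Der by (cases "valid x") auto
  then show ?thesis
    by (rule derivation_eqI[OF derivation_deriv])
      (auto simp: circ_def Der_var valid_def lin_def linear_simps(3)[OF linear_linear_form] split: prod.split)
qed

lemma Der_letters_of:
  assumes "i < n" "a \<in> carrier A"
  shows "lin_ext pm_scale (\<lambda>u. linear_form (circ u z)) (letters_of i a) = Der i 0 a (var z)"
proof (rule lin_ext_letters_of[where h = "\<lambda>a. Der i 0 a (var z)", OF pm.vector_space_axioms assms(2)])
  fix b assume "b \<in> B"
  with assms show "linear_form (circ (i, b) z) = Der i 0 b (var z)"
    using deriv_circ[of "(i, b)" "var z"] by (simp add: valid_def)
qed (use assms in \<open>simp_all add: Der_add Der_smult\<close>)

lemma lin_ext_0: "lin_ext s g 0 = 0"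
  by (simp add: lin_ext_def)

sublocale S: pre_lie_module sc circ opr w0
proof (intro pre_lie_module.intro pre_lie_module_axioms.intro vector_space_axioms)
  fix x
  show "Vector_Spaces.linear sc sc (opr x)"
  proof (cases "valid x")
    case True
    then have "opr x = E (fst x) 0 (snd x)" by (auto simp: opr_def)
    with True show ?thesis by (auto simp: valid_def intro: E_linear)
  next
    case False
    then have "opr x = (\<lambda>_. 0)" by (auto simp: opr_def)
    then show ?thesis by (auto intro!: linearI vector_space_axioms)
  qed
next
  fix x y v
  show "opr x (opr y v) - opr y (opr x v) =
      lin_ext sc (\<lambda>z. opr z v) (circ x y) - lin_ext sc (\<lambda>z. opr z v) (circ y x)"
  proof (cases "valid x \<and> valid y")
    case True
    then have v: "valid x" "valid y" by auto
    have 1: "opr x u = E (fst x) 0 (snd x) u" if "valid x" for x u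
      using that by (simp add: opr_def)
    have 2: "lin_ext sc (\<lambda>z. opr z v) (circ x y) =
        (if 0 = fst y then E (fst x) 0 (snd x \<otimes>\<^bsub>A\<^esub> snd y) v else 0)" if "valid x" "valid y" for x y
      using that by (auto simp: circ_def lin_ext_0 E_letters_of valid_def)
    show ?thesis
      unfolding 1[OF v(1)] 1[OF v(2)] 2[OF v] 2[OF v(2,1)]
      using E_commutator[of "fst x" 0 "fst y" 0 "snd x" "snd y" v] v by (simp add: valid_def)
  next
    case False
    have "E (fst z) 0 (snd z) 0 = 0" if "valid z" for z
      using that by (auto simp: valid_def linear_simps(3)[OF E_linear])
    with False show ?thesis by (auto simp: opr_def circ_def lin_ext_0)
  qed
next
  fix x y z
  show "deriv (\<lambda>v. linear_form (circ x v)) (linear_form (circ y z))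
        - deriv (\<lambda>v. linear_form (circ y v)) (linear_form (circ x z))
      = lin_ext pm_scale (\<lambda>u. linear_form (circ u z)) (circ x y)
        - lin_ext pm_scale (\<lambda>u. linear_form (circ u z)) (circ y x)"
  proof (cases "valid x \<and> valid y")
    case True
    then have v: "valid x" "valid y" by auto
    have 1: "linear_form (circ x z) = Der (fst x) 0 (snd x) (var z)" if "valid x" for x
      using deriv_circ[of x "var z"] that by simp
    have 2: "snd x \<in> carrier A" "snd y \<in> carrier A" using True by (auto simp: valid_def)
    have 3: "lin_ext pm_scale (\<lambda>u. linear_form (circ u z)) (circ x y) =
        (if 0 = fst y then Der (fst x) 0 (snd x \<otimes>\<^bsub>A\<^esub> snd y) (var z) else 0)" if "valid x" "valid y" for x y
      using that unfolding circ_def[of x y] by (auto simp: lin_ext_0 Der_letters_of valid_def)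
    show ?thesis
      unfolding 3[OF v] 3[OF v(2,1)] deriv_circ 1[OF v(1)] 1[OF v(2)]
      using v by (simp add: Der_commutator[OF 2])
  next
    case False
    then show ?thesis
      unfolding deriv_circ
      by (auto simp: circ_def lin_ext_0 linear_simps(3)[OF linear_linear_form] linear_simps(3)[OF Der_linear])
  qed
qed

abbreviation "\<Psi> \<equiv> S.symm_map"

lemmas linear_Psi = S.linear_symm_map
lemmas Psi_simps = linear_simps[OF linear_Psi]

lemma D_valid: "valid x \<Longrightarrow> S.D x p = Der (fst x) 0 (snd x) p"
  by (simp add: S.D_def deriv_circ)

lemma Psi_invalid_letter: "\<not> valid x \<Longrightarrow> \<Psi> (var x * p) = 0"
  by (simp add: S.symm_map_var S.D_def deriv_circ opr_def Psi_simps)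

lemma E_Psi_0:
  assumes "i < n" "a \<in> carrier A"
  shows "E i 0 a (\<Psi> p) = \<Psi> (lin i a * p) + \<Psi> (Der i 0 a p)"
proof -
  have "lin_ext sc (\<lambda>z. opr z (\<Psi> p)) (letters_of i a) = \<Psi> (lin i a * p) + \<Psi> (Der i 0 a p)"
  proof (rule lin_ext_letters_of[where h = "\<lambda>a. \<Psi> (lin i a * p) + \<Psi> (Der i 0 a p)", OF vector_space_axioms assms(2)])
    fix b assume "b \<in> B"
    then have v: "valid (i, b)" using assms by (simp add: valid_def)
    show "opr (i, b) (\<Psi> p) = \<Psi> (lin i b * p) + \<Psi> (Der i 0 b p)"
      using S.symm_map_var[of "(i, b)" p] D_valid[OF v] \<open>b \<in> B\<close> by (simp add: lin_simps)
  qed (simp_all add: lin_simps Der_add Der_smult distrib_right Psi_simps pm_scale_mult_left scale_right_distrib)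
  then show ?thesis by (simp add: E_letters_of assms)
qed

lemma homogeneous_linear_eq:
  assumes "Vector_Spaces.linear pm_scale sc f" "Vector_Spaces.linear pm_scale sc g" "homogeneous r p"
    and "\<And>\<mu>. size \<mu> = r \<Longrightarrow> f (monomial \<mu>) = g (monomial \<mu>)"
  shows "f p = g p"
  by (rule linear_pm_eq[OF assms(1,2)]) (use assms(3,4) in \<open>auto simp: homogeneous_def\<close>)

lemma commutator_rearrangement:
  assumes "x - y = p - q" "u - v = p' - q" "p = l + p'"
  shows "x - u = y - v + (l :: 'w)"
proof -
  have "x - u = (x - y) - (u - v) + (y - v)" by simp
  then show ?thesis unfolding assms by simp
qed

text \<open>
  Induction on the degree. Splitting off a letter \<open>x = (k, b)\<close>, the commutators of \<open>e\<^sub>i\<^sub>j \<otimes> a\<close> with the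
  operator \<open>e\<^sub>k\<^sub>0 \<otimes> b\<close> and with the derivation \<open>D\<^sub>x\<close> have the same shape, and by \<open>E_Psi_0\<close> they differ by
  \<open>\<Psi>((v\<^sub>i \<otimes> ab) f)\<close> for \<open>j = k\<close>, which is the term where the derivation hits \<open>x\<close>. The induction starts
  with the assumption that columns other than the first kill the generator.
\<close>

lemma E_Psi_pos:
  assumes j: "0 < j" "j < n"
  shows "i < n \<Longrightarrow> a \<in> carrier A \<Longrightarrow> homogeneous r p \<Longrightarrow> E i j a (\<Psi> p) = \<Psi> (Der i j a p)"
proof (induction r arbitrary: i a p)
  case (0 i a p)
  show ?case
  proof (rule homogeneous_linear_eq[OF lin_comp[OF linear_Psi E_linear] lin_comp[OF Der_linear linear_Psi]])
    show "E i j a (\<Psi> (monomial \<mu>)) = \<Psi> (Der i j a (monomial \<mu>))" if "size \<mu> = 0" for \<mu>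
      using that 0 j by (simp add: S.symm_map_one E_kills derivation_one[OF derivation_Der] Psi_simps)
  qed (use 0 j in auto)
next
  case (Suc r i a p)
  show ?case
  proof (rule homogeneous_linear_eq[OF lin_comp[OF linear_Psi E_linear] lin_comp[OF Der_linear linear_Psi]])
    fix \<mu> :: "(nat \<times> 'a) multiset" assume "size \<mu> = Suc r"
    then obtain x \<nu> where \<mu>: "\<mu> = add_mset x \<nu>" and \<nu>: "size \<nu> = r"
      by (cases \<mu>) auto
    let ?p = "monomial \<nu>"
    have h: "homogeneous r ?p" using \<nu> by simp
    note hD = homogeneous_Der[OF h]
    obtain k b where x: "x = (k, b)" by (cases x)
    show "E i j a (\<Psi> (monomial \<mu>)) = \<Psi> (Der i j a (monomial \<mu>))"
    proof (cases "valid x")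
      case False
      then have "Der i j a (var x) = 0"
        using x j by (auto simp: Der_var valid_def)
      then show ?thesis
        unfolding \<mu> monomial_add_mset[of x \<nu>] Der_simps
        by (simp add: Psi_invalid_letter[OF False] linear_simps(3)[OF E_linear] Suc.prems j)
    next
      case True
      then have k: "k < n" and b: "b \<in> B" "b \<in> carrier A" using x by (auto simp: valid_def)
      have Psi_x: "\<Psi> (var x * q) = E k 0 b (\<Psi> q) - \<Psi> (Der k 0 b q)" for q
        using S.symm_map_var[of x q] D_valid[OF True] True x by (simp add: opr_def)
      have 1: "E i j a (E k 0 b (\<Psi> ?p)) - E k 0 b (\<Psi> (Der i j a ?p)) =
          (if j = k then E i 0 (a \<otimes>\<^bsub>A\<^esub> b) (\<Psi> ?p) else 0) - (if 0 = i then \<Psi> (Der k j (b \<otimes>\<^bsub>A\<^esub> a) ?p) else 0)"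
        using E_commutator[of i j k 0 a b "\<Psi> ?p"] Suc.IH[of k "b \<otimes>\<^bsub>A\<^esub> a", OF _ _ h] Suc.IH[OF Suc.prems(1,2) h]
        using k j b Suc.prems by auto
      have 2: "\<Psi> (Der i j a (Der k 0 b ?p)) - \<Psi> (Der k 0 b (Der i j a ?p)) =
        (if j = k then \<Psi> (Der i 0 (a \<otimes>\<^bsub>A\<^esub> b) ?p) else 0) - (if 0 = i then \<Psi> (Der k j (b \<otimes>\<^bsub>A\<^esub> a) ?p) else 0)"
        unfolding Psi_simps(4)[symmetric] using Der_commutator[of a b i j k 0 ?p] Suc.prems b
        by (simp add: Psi_simps)
      have "E i j a (\<Psi> (monomial \<mu>)) = E i j a (E k 0 b (\<Psi> ?p)) - \<Psi> (Der i j a (Der k 0 b ?p))"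
        unfolding \<mu> monomial_add_mset[of x \<nu>] Psi_x
        using Suc.IH[OF Suc.prems(1,2) homogeneous_Der[OF h]] j Suc.prems
        by (simp add: linear_simps(4)[OF E_linear])
      also have "\<dots> = E k 0 b (\<Psi> (Der i j a ?p)) - \<Psi> (Der k 0 b (Der i j a ?p)) +
          (if j = k then \<Psi> (lin i (a \<otimes>\<^bsub>A\<^esub> b) * ?p) else 0)"
      proof (rule commutator_rearrangement[OF 1 2])
        show "(if j = k then E i 0 (a \<otimes>\<^bsub>A\<^esub> b) (\<Psi> ?p) else 0) =
            (if j = k then \<Psi> (lin i (a \<otimes>\<^bsub>A\<^esub> b) * ?p) else 0) + (if j = k then \<Psi> (Der i 0 (a \<otimes>\<^bsub>A\<^esub> b) ?p) else 0)"
          using E_Psi_0[of i "a \<otimes>\<^bsub>A\<^esub> b" ?p] Suc.prems b by simp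
      qed
      also have "\<dots> = \<Psi> (var x * Der i j a ?p + Der i j a (var x) * ?p)"
        using b x by (simp add: Psi_x[symmetric] Psi_simps Der_var)
      also have "\<dots> = \<Psi> (Der i j a (monomial \<mu>))"
        unfolding \<mu> monomial_add_mset[of x \<nu>] Der_simps by (simp add: add.commute)
      finally show ?thesis .
    qed
  qed (use Suc.prems j in auto)
qed

text \<open>
  The identity matrix acts on polynomials as the Euler operator.
\<close>

lemma Psi_euler:
  assumes "homogeneous r p"
  shows "\<Psi> (\<Sum>i<n. Der i i \<one>\<^bsub>A\<^esub> p) = sc (of_nat r) (\<Psi> p)"
proof -
  define eul where "eul p = (\<Sum>i<n. Der i i \<one>\<^bsub>A\<^esub> p)" for p
  have d: "derivation eul"
    unfolding eul_def by (intro derivation_sum derivation_Der)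
  have ev: "eul (var x) = (if valid x then var x else 0)" for x
    by (cases x) (auto simp: eul_def Der_var valid_def lin_simps)
  have valid: "eul (monomial \<mu>) = of_nat (size \<mu>) * monomial \<mu>" if "\<forall>x\<in>#\<mu>. valid x" for \<mu>
    using that
  proof (induction \<mu>)
    case empty
    then show ?case using derivation_one[OF d] by simp
  next
    case (add x \<mu>)
    then show ?case
      unfolding monomial_add_mset[of x \<mu>] derivation_mult[OF d] by (simp add: ev algebra_simps)
  qed
  have *: "\<Psi> (eul (monomial \<mu>)) = sc (of_nat (size \<mu>)) (\<Psi> (monomial \<mu>))" for \<mu>
  proof (cases "\<forall>x\<in>#\<mu>. valid x")
    case True
    have "of_nat (size \<mu>) * monomial \<mu> = pm_scale (of_nat (size \<mu>)) (monomial \<mu>)"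
      unfolding mult_map_scale_conv_mult by (simp add: single_of_nat)
    then show ?thesis
      unfolding valid[OF True] by (simp only: Psi_simps)
  next
    case False
    then obtain x \<nu> where \<mu>: "\<mu> = add_mset x \<nu>" and x: "\<not> valid x"
      by (meson multi_member_split)
    show ?thesis
      unfolding \<mu> monomial_add_mset[of x \<nu>] derivation_mult[OF d]
      using x by (simp add: ev Psi_invalid_letter)
  qed
  have "\<Psi> (eul p) = sc (of_nat r) (\<Psi> p)"
    by (rule homogeneous_linear_eq[OF lin_comp[OF derivation_linear[OF d] linear_Psi]
          lin_comp[OF linear_Psi linear_scale_self] assms]) (use * in auto)
  then show ?thesis by (simp add: eul_def)
qed

text \<open>
  The identity matrix is central, so it acts by the same scalar on the whole submodule generated by \<open>w0\<close>.
\<close>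

lemma center_acts_by_m: "homogeneous r p \<Longrightarrow> (\<Sum>i<n. E i i \<one>\<^bsub>A\<^esub> (\<Psi> p)) = sc (of_nat m) (\<Psi> p)"
proof (induction r arbitrary: p)
  have lin: "Vector_Spaces.linear pm_scale sc (\<lambda>p. \<Sum>i<n. E i i \<one>\<^bsub>A\<^esub> (\<Psi> p))"
    by (rule linearI)
      (auto intro: pm.vector_space_axioms vector_space_axioms
        simp: Psi_simps linear_simps[OF E_linear] sum.distrib scale_sum_right)
  note rule = homogeneous_linear_eq[OF lin lin_comp[OF linear_Psi linear_scale_self]]
  {
    case (0 p)
    show ?case
    proof (rule rule[OF 0])
      fix \<mu> :: "(nat \<times> 'a) multiset" assume "size \<mu> = 0"
      moreover have "(\<Sum>i<n. E i i \<one>\<^bsub>A\<^esub> w0) = (\<Sum>i\<in>{0}. E i i \<one>\<^bsub>A\<^esub> w0)"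
        by (rule sum.mono_neutral_right) (auto simp: E_kills)
      ultimately show "(\<Sum>i<n. E i i \<one>\<^bsub>A\<^esub> (\<Psi> (monomial \<mu>))) = sc (of_nat m) (\<Psi> (monomial \<mu>))"
        by (simp add: S.symm_map_one E_weight)
    qed
  next
    case (Suc r p)
    show ?case
    proof (rule rule[OF Suc.prems])
      fix \<mu> :: "(nat \<times> 'a) multiset" assume "size \<mu> = Suc r"
      then obtain x \<nu> where \<mu>: "\<mu> = add_mset x \<nu>" and \<nu>: "size \<nu> = r"
        by (cases \<mu>) auto
      let ?p = "monomial \<nu>"
      have h: "homogeneous r ?p" using \<nu> by simp
      show "(\<Sum>i<n. E i i \<one>\<^bsub>A\<^esub> (\<Psi> (monomial \<mu>))) = sc (of_nat m) (\<Psi> (monomial \<mu>))"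
      proof (cases "valid x")
        case False
        then show ?thesis
          unfolding \<mu> monomial_add_mset[of x \<nu>]
          by (simp add: Psi_invalid_letter linear_simps(3)[OF E_linear])
      next
        case True
        then have k: "fst x < n" and b: "snd x \<in> carrier A" by (auto simp: valid_def)
        let ?X = "E (fst x) 0 (snd x)"
        have "(\<Sum>i<n. E i i \<one>\<^bsub>A\<^esub> (?X v)) - ?X (\<Sum>i<n. E i i \<one>\<^bsub>A\<^esub> v) =
            (\<Sum>i<n. E i i \<one>\<^bsub>A\<^esub> (?X v) - ?X (E i i \<one>\<^bsub>A\<^esub> v))" for v
          by (simp add: linear_simps(6)[OF E_linear] k b sum_subtractf)
        also have "\<dots> v = (\<Sum>i<n. (if i = fst x then ?X v else 0) - (if i = 0 then ?X v else 0))" for v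
          using k b by (intro sum.cong) (auto simp: E_commutator)
        also have "\<dots> v = 0" for v
          using k by (simp add: sum_subtractf)
        finally have comm: "(\<Sum>i<n. E i i \<one>\<^bsub>A\<^esub> (?X v)) = ?X (\<Sum>i<n. E i i \<one>\<^bsub>A\<^esub> v)" for v
          by simp
        have "\<Psi> (monomial \<mu>) = ?X (\<Psi> ?p) - \<Psi> (S.D x ?p)"
          unfolding \<mu> monomial_add_mset[of x \<nu>] S.symm_map_var using True by (simp add: opr_def)
        moreover have "(\<Sum>i<n. E i i \<one>\<^bsub>A\<^esub> (v - v')) = (\<Sum>i<n. E i i \<one>\<^bsub>A\<^esub> v) - (\<Sum>i<n. E i i \<one>\<^bsub>A\<^esub> v')" for v v'
          by (simp add: linear_simps(4)[OF E_linear] sum_subtractf)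
        ultimately show ?thesis
          by (simp add: comm Suc.IH[OF h] Suc.IH[OF S.homogeneous_D[OF h]] scale_right_diff_distrib
              linear_simps(2)[OF E_linear] k b)
      qed
    qed
  }
qed

text \<open>
  The identity matrix acts on \<open>\<Psi>(p)\<close> by \<open>m\<close>. On the other hand, moving all \<open>e\<^sub>i\<^sub>i \<otimes> 1\<close> inside produces the
  Euler operator, which contributes \<open>r\<close>, and the additional term of \<open>e\<^sub>0\<^sub>0 \<otimes> 1\<close>, which is the left side.
\<close>

lemma Psi_lin_one:
  assumes "homogeneous r p"
  shows "\<Psi> (lin 0 \<one>\<^bsub>A\<^esub> * p) = sc (of_nat m - of_nat r) (\<Psi> p)"
proof -
  have split: "(\<Sum>i<n. f i) = f 0 + (\<Sum>i\<in>{0<..<n}. f i)" for f :: "nat \<Rightarrow> 'w"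
  proof -
    have "{..<n} = insert 0 {0<..<n}" by auto
    then show ?thesis by simp
  qed
  have "sc (of_nat m) (\<Psi> p) = (\<Sum>i<n. E i i \<one>\<^bsub>A\<^esub> (\<Psi> p))"
    using center_acts_by_m[OF assms] by simp
  also have "\<dots> = \<Psi> (lin 0 \<one>\<^bsub>A\<^esub> * p) + (\<Psi> (Der 0 0 \<one>\<^bsub>A\<^esub> p) + (\<Sum>i\<in>{0<..<n}. \<Psi> (Der i i \<one>\<^bsub>A\<^esub> p)))"
    unfolding split by (simp add: E_Psi_0 E_Psi_pos[OF _ _ _ _ assms] add.assoc)
  also have "\<dots> = \<Psi> (lin 0 \<one>\<^bsub>A\<^esub> * p) + \<Psi> (\<Sum>i<n. Der i i \<one>\<^bsub>A\<^esub> p)"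
    unfolding Psi_simps split by simp
  finally show ?thesis
    by (simp add: Psi_euler[OF assms] scale_left_diff_distrib algebra_simps)
qed

lemma Psi_lin_one_power:
  "k \<le> m \<Longrightarrow> \<Psi> (lin 0 \<one>\<^bsub>A\<^esub> ^ k) = sc (fact m / fact (m - k)) w0"
proof (induction k)
  case 0
  then show ?case by (simp add: S.symm_map_one)
next
  case (Suc k)
  have h: "homogeneous k (lin 0 \<one>\<^bsub>A\<^esub> ^ k)"
    using homogeneous_power[OF homogeneous_lin, of k 0 "\<one>\<^bsub>A\<^esub>"] by simp
  have "m - k = Suc (m - Suc k)" using Suc.prems by simp
  then have "fact (m - k) = of_nat (m - k) * (fact (m - Suc k) :: complex)"
    by (simp add: fact_Suc)
  then have "(fact (m - k) :: complex) = (of_nat m - of_nat k) * fact (m - Suc k)"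
    using Suc.prems by (simp only: of_nat_diff Suc_leD)
  moreover have "(of_nat m - of_nat k :: complex) \<noteq> 0"
    using Suc.prems by simp
  ultimately have "(of_nat m - of_nat k) * (fact m / fact (m - k)) = (fact m / fact (m - Suc k) :: complex)"
    by simp
  then show ?case
    using Suc Psi_lin_one[OF h] by simp
qed

text \<open>
  Polarization. For \<open>t = 0\<close> this is the relation \<open>(e\<^sub>1\<^sub>0 \<otimes> 1)\<^bsup>m+1\<^esup> w0 = 0\<close>. In the step, \<open>e\<^sub>i\<^sub>1 \<otimes> b\<close> acts on
  \<open>\<Psi>(p y\<^bsup>s+1\<^esup>)\<close> by a derivation, which replaces one factor \<open>y = v\<^sub>1 \<otimes> 1\<close> by the letter \<open>(i, b)\<close>.
\<close>

lemma Psi_vanish_aux: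
  "t \<le> Suc m \<Longrightarrow> homogeneous t p \<Longrightarrow> \<Psi> (p * lin 1 \<one>\<^bsub>A\<^esub> ^ (Suc m - t)) = 0"
proof (induction t arbitrary: p)
  let ?y = "lin 1 \<one>\<^bsub>A\<^esub>"
  have lin: "Vector_Spaces.linear pm_scale sc (\<lambda>p. \<Psi> (p * q))" for q
    by (rule lin_comp[OF linear_mult_right linear_Psi])
  have zero: "Vector_Spaces.linear pm_scale sc (\<lambda>p. 0)"
    by (auto intro!: linearI pm.vector_space_axioms vector_space_axioms)
  {
    case (0 p)
    have "\<Psi> (?y ^ k) = (E 1 0 \<one>\<^bsub>A\<^esub> ^^ k) w0" for k
    proof (induction k)
      case 0
      then show ?case by (simp add: S.symm_map_one)
    next
      case (Suc k)
      have "Der 1 0 \<one>\<^bsub>A\<^esub> (?y ^ k) = 0"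
      proof (cases k)
        case 0 then show ?thesis by (simp add: derivation_one[OF derivation_Der])
      next
        case (Suc l)
        then show ?thesis by (simp only: derivation_power[OF derivation_Der]) (simp add: Der_lin)
      qed
      then show ?case
        using E_Psi_0[of 1 "\<one>\<^bsub>A\<^esub>" "?y ^ k"] Suc by (simp add: Psi_simps)
    qed
    then have "\<Psi> (monomial {#} * ?y ^ Suc m) = 0"
      using E_nilpotent by (simp only: monomial_empty mult_1)
    then show ?case
      by (intro homogeneous_linear_eq[OF lin zero 0(2)]) simp
  next
    case (Suc t p)
    show ?case
    proof (rule homogeneous_linear_eq[OF lin zero Suc.prems(2)])
      fix \<mu> :: "(nat \<times> 'a) multiset" assume "size \<mu> = Suc t"
      then obtain x \<nu> where \<mu>: "\<mu> = add_mset x \<nu>" and \<nu>: "size \<nu> = t"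
        by (cases \<mu>) auto
      let ?p = "monomial \<nu>"
      have h: "homogeneous t ?p" using \<nu> by simp
      show "\<Psi> (monomial \<mu> * ?y ^ (Suc m - Suc t)) = 0"
      proof (cases "valid x")
        case False
        then show ?thesis
          unfolding \<mu> monomial_add_mset[of x \<nu>] by (simp add: Psi_invalid_letter mult.assoc)
      next
        case True
        obtain i b where x: "x = (i, b)" by (cases x)
        have i: "i < n" and b: "b \<in> B" "b \<in> carrier A" using True x by (auto simp: valid_def)
        define s where "s = m - t"
        have s: "Suc m - t = Suc s" "Suc m - Suc t = s" and m: "m = t + s"
          using Suc.prems by (auto simp: s_def)
        have hg: "homogeneous (Suc m) (?p * ?y ^ Suc s)"
          using homogeneous_mult[OF h homogeneous_power[OF homogeneous_lin, of "Suc s" 1 "\<one>\<^bsub>A\<^esub>"]] 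
          by (simp add: m)
        have D: "Der i 1 b (?p * ?y ^ Suc s) = Der i 1 b ?p * ?y ^ Suc s + of_nat (Suc s) * (var x * ?p * ?y ^ s)"
          unfolding Der_simps derivation_power[OF derivation_Der]
          using b x by (simp add: Der_lin lin_simps algebra_simps)
        have "0 = E i 1 b (\<Psi> (?p * ?y ^ Suc s))"
          using Suc.IH[OF _ h] Suc.prems b i by (simp only: s) (simp add: linear_simps(3)[OF E_linear])
        also have "\<dots> = \<Psi> (Der i 1 b (?p * ?y ^ Suc s))"
          using i b by (intro E_Psi_pos[OF _ _ _ _ hg]) auto
        also have "\<dots> = \<Psi> (Der i 1 b ?p * ?y ^ Suc s) + sc (of_nat (Suc s)) (\<Psi> (var x * ?p * ?y ^ s))"
          unfolding D Psi_simps(1) by (metis Psi_simps(2) mult_map_scale_conv_mult single_of_nat)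
        also have "\<Psi> (Der i 1 b ?p * ?y ^ Suc s) = 0"
          using Suc.IH[OF _ homogeneous_Der[OF h]] Suc.prems by (simp only: s)
        finally show ?thesis
          unfolding \<mu> monomial_add_mset[of x \<nu>] s by (simp del: of_nat_Suc)
      qed
    qed
  }
qed

lemma Psi_vanish: "homogeneous (Suc m) p \<Longrightarrow> \<Psi> p = 0"
  using Psi_vanish_aux[of "Suc m" p] by simp

text \<open>
  The additional term of the first column is a form of degree \<open>m + 1\<close>.
\<close>

theorem E_Psi:
  assumes "i < n" "j < n" "a \<in> carrier A" "homogeneous m p"
  shows "E i j a (\<Psi> p) = \<Psi> (Der i j a p)"
proof (cases "j = 0")
  case True
  have "homogeneous (Suc m) (lin i a * p)"
    using homogeneous_mult[OF homogeneous_lin assms(4)] by simp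
  with True show ?thesis
    using assms by (simp add: E_Psi_0 Psi_vanish)
next
  case False
  with assms show ?thesis by (intro E_Psi_pos) auto
qed

theorem Psi_lin_one_power_m: "\<Psi> (lin 0 \<one>\<^bsub>A\<^esub> ^ m) = sc (fact m) w0"
  using Psi_lin_one_power[of m] by simp

end



section \<open>Divided powers and the recursion for \<open>q\<^sub>i\<close>\<close>

lemma finite_subset_mset: "finite {\<psi>. \<psi> \<subseteq># \<chi>}"
proof (induction \<chi>)
  case (add x \<chi>)
  have "{\<psi>. \<psi> \<subseteq># add_mset x \<chi>} \<subseteq> {\<psi>. \<psi> \<subseteq># \<chi>} \<union> add_mset x ` {\<psi>. \<psi> \<subseteq># \<chi>}"
  proof
    fix \<psi> assume *: "\<psi> \<in> {\<psi>. \<psi> \<subseteq># add_mset x \<chi>}"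
    show "\<psi> \<in> {\<psi>. \<psi> \<subseteq># \<chi>} \<union> add_mset x ` {\<psi>. \<psi> \<subseteq># \<chi>}"
    proof (cases "x \<in># \<psi>")
      case True
      then obtain \<psi>' where "\<psi> = add_mset x \<psi>'" by (auto dest: multi_member_split)
      then show ?thesis using * by auto
    next
      case False
      have "count \<psi> a \<le> count \<chi> a" for a
        using * False mset_subset_eq_count[of \<psi> "add_mset x \<chi>" a] by (cases "a = x") (auto simp: not_in_iff)
      then show ?thesis by (simp add: subseteq_mset_def)
    qed
  qed
  then show ?case using add by (meson finite_UnI finite_imageI finite_subset)
qed simp

lemma sum_mset_eq_sum_count:
  assumes "finite S" "set_mset \<chi> \<subseteq> S"
  shows "(\<Sum>c\<in>#\<chi>. f c) = (\<Sum>c\<in>S. pm_scale (of_nat (count \<chi> c)) (f c))"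
  using assms(2)
proof (induction \<chi>)
  case (add x \<chi>)
  have "(\<Sum>c\<in>S. pm_scale (of_nat (count (add_mset x \<chi>) c)) (f c)) =
      (\<Sum>c\<in>S. (if c = x then f c else 0) + pm_scale (of_nat (count \<chi> c)) (f c))"
    by (intro sum.cong) (auto simp: pm.scale_left_distrib)
  then show ?case using add assms(1) by (simp add: sum.distrib)
qed simp

definition fact_mset :: "'a multiset \<Rightarrow> complex"
  where "fact_mset \<chi> = (\<Prod>a\<in>set_mset \<chi>. fact (count \<chi> a))"

lemma fact_mset_nonzero [simp]: "fact_mset \<chi> \<noteq> 0"
  by (simp add: fact_mset_def)

lemma fact_mset_empty [simp]: "fact_mset {#} = 1"
  by (simp add: fact_mset_def)

lemma fact_mset_add: "fact_mset (add_mset c \<chi>) = of_nat (Suc (count \<chi> c)) * fact_mset \<chi>"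
proof -
  let ?S = "insert c (set_mset \<chi>)"
  have "fact_mset \<chi> = (\<Prod>a\<in>?S. fact (count \<chi> a))"
    unfolding fact_mset_def by (intro prod.mono_neutral_left) (auto simp: not_in_iff)
  also have "\<dots> = fact (count \<chi> c) * (\<Prod>a\<in>set_mset \<chi> - {c}. fact (count \<chi> a))"
    by (simp add: prod.insert_remove)
  finally have 1: "fact_mset \<chi> = fact (count \<chi> c) * (\<Prod>a\<in>set_mset \<chi> - {c}. fact (count \<chi> a))" .
  have "fact_mset (add_mset c \<chi>) = fact (Suc (count \<chi> c)) * (\<Prod>a\<in>set_mset \<chi> - {c}. fact (count (add_mset c \<chi>) a))"
    unfolding fact_mset_def by (simp add: prod.insert_remove)
  also have "(\<Prod>a\<in>set_mset \<chi> - {c}. fact (count (add_mset c \<chi>) a)) = (\<Prod>a\<in>set_mset \<chi> - {c}. fact (count \<chi> a) :: complex)"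
    by (intro prod.cong) auto
  finally show ?thesis unfolding 1 by simp
qed

lemma fact_mset_remove: "c \<in># \<chi> \<Longrightarrow> fact_mset \<chi> = of_nat (count \<chi> c) * fact_mset (\<chi> - {#c#})"
  by (auto dest!: multi_member_split simp: fact_mset_add)

lemma fact_mset_replicate: "fact_mset (replicate_mset k x) = fact k"
  by (cases k) (auto simp: fact_mset_def)

lemma multinom_eq: "multinom \<psi> = fact (size \<psi>) / fact_mset \<psi>"
  by (simp add: multinom_def fact_mset_def)

lemma size_eq_sum_count: "size \<chi> = (\<Sum>c\<in>set_mset \<chi>. count \<chi> c)"
  by (simp add: size_multiset_overloaded_eq)

text \<open>
  Pascal's rule for multinomial coefficients.
\<close>

lemma multinom_remove_sum:
  assumes "\<psi> \<noteq> {#}"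
  shows "(\<Sum>c\<in>set_mset \<psi>. multinom (\<psi> - {#c#})) = multinom \<psi>"
proof -
  obtain s where s: "size \<psi> = Suc s" using assms by (cases "size \<psi>") auto
  have "multinom (\<psi> - {#c#}) = fact s / fact_mset \<psi> * of_nat (count \<psi> c)" if "c \<in># \<psi>" for c
    using that s by (simp add: multinom_eq fact_mset_remove[OF that] size_Diff_singleton)
  then have "(\<Sum>c\<in>set_mset \<psi>. multinom (\<psi> - {#c#})) = fact s / fact_mset \<psi> * of_nat (size \<psi>)"
    by (simp add: size_eq_sum_count sum_distrib_left)
  then show ?thesis by (simp add: multinom_eq s)
qed

definition divpow :: "'x mpoly \<Rightarrow> nat \<Rightarrow> 'x mpoly"
  where "divpow x k = pm_scale (1 / fact k) (x ^ k)"

text \<open>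
  The divided power of exponent \<open>k - 1\<close>, which is 0 for \<open>k = 0\<close>; with this convention the derivative of
  a divided power needs no case distinction.
\<close>

definition divpow_pred :: "'x mpoly \<Rightarrow> nat \<Rightarrow> 'x mpoly"
  where "divpow_pred x k = (if k = 0 then 0 else divpow x (k - 1))"

definition divpow_mset :: "('a \<Rightarrow> 'x mpoly) \<Rightarrow> 'a multiset \<Rightarrow> 'x mpoly"
  where "divpow_mset u \<chi> = pm_scale (1 / fact_mset \<chi>) (\<Prod>c\<in>#\<chi>. u c)"

lemma divpow_mset_empty [simp]: "divpow_mset u {#} = 1"
  by (simp add: divpow_mset_def)

lemma divpow_0 [simp]: "divpow x 0 = 1"
  by (simp add: divpow_def)

lemma divpow_mset_replicate: "divpow_mset u (replicate_mset k c) = divpow (u c) k"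
  by (simp add: divpow_mset_def divpow_def fact_mset_replicate)

lemma of_nat_mult_pm: "of_nat k * p = pm_scale (of_nat k) p" for p :: "'x mpoly"
  unfolding mult_map_scale_conv_mult by (simp add: single_of_nat)

lemma derivation_divpow:
  assumes "derivation \<delta>" shows "\<delta> (divpow x k) = \<delta> x * divpow_pred x k"
proof (cases k)
  case 0
  then show ?thesis using assms by (simp add: divpow_pred_def derivation_one)
next
  case (Suc l)
  have "\<delta> (divpow x (Suc l)) = pm_scale (1 / fact (Suc l)) (of_nat (Suc l) * (x ^ l * \<delta> x))"
    unfolding divpow_def linear_simps(2)[OF derivation_linear[OF assms]] derivation_power[OF assms] ..
  also have "\<dots> = pm_scale (1 / fact l) (x ^ l * \<delta> x)"
    unfolding of_nat_mult_pm pm.scale_scale by (simp del: of_nat_Suc)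
  finally show ?thesis
    using Suc by (simp add: divpow_pred_def divpow_def pm_scale_mult_right mult.commute)
qed

lemma mult_divpow_pred: "x * divpow_pred x k = pm_scale (of_nat k) (divpow x k)"
proof (cases k)
  case (Suc l)
  have "pm_scale (of_nat (Suc l)) (divpow x (Suc l)) = pm_scale (1 / fact l) (x ^ Suc l)"
    unfolding divpow_def pm.scale_scale by (simp del: of_nat_Suc)
  then show ?thesis unfolding Suc by (simp add: divpow_pred_def pm_scale_mult_right divpow_def[of x l])
qed (simp add: divpow_pred_def)

lemma divpow_mset_remove:
  assumes "c \<in># \<chi>"
  shows "pm_scale (of_nat (count \<chi> c)) (divpow_mset u \<chi>) = u c * divpow_mset u (\<chi> - {#c#})"
proof -
  obtain \<psi> where \<chi>: "\<chi> = add_mset c \<psi>" using assms by (auto dest: multi_member_split)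
  show ?thesis
    unfolding \<chi> divpow_mset_def pm.scale_scale
    by (simp add: fact_mset_add pm_scale_mult_right del: of_nat_Suc)
qed

lemma derivation_divpow_mset:
  assumes "derivation \<delta>"
  shows "\<delta> (divpow_mset u \<chi>) = (\<Sum>c\<in>set_mset \<chi>. \<delta> (u c) * divpow_mset u (\<chi> - {#c#}))"
proof -
  have "\<delta> (divpow_mset u \<chi>) = pm_scale (1 / fact_mset \<chi>) (\<Sum>c\<in>#\<chi>. \<delta> (u c) * (\<Prod>c\<in>#\<chi> - {#c#}. u c))"
    unfolding divpow_mset_def linear_simps(2)[OF derivation_linear[OF assms]] derivation_prod_mset[OF assms] ..
  also have "\<dots> = (\<Sum>c\<in>set_mset \<chi>. pm_scale (of_nat (count \<chi> c) / fact_mset \<chi>) (\<delta> (u c) * (\<Prod>c\<in>#\<chi> - {#c#}. u c)))"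
    by (subst sum_mset_eq_sum_count[of "set_mset \<chi>"]) (auto simp: pm.scale_sum_right)
  also have "\<dots> = (\<Sum>c\<in>set_mset \<chi>. \<delta> (u c) * divpow_mset u (\<chi> - {#c#}))"
  proof (intro sum.cong refl)
    fix c assume c: "c \<in># \<chi>"
    have "of_nat (count \<chi> c) / fact_mset \<chi> = 1 / fact_mset (\<chi> - {#c#})"
      using c by (simp add: fact_mset_remove[OF c])
    then show "pm_scale (of_nat (count \<chi> c) / fact_mset \<chi>) (\<delta> (u c) * (\<Prod>c\<in>#\<chi> - {#c#}. u c)) =
        \<delta> (u c) * divpow_mset u (\<chi> - {#c#})"
      by (simp add: divpow_mset_def pm_scale_mult_right)
  qed
  finally show ?thesis .
qed

lemma euler_divpow_mset:
  "(\<Sum>c\<in>set_mset \<chi>. u c * divpow_mset u (\<chi> - {#c#})) = pm_scale (of_nat (size \<chi>)) (divpow_mset u \<chi>)"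
proof -
  have "(\<Sum>c\<in>set_mset \<chi>. u c * divpow_mset u (\<chi> - {#c#})) =
      (\<Sum>c\<in>set_mset \<chi>. pm_scale (of_nat (count \<chi> c)) (divpow_mset u \<chi>))"
    by (intro sum.cong) (simp_all add: divpow_mset_remove)
  then show ?thesis by (simp add: size_eq_sum_count pm.scale_sum_left)
qed

context based_algebra
begin

lemma mset_prod_closed: "set_mset \<psi> \<subseteq> carrier A \<Longrightarrow> mset_prod A \<psi> \<in> carrier A"
  unfolding mset_prod_def by (intro A.finprod_closed) auto

lemma mset_prod_empty [simp]: "mset_prod A {#} = \<one>\<^bsub>A\<^esub>"
  by (simp add: mset_prod_def)

lemma mset_prod_add:
  assumes "c \<in> carrier A" "set_mset \<psi> \<subseteq> carrier A"
  shows "mset_prod A (add_mset c \<psi>) = c \<otimes>\<^bsub>A\<^esub> mset_prod A \<psi>"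
proof -
  let ?S = "set_mset \<psi> - {c}" and ?pow = "\<lambda>\<psi> a. a [^]\<^bsub>A\<^esub> count \<psi> a"
  have S: "finite ?S" "c \<notin> ?S" "?S \<subseteq> carrier A" using assms by auto
  have P: "?pow \<psi>' \<in> ?S \<rightarrow> carrier A" "?pow \<psi>' c \<in> carrier A" for \<psi>' using S(3) assms by auto
  have "mset_prod A \<psi> = finprod A (?pow \<psi>) (insert c ?S)"
    unfolding mset_prod_def
    by (intro A.finprod_mono_neutral_cong_left) (use assms in \<open>auto simp: not_in_iff\<close>)
  then have 1: "mset_prod A \<psi> = ?pow \<psi> c \<otimes>\<^bsub>A\<^esub> finprod A (?pow \<psi>) ?S"
    using A.finprod_insert[OF S(1,2) P(1)[of \<psi>] P(2)[of \<psi>]] by (simp only:)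
  have "mset_prod A (add_mset c \<psi>) = finprod A (?pow (add_mset c \<psi>)) (insert c ?S)"
    unfolding mset_prod_def by (rule arg_cong[of _ _ "finprod A _"]) auto
  then have 2: "mset_prod A (add_mset c \<psi>) = ?pow (add_mset c \<psi>) c \<otimes>\<^bsub>A\<^esub> finprod A (?pow (add_mset c \<psi>)) ?S"
    using A.finprod_insert[OF S(1,2) P(1)[of "add_mset c \<psi>"] P(2)[of "add_mset c \<psi>"]] by (simp only:)
  have 3: "finprod A (?pow (add_mset c \<psi>)) ?S = finprod A (?pow \<psi>) ?S"
    by (rule A.finprod_cong') (use P in auto)
  have 4: "finprod A (?pow \<psi>) ?S \<in> carrier A" using P by (intro A.finprod_closed)
  show ?thesis
    unfolding 1 2 3 using assms 4 by (simp add: A.nat_pow_Suc A.m_ac)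
qed

text \<open>
  By the Leibniz rule, the summand of \<open>\<psi>\<close> consists of the term \<open>T \<psi>\<close>, where the derivation hits the power
  of \<open>X 1\<close>, and of the terms where it hits a factor \<open>X c\<close> of the rest. The latter equals \<open>T (\<psi> + c)\<close>, since
  \<open>\<pi>(\<psi>) c = \<pi>(\<psi> + c)\<close>. With Pascal's rule for the coefficients \<open>multinom\<close>, all terms cancel except
  \<open>T 0\<close>.
\<close>

lemma telescoping:
  assumes \<delta>: "\<And>b. b \<in> carrier A \<Longrightarrow> derivation (\<delta> b)"
    and \<delta>X: "\<And>b c. b \<in> carrier A \<Longrightarrow> c \<in> carrier A \<Longrightarrow> \<delta> b (X c) = U (b \<otimes>\<^bsub>A\<^esub> c)"
    and \<chi>: "set_mset \<chi> \<subseteq> carrier A" and d: "d \<in> carrier A"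
  shows "(\<Sum>\<psi> | \<psi> \<subseteq># \<chi>. pm_scale ((- 1) ^ size \<psi> * multinom \<psi>)
      (\<delta> (d \<otimes>\<^bsub>A\<^esub> mset_prod A \<psi>) (divpow (X \<one>\<^bsub>A\<^esub>) (k + size \<psi>) * divpow_mset X (\<chi> - \<psi>)))) =
    U d * divpow_pred (X \<one>\<^bsub>A\<^esub>) k * divpow_mset X \<chi>"
proof -
  let ?S = "{\<psi>. \<psi> \<subseteq># \<chi>}" and ?x = "X \<one>\<^bsub>A\<^esub>" and ?\<pi> = "\<lambda>\<psi>. d \<otimes>\<^bsub>A\<^esub> mset_prod A \<psi>"
  have fin: "finite ?S" by (rule finite_subset_mset)
  have car: "set_mset \<psi> \<subseteq> carrier A" if "\<psi> \<subseteq># \<chi>" for \<psi>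
    using that \<chi> by (meson order_trans set_mset_mono)
  have \<pi>: "?\<pi> \<psi> \<in> carrier A" if "\<psi> \<subseteq># \<chi>" for \<psi>
    using d mset_prod_closed[OF car[OF that]] by simp
  define T where "T \<psi> = U (?\<pi> \<psi>) * divpow_pred ?x (k + size \<psi>) * divpow_mset X (\<chi> - \<psi>)" for \<psi>
  define s where "s \<psi> = ((- 1) ^ size \<psi> :: complex)" for \<psi> :: "'a multiset"
  define G where "G \<psi> c = pm_scale (s \<psi> * multinom \<psi>) (T (add_mset c \<psi>))" for \<psi> c
  have step: "pm_scale (s \<psi> * multinom \<psi>) (\<delta> (?\<pi> \<psi>) (divpow ?x (k + size \<psi>) * divpow_mset X (\<chi> - \<psi>))) =
      pm_scale (s \<psi> * multinom \<psi>) (T \<psi>) + (\<Sum>c\<in>set_mset (\<chi> - \<psi>). G \<psi> c)" if \<psi>: "\<psi> \<subseteq># \<chi>" for \<psi>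
  proof -
    note D = \<delta>[OF \<pi>[OF \<psi>]]
    have "divpow ?x (k + size \<psi>) * \<delta> (?\<pi> \<psi>) (divpow_mset X (\<chi> - \<psi>)) =
        (\<Sum>c\<in>set_mset (\<chi> - \<psi>). T (add_mset c \<psi>))"
      unfolding derivation_divpow_mset[OF D] sum_distrib_left
    proof (intro sum.cong refl)
      fix c assume "c \<in># \<chi> - \<psi>"
      then have c: "c \<in> carrier A" using \<chi> by (meson in_diffD subsetD)
      have "?\<pi> \<psi> \<otimes>\<^bsub>A\<^esub> c = ?\<pi> (add_mset c \<psi>)"
        using c d car[OF \<psi>] mset_prod_closed[OF car[OF \<psi>]] by (simp add: mset_prod_add A.m_ac)
      then show "divpow ?x (k + size \<psi>) * (\<delta> (?\<pi> \<psi>) (X c) * divpow_mset X (\<chi> - \<psi> - {#c#})) = T (add_mset c \<psi>)"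
        using \<delta>X[OF \<pi>[OF \<psi>] c] by (simp add: T_def divpow_pred_def mult_ac)
    qed
    moreover have "\<delta> (?\<pi> \<psi>) (divpow ?x (k + size \<psi>)) = U (?\<pi> \<psi>) * divpow_pred ?x (k + size \<psi>)"
      unfolding derivation_divpow[OF D] using \<delta>X[OF \<pi>[OF \<psi>], of "\<one>\<^bsub>A\<^esub>"] \<pi>[OF \<psi>] by simp
    ultimately show ?thesis
      unfolding derivation_mult[OF D] G_def
      by (simp add: T_def pm.scale_right_distrib pm.scale_sum_right)
  qed
  (* Reindexing by the multiset that results from adding c to \<psi>. *)
  have "(\<Sum>\<psi>\<in>?S. \<Sum>c\<in>set_mset (\<chi> - \<psi>). G \<psi> c) = (\<Sum>(\<psi>, c)\<in>Sigma ?S (\<lambda>\<psi>. set_mset (\<chi> - \<psi>)). G \<psi> c)"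
    using fin by (intro sum.Sigma) auto
  also have "\<dots> = (\<Sum>(\<psi>, c)\<in>Sigma ?S set_mset. G (\<psi> - {#c#}) c)"
  proof (rule sum.reindex_bij_witness[where i = "\<lambda>(\<psi>, c). (\<psi> - {#c#}, c)" and j = "\<lambda>(\<psi>, c). (add_mset c \<psi>, c)"]; clarsimp)
    show "add_mset c \<psi> \<subseteq># \<chi>" if sub: "\<psi> \<subseteq># \<chi>" "c \<in># \<chi> - \<psi>" for \<psi> c
    proof -
      obtain \<rho> where \<chi>: "\<chi> = \<psi> + \<rho>" using sub by (auto simp: mset_subset_eq_exists_conv)
      then obtain \<rho>' where "\<rho> = add_mset c \<rho>'" using sub by (auto dest: multi_member_split)
      then show ?thesis by (simp add: \<chi>)
    qed
    show "\<psi> - {#c#} \<subseteq># \<chi> \<and> c \<in># \<chi> - (\<psi> - {#c#})" if sub: "\<psi> \<subseteq># \<chi>" "c \<in># \<psi>" for \<psi> c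
    proof -
      obtain \<xi> \<rho> where "\<psi> = add_mset c \<xi>" "\<chi> = \<psi> + \<rho>"
        using sub by (auto dest: multi_member_split simp: mset_subset_eq_exists_conv)
      then have "\<psi> - {#c#} = \<xi>" "\<chi> = \<xi> + add_mset c \<rho>" by simp_all
      then show ?thesis by simp
    qed
  qed
  also have "\<dots> = (\<Sum>\<psi>\<in>?S. \<Sum>c\<in>set_mset \<psi>. G (\<psi> - {#c#}) c)"
    using fin by (intro sum.Sigma[symmetric]) auto
  also have "\<dots> = (\<Sum>\<psi>\<in>?S. if \<psi> = {#} then 0 else - pm_scale (s \<psi> * multinom \<psi>) (T \<psi>))"
  proof (intro sum.cong refl)
    fix \<psi>
    have "(\<Sum>c\<in>set_mset \<psi>. G (\<psi> - {#c#}) c) = pm_scale (- s \<psi> * (\<Sum>c\<in>set_mset \<psi>. multinom (\<psi> - {#c#}))) (T \<psi>)"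
      unfolding sum_distrib_left pm.scale_sum_left
    proof (intro sum.cong refl)
      fix c assume "c \<in># \<psi>"
      then obtain \<xi> where "\<psi> = add_mset c \<xi>" by (auto dest: multi_member_split)
      then show "G (\<psi> - {#c#}) c = pm_scale (- s \<psi> * multinom (\<psi> - {#c#})) (T \<psi>)"
        by (simp add: G_def s_def)
    qed
    then show "(\<Sum>c\<in>set_mset \<psi>. G (\<psi> - {#c#}) c) =
        (if \<psi> = {#} then 0 else - pm_scale (s \<psi> * multinom \<psi>) (T \<psi>))"
      by (simp add: multinom_remove_sum pm.scale_minus_left)
  qed
  finally have G: "(\<Sum>\<psi>\<in>?S. \<Sum>c\<in>set_mset (\<chi> - \<psi>). G \<psi> c) =
      (\<Sum>\<psi>\<in>?S. if \<psi> = {#} then 0 else - pm_scale (s \<psi> * multinom \<psi>) (T \<psi>))" .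
  have "(\<Sum>\<psi>\<in>?S. pm_scale (s \<psi> * multinom \<psi>)
      (\<delta> (?\<pi> \<psi>) (divpow ?x (k + size \<psi>) * divpow_mset X (\<chi> - \<psi>)))) =
    (\<Sum>\<psi>\<in>?S. pm_scale (s \<psi> * multinom \<psi>) (T \<psi>)) + (\<Sum>\<psi>\<in>?S. \<Sum>c\<in>set_mset (\<chi> - \<psi>). G \<psi> c)"
    unfolding sum.distrib[symmetric] by (intro sum.cong) (auto simp: step)
  also have "\<dots> = (\<Sum>\<psi>\<in>?S. if \<psi> = {#} then pm_scale (s \<psi> * multinom \<psi>) (T \<psi>) else 0)"
    unfolding G sum.distrib[symmetric] by (intro sum.cong) auto
  also have "\<dots> = pm_scale (s {#} * multinom ({#} :: 'a multiset)) (T {#})"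
  proof -
    have "(\<Sum>\<psi>\<in>?S. if \<psi> = {#} then pm_scale (s \<psi> * multinom \<psi>) (T \<psi>) else 0) =
        (\<Sum>\<psi>\<in>?S. if \<psi> = {#} then pm_scale (s {#} * multinom ({#} :: 'a multiset)) (T {#}) else 0)"
      by (intro sum.cong) auto
    then show ?thesis using fin by simp
  qed
  also have "\<dots> = U d * divpow_pred ?x k * divpow_mset X \<chi>"
    using d by (simp add: s_def multinom_eq T_def)
  finally show ?thesis by (simp add: s_def)
qed

lemma telescoping_with_factor:
  assumes \<delta>: "\<And>b. b \<in> carrier A \<Longrightarrow> derivation (\<delta> b)"
    and \<delta>X: "\<And>b c. b \<in> carrier A \<Longrightarrow> c \<in> carrier A \<Longrightarrow> \<delta> b (X c) = U (b \<otimes>\<^bsub>A\<^esub> c)"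
    and \<delta>R: "\<And>b. b \<in> carrier A \<Longrightarrow> \<delta> b R = 0"
    and \<chi>: "set_mset \<chi> \<subseteq> carrier A" and d: "d \<in> carrier A"
  shows "(\<Sum>\<psi> | \<psi> \<subseteq># \<chi>. pm_scale ((- 1) ^ size \<psi> * multinom \<psi>)
      (\<delta> (d \<otimes>\<^bsub>A\<^esub> mset_prod A \<psi>) (divpow (X \<one>\<^bsub>A\<^esub>) (k + size \<psi>) * divpow_mset X (\<chi> - \<psi>) * R))) =
    U d * divpow_pred (X \<one>\<^bsub>A\<^esub>) k * divpow_mset X \<chi> * R" (is "?lhs = ?rhs")
proof -
  have "\<delta> (d \<otimes>\<^bsub>A\<^esub> mset_prod A \<psi>) (p * R) = \<delta> (d \<otimes>\<^bsub>A\<^esub> mset_prod A \<psi>) p * R" if "\<psi> \<subseteq># \<chi>" for \<psi> p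
  proof -
    have "mset_prod A \<psi> \<in> carrier A"
      using that \<chi> by (meson mset_prod_closed order_trans set_mset_mono)
    then have "d \<otimes>\<^bsub>A\<^esub> mset_prod A \<psi> \<in> carrier A" using d by simp
    then show ?thesis using derivation_mult[OF \<delta>] \<delta>R by simp
  qed
  then have "?lhs = (\<Sum>\<psi> | \<psi> \<subseteq># \<chi>. pm_scale ((- 1) ^ size \<psi> * multinom \<psi>)
      (\<delta> (d \<otimes>\<^bsub>A\<^esub> mset_prod A \<psi>) (divpow (X \<one>\<^bsub>A\<^esub>) (k + size \<psi>) * divpow_mset X (\<chi> - \<psi>)))) * R"
    unfolding sum_distrib_right pm_scale_mult_left by (intro sum.cong) auto
  also have "\<dots> = ?rhs"
    using telescoping[where \<delta> = \<delta> and X = X and U = U and k = k, OF assms(1,2,4,5)] by simp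
  finally show ?thesis .
qed

text \<open>
  The recursion of \<open>q\<^sub>i\<close>, with derivations \<open>h\<close> and \<open>e\<close> in place of \<open>h\<^sub>i\<close> and \<open>x\<^sub>-\<^sub>i\<close>, vectors \<open>X c\<close> and \<open>Y c\<close> in place
  of \<open>v\<^sub>i \<otimes> c\<close> and \<open>v\<^sub>i\<^sub>+\<^sub>1 \<otimes> c\<close>, and a factor \<open>R\<close> on which both vanish. Insert the formula into the
  recursion: the sign \<open>(-1)\<^bsup>|\<chi> - \<psi>|\<^esup>\<close> makes the sum over \<open>\<psi>\<close> alternating, and it telescopes. For \<open>\<phi> \<noteq> 0\<close>,
  the sum over \<open>d\<close> is the Euler identity in the letters \<open>Y d\<close>. For \<open>\<phi> = 0\<close> the term \<open>\<psi> = 0\<close> is missing; it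
  is the Euler operator \<open>h 1\<close> on a form in the \<open>X c\<close>, and exceeds the telescoped sum by \<open>|\<chi>|\<close> times
  the claimed form, and the recursion divides by \<open>|\<chi>|\<close>.
\<close>

lemma q_recursion_solution:
  fixes h e :: "'a \<Rightarrow> (nat \<times> 'a) mpoly \<Rightarrow> (nat \<times> 'a) mpoly"
    and Q :: "'a multiset \<Rightarrow> 'a multiset \<Rightarrow> (nat \<times> 'a) mpoly \<Rightarrow> (nat \<times> 'a) mpoly"
  assumes h: "\<And>b. b \<in> carrier A \<Longrightarrow> derivation (h b)"
    and hX: "\<And>b c. b \<in> carrier A \<Longrightarrow> c \<in> carrier A \<Longrightarrow> h b (X c) = X (b \<otimes>\<^bsub>A\<^esub> c)"
    and hR: "\<And>b. b \<in> carrier A \<Longrightarrow> h b R = 0"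
    and e: "\<And>b. b \<in> carrier A \<Longrightarrow> derivation (e b)"
    and eX: "\<And>b c. b \<in> carrier A \<Longrightarrow> c \<in> carrier A \<Longrightarrow> e b (X c) = Y (b \<otimes>\<^bsub>A\<^esub> c)"
    and eY: "\<And>b c. b \<in> carrier A \<Longrightarrow> c \<in> carrier A \<Longrightarrow> e b (Y c) = 0"
    and eR: "\<And>b. b \<in> carrier A \<Longrightarrow> e b R = 0"
    and Q00: "\<And>p. Q {#} {#} p = p"
    and Q0: "\<And>\<chi> p. set_mset \<chi> \<subseteq> carrier A \<Longrightarrow> \<chi> \<noteq> {#} \<Longrightarrow> Q {#} \<chi> p = pm_scale (- 1 / of_nat (size \<chi>))
      (\<Sum>\<psi> | \<psi> \<noteq> {#} \<and> \<psi> \<subseteq># \<chi>. pm_scale (multinom \<psi>) (h (mset_prod A \<psi>) (Q {#} (\<chi> - \<psi>) p)))"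
    and Q: "\<And>\<phi> \<chi> p. set_mset \<phi> \<subseteq> carrier A \<Longrightarrow> set_mset \<chi> \<subseteq> carrier A \<Longrightarrow> \<phi> \<noteq> {#} \<Longrightarrow>
      Q \<phi> \<chi> p = pm_scale (- 1 / of_nat (size \<phi>))
        (\<Sum>\<psi> | \<psi> \<subseteq># \<chi>. \<Sum>d\<in>set_mset \<phi>. pm_scale (multinom \<psi>)
          (e (d \<otimes>\<^bsub>A\<^esub> mset_prod A \<psi>) (Q (\<phi> - {#d#}) (\<chi> - \<psi>) p)))"
  shows "set_mset \<phi> \<subseteq> carrier A \<Longrightarrow> set_mset \<chi> \<subseteq> carrier A \<Longrightarrow> size \<phi> + size \<chi> \<le> r \<Longrightarrow>
    Q \<phi> \<chi> (divpow (X \<one>\<^bsub>A\<^esub>) r * R) = pm_scale ((- 1) ^ (size \<phi> + size \<chi>))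
      (divpow (X \<one>\<^bsub>A\<^esub>) (r - size \<phi> - size \<chi>) * divpow_mset X \<chi> * (divpow_mset Y \<phi> * R))"
proof (induction "size \<phi> + size \<chi>" arbitrary: \<phi> \<chi> rule: less_induct)
  case less
  let ?x = "X \<one>\<^bsub>A\<^esub>" and ?p = "divpow (X \<one>\<^bsub>A\<^esub>) r * R"
  have sub: "set_mset (\<chi> - \<psi>) \<subseteq> carrier A" "size (\<chi> - \<psi>) = size \<chi> - size \<psi>" "size \<psi> \<le> size \<chi>"
    "mset_prod A \<psi> \<in> carrier A" if "\<psi> \<subseteq># \<chi>" for \<psi>
    using less.prems(2) mset_prod_closed[of \<psi>] set_mset_mono[OF that] size_Diff_submset[OF that]
      size_mset_mono[OF that] in_diffD[of _ \<chi> \<psi>]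
    by blast+
  have sgn: "(- 1) ^ (a - b) = (- 1) ^ a * (- 1 :: complex) ^ b" if "b \<le> a" for a b :: nat
    using that by (cases "even b") (simp_all add: power_diff)
  show ?case
  proof (cases "\<phi> = {#}")
    case True
    show ?thesis
    proof (cases "\<chi> = {#}")
      case True
      with \<open>\<phi> = {#}\<close> show ?thesis by (simp add: Q00)
    next
      case False
      let ?k = "r - size \<chi>"
      define F where "F \<psi> = pm_scale ((- 1) ^ size \<psi> * multinom \<psi>) (h (\<one>\<^bsub>A\<^esub> \<otimes>\<^bsub>A\<^esub> mset_prod A \<psi>)
          (divpow ?x (?k + size \<psi>) * divpow_mset X (\<chi> - \<psi>) * R))" for \<psi>
      have "pm_scale (multinom \<psi>) (h (mset_prod A \<psi>) (Q {#} (\<chi> - \<psi>) ?p)) = pm_scale ((- 1) ^ size \<chi>) (F \<psi>)"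
        if \<psi>: "\<psi> \<noteq> {#}" "\<psi> \<subseteq># \<chi>" for \<psi>
      proof -
        have "Q {#} (\<chi> - \<psi>) ?p = pm_scale ((- 1) ^ size (\<chi> - \<psi>))
            (divpow ?x (r - size (\<chi> - \<psi>)) * divpow_mset X (\<chi> - \<psi>) * R)"
          using less.hyps[of "{#}" "\<chi> - \<psi>"] less.prems sub[OF \<psi>(2)] \<psi>(1) \<open>\<phi> = {#}\<close>
          by (simp add: nonempty_has_size)
        moreover have "r - size (\<chi> - \<psi>) = ?k + size \<psi>"
          using sub[OF \<psi>(2)] less.prems \<open>\<phi> = {#}\<close> by simp
        ultimately show ?thesis
          using sub[OF \<psi>(2)]
          by (simp add: F_def linear_simps(2)[OF derivation_linear[OF h]] sgn mult_ac)
      qed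
      then have "Q {#} \<chi> ?p = pm_scale (- 1 / of_nat (size \<chi>)) (\<Sum>\<psi> | \<psi> \<noteq> {#} \<and> \<psi> \<subseteq># \<chi>. pm_scale ((- 1) ^ size \<chi>) (F \<psi>))"
        unfolding Q0[OF less.prems(2) False] by (intro arg_cong[of _ _ "pm_scale _"] sum.cong) auto
      also have "\<dots> = pm_scale (- ((- 1) ^ size \<chi>) / of_nat (size \<chi>)) (\<Sum>\<psi> | \<psi> \<noteq> {#} \<and> \<psi> \<subseteq># \<chi>. F \<psi>)"
        unfolding pm.scale_sum_right[symmetric] pm.scale_scale by simp
      also have "(\<Sum>\<psi> | \<psi> \<noteq> {#} \<and> \<psi> \<subseteq># \<chi>. F \<psi>) = - pm_scale (of_nat (size \<chi>)) (divpow ?x ?k * divpow_mset X \<chi> * R)"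
      proof -
        have "{\<psi>. \<psi> \<subseteq># \<chi>} = insert {#} {\<psi>. \<psi> \<noteq> {#} \<and> \<psi> \<subseteq># \<chi>}" by auto
        moreover have "finite {\<psi>. \<psi> \<noteq> {#} \<and> \<psi> \<subseteq># \<chi>}"
          by (rule finite_subset[OF _ finite_subset_mset[of \<chi>]]) auto
        ultimately have "(\<Sum>\<psi> | \<psi> \<subseteq># \<chi>. F \<psi>) = F {#} + (\<Sum>\<psi> | \<psi> \<noteq> {#} \<and> \<psi> \<subseteq># \<chi>. F \<psi>)"
          by simp
        moreover have "(\<Sum>\<psi> | \<psi> \<subseteq># \<chi>. F \<psi>) = pm_scale (of_nat ?k) (divpow ?x ?k * divpow_mset X \<chi> * R)"
          unfolding F_def
          using telescoping_with_factor[where \<delta> = h and X = X and U = X and k = ?k and d = "\<one>\<^bsub>A\<^esub>", OF h hX hR less.prems(2)]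
          by (simp add: mult_divpow_pred pm_scale_mult_left)
        moreover have "F {#} = pm_scale (of_nat ?k + of_nat (size \<chi>)) (divpow ?x ?k * divpow_mset X \<chi> * R)"
        proof -
          have d: "derivation (h \<one>\<^bsub>A\<^esub>)" by (rule h) simp
          have "h \<one>\<^bsub>A\<^esub> (divpow_mset X \<chi>) = pm_scale (of_nat (size \<chi>)) (divpow_mset X \<chi>)"
          proof -
            have "h \<one>\<^bsub>A\<^esub> (divpow_mset X \<chi>) = (\<Sum>c\<in>set_mset \<chi>. X c * divpow_mset X (\<chi> - {#c#}))"
              unfolding derivation_divpow_mset[OF d] using less.prems(2) by (intro sum.cong) (auto simp: hX)
            then show ?thesis by (simp add: euler_divpow_mset)
          qed
          moreover have "h \<one>\<^bsub>A\<^esub> (divpow ?x ?k) = pm_scale (of_nat ?k) (divpow ?x ?k)"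
            unfolding derivation_divpow[OF d] by (simp add: hX mult_divpow_pred)
          ultimately show ?thesis
            by (simp add: F_def multinom_eq derivation_mult[OF d] hR pm_scale_mult_left pm_scale_mult_right
                pm.scale_left_distrib distrib_right)
        qed
        ultimately show ?thesis by (simp add: pm.scale_left_distrib algebra_simps eq_neg_iff_add_eq_0)
      qed
      also have "pm_scale (- ((- 1) ^ size \<chi>) / of_nat (size \<chi>)) (- pm_scale (of_nat (size \<chi>)) p) = pm_scale ((- 1) ^ size \<chi>) p"
        for p :: "(nat \<times> 'a) mpoly"
        unfolding pm.scale_minus_right pm.scale_scale pm.scale_minus_left[symmetric]
        by (rule arg_cong[where f = "\<lambda>c. pm_scale c p"]) (use False in simp)
      finally show ?thesis
        unfolding \<open>\<phi> = {#}\<close> by simp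
    qed
  next
    case False
    let ?k = "Suc (r - size \<phi> - size \<chi>)" and ?s = "(- 1) ^ (size \<phi> + size \<chi>) :: complex"
    define F where "F d \<psi> = pm_scale ((- 1) ^ size \<psi> * multinom \<psi>) (e (d \<otimes>\<^bsub>A\<^esub> mset_prod A \<psi>)
        (divpow ?x (?k + size \<psi>) * divpow_mset X (\<chi> - \<psi>) * (divpow_mset Y (\<phi> - {#d#}) * R)))" for d \<psi>
    have phi: "size (\<phi> - {#d#}) = size \<phi> - 1" "size \<phi> \<ge> 1" "d \<in> carrier A"
      "set_mset (\<phi> - {#d#}) \<subseteq> carrier A" if "d \<in># \<phi>" for d
      using that less.prems(1) by (auto simp: size_Diff_singleton Suc_le_eq nonempty_has_size[symmetric] dest: in_diffD)
    have "pm_scale (multinom \<psi>) (e (d \<otimes>\<^bsub>A\<^esub> mset_prod A \<psi>) (Q (\<phi> - {#d#}) (\<chi> - \<psi>) ?p)) = - pm_scale ?s (F d \<psi>)"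
      if \<psi>: "\<psi> \<subseteq># \<chi>" and d: "d \<in># \<phi>" for d \<psi>
    proof -
      have "Q (\<phi> - {#d#}) (\<chi> - \<psi>) ?p = pm_scale ((- 1) ^ (size (\<phi> - {#d#}) + size (\<chi> - \<psi>)))
          (divpow ?x (r - size (\<phi> - {#d#}) - size (\<chi> - \<psi>)) * divpow_mset X (\<chi> - \<psi>) * (divpow_mset Y (\<phi> - {#d#}) * R))"
        using less.hyps[of "\<phi> - {#d#}" "\<chi> - \<psi>"] less.prems sub[OF \<psi>] phi[OF d] by simp
      moreover have "r - size (\<phi> - {#d#}) - size (\<chi> - \<psi>) = ?k + size \<psi>"
        using sub[OF \<psi>] phi[OF d] less.prems by simp
      moreover have "(- 1) ^ (size (\<phi> - {#d#}) + size (\<chi> - \<psi>)) = - ?s * (- 1) ^ size \<psi>"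
        unfolding phi(1)[OF d] sub(2)[OF \<psi>] power_add sgn[OF sub(3)[OF \<psi>]] sgn[OF phi(2)[OF d]] by simp
      ultimately show ?thesis
        using sub[OF \<psi>] phi[OF d]
        by (simp add: F_def linear_simps(2,5)[OF derivation_linear[OF e]] mult_ac pm.scale_minus_left pm.scale_minus_right)
    qed
    then have "Q \<phi> \<chi> ?p = pm_scale (- 1 / of_nat (size \<phi>)) (\<Sum>\<psi> | \<psi> \<subseteq># \<chi>. \<Sum>d\<in>set_mset \<phi>. - pm_scale ?s (F d \<psi>))"
      unfolding Q[OF less.prems(1,2) False] by (intro arg_cong[of _ _ "pm_scale _"] sum.cong) auto
    also have "\<dots> = pm_scale (?s / of_nat (size \<phi>)) (\<Sum>d\<in>set_mset \<phi>. \<Sum>\<psi> | \<psi> \<subseteq># \<chi>. F d \<psi>)"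
      unfolding sum_negf pm.scale_sum_right[symmetric] pm.scale_minus_right pm.scale_scale
      by (subst sum.swap) (simp add: pm.scale_minus_left)
    also have "(\<Sum>d\<in>set_mset \<phi>. \<Sum>\<psi> | \<psi> \<subseteq># \<chi>. F d \<psi>) =
        (\<Sum>d\<in>set_mset \<phi>. Y d * divpow_mset Y (\<phi> - {#d#}) * (divpow ?x (r - size \<phi> - size \<chi>) * divpow_mset X \<chi> * R))"
    proof (intro sum.cong refl)
      fix d assume d: "d \<in># \<phi>"
      have "e b (divpow_mset Y (\<phi> - {#d#}) * R) = 0" if b: "b \<in> carrier A" for b
      proof -
        have "e b (divpow_mset Y (\<phi> - {#d#})) = 0"
          unfolding derivation_divpow_mset[OF e[OF b]]
          using eY[OF b] phi(4)[OF d] by (intro sum.neutral) auto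
        then show ?thesis using derivation_mult[OF e[OF b]] eR[OF b] by simp
      qed
      then have "(\<Sum>\<psi> | \<psi> \<subseteq># \<chi>. F d \<psi>) = Y d * divpow_pred ?x ?k * divpow_mset X \<chi> * (divpow_mset Y (\<phi> - {#d#}) * R)"
        unfolding F_def
        by (intro telescoping_with_factor e eX less.prems phi(3)[OF d])
      then show "(\<Sum>\<psi> | \<psi> \<subseteq># \<chi>. F d \<psi>) =
          Y d * divpow_mset Y (\<phi> - {#d#}) * (divpow ?x (r - size \<phi> - size \<chi>) * divpow_mset X \<chi> * R)"
        by (simp add: divpow_pred_def mult_ac)
    qed
    also have "\<dots> = pm_scale (of_nat (size \<phi>)) (divpow_mset Y \<phi> * (divpow ?x (r - size \<phi> - size \<chi>) * divpow_mset X \<chi> * R))"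
      unfolding sum_distrib_right[symmetric] euler_divpow_mset pm_scale_mult_left ..
    also have "pm_scale (?s / of_nat (size \<phi>)) (pm_scale (of_nat (size \<phi>)) p) = pm_scale ?s p"
      for p :: "(nat \<times> 'a) mpoly"
      unfolding pm.scale_scale
      by (rule arg_cong[where f = "\<lambda>c. pm_scale c p"]) (use False in simp)
    finally show ?thesis
      by (simp only: mult_ac)
  qed
qed

end



section \<open>Quotient modules\<close>

lemma submoduleD:
  assumes "submodule R N M"
  shows "N \<subseteq> carrier M" "\<zero>\<^bsub>M\<^esub> \<in> N" "x \<in> N \<Longrightarrow> y \<in> N \<Longrightarrow> x \<oplus>\<^bsub>M\<^esub> y \<in> N"
    "c \<in> carrier R \<Longrightarrow> x \<in> N \<Longrightarrow> c \<odot>\<^bsub>M\<^esub> x \<in> N"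
  using assms by (auto simp: submodule_def)

lemma (in Module.module) submodule_abelian_subgroup:
  assumes "submodule R N M"
  shows "abelian_subgroup N M"
proof (rule abelian_subgroupI2)
  show "comm_group (add_monoid M)" by (rule abelian_group.a_comm_group[OF M.abelian_group_axioms])
  note N = submoduleD[OF assms]
  have inv: "\<ominus>\<^bsub>M\<^esub> x \<in> N" if "x \<in> N" for x
  proof -
    have x: "x \<in> carrier M" using N(1) that by auto
    have "\<ominus>\<^bsub>M\<^esub> x = (\<ominus> \<one>) \<odot>\<^bsub>M\<^esub> x" using x by (simp add: smult_l_minus)
    with N(4) that show ?thesis by simp
  qed
  show "subgroup N (add_monoid M)"
    by (rule subgroup.intro) (use N inv in \<open>auto simp flip: a_inv_def\<close>)
qed

locale quotient_module = Module.module R M for R (structure) and M (structure) +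
  fixes N
  assumes N: "submodule R N M"
begin

sublocale N: abelian_subgroup N M
  by (rule submodule_abelian_subgroup[OF N])

abbreviation Q where "Q \<equiv> quotient_mod M N"

abbreviation cls where "cls x \<equiv> N +>\<^bsub>M\<^esub> x"

lemma carrier_Q: "carrier Q = cls ` carrier M"
  by (auto simp: quotient_mod_def A_RCOSETS_def')

lemma cls_closed [simp, intro]: "x \<in> carrier M \<Longrightarrow> cls x \<in> carrier Q"
  by (simp add: carrier_Q)

lemma mem_cls: "x \<in> carrier M \<Longrightarrow> y \<in> cls x \<longleftrightarrow> y \<in> carrier M \<and> y \<ominus>\<^bsub>M\<^esub> x \<in> N"
  by (metis N.a_elemrcos_carrier N.a_rcos_module a_minus_def)

lemma cls_eq_iff:
  assumes "x \<in> carrier M" "y \<in> carrier M"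
  shows "cls x = cls y \<longleftrightarrow> x \<ominus>\<^bsub>M\<^esub> y \<in> N"
proof
  assume "cls x = cls y"
  then have "x \<in> cls y" using N.a_rcos_self[OF assms(1)] by simp
  then show "x \<ominus>\<^bsub>M\<^esub> y \<in> N" using mem_cls assms by simp
next
  assume "x \<ominus>\<^bsub>M\<^esub> y \<in> N"
  then have "x \<in> cls y" using mem_cls assms by simp
  then show "cls x = cls y"
    using M.a_repr_independence[OF _ assms(2) N.a_subgroup] by simp
qed

lemma self_cls: "x \<in> carrier M \<Longrightarrow> x \<in> cls x"
  by (rule N.a_rcos_self)

lemma Q_add: "x \<in> carrier M \<Longrightarrow> y \<in> carrier M \<Longrightarrow> cls x \<oplus>\<^bsub>Q\<^esub> cls y = cls (x \<oplus>\<^bsub>M\<^esub> y)"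
  by (simp add: quotient_mod_def N.a_rcos_sum)

lemma cls_zero: "cls \<zero>\<^bsub>M\<^esub> = N"
  by (rule N.a_rcos_const) (rule submoduleD(2)[OF N])

lemma Q_zero: "\<zero>\<^bsub>Q\<^esub> = cls \<zero>\<^bsub>M\<^esub>"
  by (simp add: cls_zero) (simp add: quotient_mod_def)

lemma Q_smult:
  assumes "c \<in> carrier R" "x \<in> carrier M"
  shows "c \<odot>\<^bsub>Q\<^esub> cls x = cls (c \<odot>\<^bsub>M\<^esub> x)"
proof -
  have "cls (c \<odot>\<^bsub>M\<^esub> y) = cls (c \<odot>\<^bsub>M\<^esub> x)" if "y \<in> cls x" for y
  proof -
    have y: "y \<in> carrier M" "y \<ominus>\<^bsub>M\<^esub> x \<in> N" using that mem_cls assms by auto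
    have "c \<odot>\<^bsub>M\<^esub> y \<ominus>\<^bsub>M\<^esub> c \<odot>\<^bsub>M\<^esub> x = c \<odot>\<^bsub>M\<^esub> (y \<ominus>\<^bsub>M\<^esub> x)"
      using assms y by (simp add: a_minus_def smult_r_distr smult_r_minus)
    then show ?thesis
      using assms y submoduleD(4)[OF N] by (simp add: cls_eq_iff)
  qed
  then have "(\<Union>y\<in>cls x. cls (c \<odot>\<^bsub>M\<^esub> y)) = (\<Union>y\<in>cls x. cls (c \<odot>\<^bsub>M\<^esub> x))"
    by (rule SUP_cong[OF refl])
  moreover have "cls x \<noteq> {}" using self_cls[OF assms(2)] by blast
  ultimately show ?thesis by (simp add: quotient_mod_def)
qed

lemma module_Q: "module R Q"
proof (rule moduleI)
  show "cring R" by (rule R.is_cring)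
  show "abelian_group Q"
  proof (rule abelian_groupI)
    show "\<exists>y\<in>carrier Q. y \<oplus>\<^bsub>Q\<^esub> x = \<zero>\<^bsub>Q\<^esub>" if x: "x \<in> carrier Q" for x
    proof -
      obtain v where v: "v \<in> carrier M" "x = cls v" using x by (auto simp: carrier_Q)
      then have "cls (\<ominus>\<^bsub>M\<^esub> v) \<oplus>\<^bsub>Q\<^esub> x = \<zero>\<^bsub>Q\<^esub>"
        by (simp add: Q_add Q_zero M.l_neg)
      with v show ?thesis by blast
    qed
  qed (auto simp: carrier_Q Q_add Q_zero M.a_ac)
qed (auto simp: carrier_Q Q_add Q_smult smult_l_distr smult_r_distr smult_assoc1)

lemma cls_minus:
  assumes "x \<in> carrier M"
  shows "\<ominus>\<^bsub>Q\<^esub> cls x = cls (\<ominus>\<^bsub>M\<^esub> x)"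
proof -
  interpret Q: Module.module R Q by (rule module_Q)
  show ?thesis
    using assms by (intro Q.minus_equality) (auto simp: Q_add Q_zero M.l_neg)
qed

end

section \<open>Free spaces and free algebras\<close>

lemma module_free_space: "module class_ring (free_space X)"
proof (rule moduleI)
  show "cring (class_ring :: complex ring)" by (rule class_cring.is_cring)
  show "abelian_group (free_space X)"
  proof (rule abelian_groupI)
    fix p assume "p \<in> carrier (free_space X)"
    then show "\<exists>q\<in>carrier (free_space X). q \<oplus>\<^bsub>free_space X\<^esub> p = \<zero>\<^bsub>free_space X\<^esub>"
      by (intro bexI[of _ "- p"]) (auto simp: free_space_def)
  qed (auto simp: free_space_def algebra_simps dest: subsetD[OF Poly_Mapping.keys_add])
qed (auto simp: free_space_def pm.scale_left_distrib pm.scale_right_distrib in_keys_iff simp del: pm.scale_scale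
   simp flip: pm.scale_scale)

lemma free_space_simps:
  "carrier (free_space X) = {p. Poly_Mapping.keys p \<subseteq> X}"
  "\<zero>\<^bsub>free_space X\<^esub> = 0" "p \<oplus>\<^bsub>free_space X\<^esub> q = p + q" "c \<odot>\<^bsub>free_space X\<^esub> p = pm_scale c p"
  by (simp_all add: free_space_def)

lemma free_space_minus:
  assumes "p \<in> carrier (free_space X)" "q \<in> carrier (free_space X)"
  shows "p \<ominus>\<^bsub>free_space X\<^esub> q = p - q"
proof -
  interpret Module.module "class_ring :: complex ring" "free_space X" by (rule module_free_space)
  have "\<ominus>\<^bsub>free_space X\<^esub> q = - q"
    using assms by (intro M.minus_equality) (auto simp: free_space_simps)
  then show ?thesis by (simp add: a_minus_def free_space_simps)
qed

definition words_in :: "'x set \<Rightarrow> ('x free_word \<Rightarrow>\<^sub>0 complex) set"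
  where "words_in X = {p. \<forall>u\<in>Poly_Mapping.keys p. set (letters u) \<subseteq> X}"

lemma words_in_add [intro]: "p \<in> words_in X \<Longrightarrow> q \<in> words_in X \<Longrightarrow> p + q \<in> words_in X"
  unfolding words_in_def using Poly_Mapping.keys_add[of p q] by blast

lemma words_in_uminus [intro]: "p \<in> words_in X \<Longrightarrow> - p \<in> words_in X"
  by (simp add: words_in_def)

lemma words_in_diff [intro]: "p \<in> words_in X \<Longrightarrow> q \<in> words_in X \<Longrightarrow> p - q \<in> words_in X"
  unfolding words_in_def using keys_diff[of p q] by blast

lemma words_in_scale [intro]: "p \<in> words_in X \<Longrightarrow> pm_scale c p \<in> words_in X"
  unfolding words_in_def by (auto simp: in_keys_iff)

lemma words_in_mult [intro]:
  assumes "p \<in> words_in X" "q \<in> words_in X"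
  shows "p * q \<in> words_in X"
  unfolding words_in_def
proof (intro CollectI ballI)
  fix w assume "w \<in> Poly_Mapping.keys (p * q)"
  then obtain u v where "u \<in> Poly_Mapping.keys p" "v \<in> Poly_Mapping.keys q" "w = u + v"
    using keys_mult[of p q] by blast
  then show "set (letters w) \<subseteq> X"
    using assms by (auto simp: words_in_def plus_free_word_def)
qed

lemma words_in_zero [simp, intro]: "0 \<in> words_in X"
  by (simp add: words_in_def)

lemma words_in_one [simp, intro]: "1 \<in> words_in X"
  by (simp add: words_in_def zero_free_word_def)

lemma words_in_gen [intro]: "x \<in> X \<Longrightarrow> free_gen x \<in> words_in X"
  by (simp add: words_in_def free_gen_def)

lemma words_in_sum [intro]: "(\<And>i. i \<in> S \<Longrightarrow> f i \<in> words_in X) \<Longrightarrow> sum f S \<in> words_in X"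
  by (induction S rule: infinite_finite_induct) auto

lemma free_algebra_simps:
  "carrier (free_algebra X) = words_in X"
  "\<zero>\<^bsub>free_algebra X\<^esub> = 0" "\<one>\<^bsub>free_algebra X\<^esub> = 1" "p \<oplus>\<^bsub>free_algebra X\<^esub> q = p + q"
  "p \<otimes>\<^bsub>free_algebra X\<^esub> q = p * q" "c \<odot>\<^bsub>free_algebra X\<^esub> p = pm_scale c p"
  by (simp_all add: free_algebra_def words_in_def)

lemma abelian_group_free_algebra: "abelian_group (free_algebra X)"
proof (rule abelian_groupI)
  fix p assume "p \<in> carrier (free_algebra X)"
  then show "\<exists>q\<in>carrier (free_algebra X). q \<oplus>\<^bsub>free_algebra X\<^esub> p = \<zero>\<^bsub>free_algebra X\<^esub>"
    by (intro bexI[of _ "- p"]) (auto simp: free_algebra_simps)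
qed (auto simp: free_algebra_simps algebra_simps)

lemma module_free_algebra: "module class_ring (free_algebra X)"
  by (rule moduleI)
    (auto simp: free_algebra_simps pm.scale_left_distrib pm.scale_right_distrib
      intro: class_cring.is_cring abelian_group_free_algebra simp del: pm.scale_scale simp flip: pm.scale_scale)

lemma ring_free_algebra: "ring (free_algebra X)"
proof (rule ringI[OF abelian_group_free_algebra])
  show "monoid (free_algebra X)"
    by (rule monoidI) (auto simp: free_algebra_simps mult.assoc)
qed (auto simp: free_algebra_simps distrib_left distrib_right)

lemma free_algebra_minus:
  assumes "p \<in> words_in X" "q \<in> words_in X"
  shows "p \<ominus>\<^bsub>free_algebra X\<^esub> q = p - q" "\<ominus>\<^bsub>free_algebra X\<^esub> q = - q"
proof -
  interpret Module.module "class_ring :: complex ring" "free_algebra X" by (rule module_free_algebra)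
  show "\<ominus>\<^bsub>free_algebra X\<^esub> q = - q"
    using assms by (intro M.minus_equality) (auto simp: free_algebra_simps)
  then show "p \<ominus>\<^bsub>free_algebra X\<^esub> q = p - q" by (simp add: a_minus_def free_algebra_simps)
qed

lemma monomial_word_mult: "Poly_Mapping.single (Word (x # xs)) 1 = free_gen x * (Poly_Mapping.single (Word xs) 1 :: _ \<Rightarrow>\<^sub>0 complex)"
  by (simp add: free_gen_def mult_single plus_free_word_def)

lemma monomial_word_Nil: "(Poly_Mapping.single (Word []) 1 :: _ \<Rightarrow>\<^sub>0 complex) = 1"
  by (metis single_one zero_free_word_def)

lemma words_in_induct [consumes 1, case_names one gen scale add]:
  assumes "p \<in> words_in X" and one: "P 1"
    and gen: "\<And>x p. x \<in> X \<Longrightarrow> p \<in> words_in X \<Longrightarrow> P p \<Longrightarrow> P (free_gen x * p)"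
    and scale: "\<And>c p. p \<in> words_in X \<Longrightarrow> P p \<Longrightarrow> P (pm_scale c p)"
    and add: "\<And>p q. p \<in> words_in X \<Longrightarrow> q \<in> words_in X \<Longrightarrow> P p \<Longrightarrow> P q \<Longrightarrow> P (p + q)"
  shows "P p"
proof -
  have word: "Poly_Mapping.single (Word xs) 1 \<in> words_in X \<and> P (Poly_Mapping.single (Word xs) 1)" if "set xs \<subseteq> X" for xs
    using that
  proof (induction xs)
    case Nil
    then show ?case by (simp only: monomial_word_Nil) (auto intro: one)
  next
    case (Cons x xs)
    then show ?case by (simp only: monomial_word_mult) (auto intro: gen)
  qed
  have "0 \<in> words_in X \<and> P 0"
    using scale[OF _ one, of 0] by (simp add: pm.scale_zero_left)
  then have "p \<in> words_in X \<and> P p"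
  proof (rule pm_induct)
    fix u assume "u \<in> Poly_Mapping.keys p"
    then show "Poly_Mapping.single u 1 \<in> words_in X \<and> P (Poly_Mapping.single u 1)"
      using word[of "letters u"] assms(1) by (simp add: words_in_def)
  qed (auto intro: scale add)
  then show ?thesis by simp
qed



section \<open>The current algebra\<close>

lemma sl_simps:
  "carrier (sl n) = {M \<in> carrier_mat n n. (\<Sum>k<n. M $$ (k, k)) = 0}"
  "\<zero>\<^bsub>sl n\<^esub> = 0\<^sub>m n n" "x \<oplus>\<^bsub>sl n\<^esub> y = x + y" "c \<odot>\<^bsub>sl n\<^esub> x = c \<cdot>\<^sub>m x"
  "bracket (sl n) x y = x * y - y * x"
  by (simp_all add: sl_def)

lemma module_sl: "module class_ring (sl n)"
proof (rule moduleI)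
  show "cring (class_ring :: complex ring)" by (rule class_cring.is_cring)
  show "abelian_group (sl n)"
  proof (rule abelian_groupI)
    fix x assume "x \<in> carrier (sl n)"
    then show "\<exists>y\<in>carrier (sl n). y \<oplus>\<^bsub>sl n\<^esub> x = \<zero>\<^bsub>sl n\<^esub>"
      by (intro bexI[of _ "- x"]) (auto simp: sl_simps sum_negf uminus_l_inv_mat)
  qed (auto simp: sl_simps sum.distrib intro: assoc_add_mat comm_add_mat)
qed (auto simp: sl_simps sum_distrib_left[symmetric] sum.distrib add_smult_distrib_right_mat
      add_smult_distrib_left_mat intro!: eq_matI simp: algebra_simps)

lemma trace_comm:
  assumes "x \<in> carrier_mat n n" "y \<in> carrier_mat n n"
  shows "(\<Sum>k<n. (x * y) $$ (k, k)) = (\<Sum>k<n. (y * x) $$ (k, k) :: complex)"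
proof -
  have "(\<Sum>k<n. (x * y) $$ (k, k)) = (\<Sum>k<n. \<Sum>l<n. x $$ (k, l) * y $$ (l, k))"
    using assms by (intro sum.cong) (auto simp: scalar_prod_def atLeast0LessThan)
  also have "\<dots> = (\<Sum>l<n. \<Sum>k<n. y $$ (l, k) * x $$ (k, l))"
    by (subst sum.swap) (simp add: mult.commute)
  also have "\<dots> = (\<Sum>k<n. (y * x) $$ (k, k))"
    using assms by (intro sum.cong) (auto simp: scalar_prod_def atLeast0LessThan)
  finally show ?thesis .
qed

lemma sl_bracket_closed:
  "x \<in> carrier (sl n) \<Longrightarrow> y \<in> carrier (sl n) \<Longrightarrow> x * y - y * x \<in> carrier (sl n)"
  by (auto simp: sl_simps sum_subtractf trace_comm simp del: index_mult_mat(1))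

lemma sl_bracket_bilinear:
  assumes "x \<in> carrier_mat n n" "y \<in> carrier_mat n n" "w \<in> carrier_mat n n"
  shows "(x + y) * w - w * (x + y) = (x * w - w * x) + (y * w - w * (y :: complex mat))"
    "w * (x + y) - (x + y) * w = (w * x - x * w) + (w * y - y * w)"
    "(c \<cdot>\<^sub>m x) * w - w * (c \<cdot>\<^sub>m x) = c \<cdot>\<^sub>m (x * w - w * x)"
    "w * (c \<cdot>\<^sub>m x) - (c \<cdot>\<^sub>m x) * w = c \<cdot>\<^sub>m (w * x - x * w)"
  using assms
  by (auto intro!: eq_matI simp: scalar_prod_def add_mult_distrib_mat[of _ n n] mult_add_distrib_mat[of _ n n]
      mult_smult_distrib[of _ n n] mult_smult_assoc_mat[of _ n n] algebra_simps)

locale current_algebra = based_algebra A B for A :: "(complex, 'a) module" and B +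
  fixes n :: nat
  assumes n2: "n \<ge> 2"
begin

abbreviation "\<g> \<equiv> carrier (sl n)"
abbreviation "pairs \<equiv> \<g> \<times> carrier A"
abbreviation "null \<equiv> tensor_null (sl n) A"

sublocale FS: Module.module "class_ring :: complex ring" "free_space pairs"
  by (rule module_free_space)

sublocale SL: Module.module "class_ring :: complex ring" "sl n"
  by (rule module_sl)

lemma g_closed [simp, intro]:
  "x \<in> \<g> \<Longrightarrow> y \<in> \<g> \<Longrightarrow> x + y \<in> \<g>" "x \<in> \<g> \<Longrightarrow> c \<cdot>\<^sub>m x \<in> \<g>" "x \<in> \<g> \<Longrightarrow> y \<in> \<g> \<Longrightarrow> x * y - y * x \<in> \<g>"
  using SL.M.add.m_closed[of x y] SL.smult_closed[of c x] sl_bracket_closed[of x n y] by (auto simp: sl_simps)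

lemma g_carrier: "x \<in> \<g> \<Longrightarrow> x \<in> carrier_mat n n"
  by (simp add: sl_simps)

lemma pair_diff_closed: "Poly_Mapping.keys p \<subseteq> X \<Longrightarrow> Poly_Mapping.keys q \<subseteq> X \<Longrightarrow> Poly_Mapping.keys (p - q) \<subseteq> X"
  using keys_diff[of p q] by blast

lemma keys_single_subset: "x \<in> X \<Longrightarrow> Poly_Mapping.keys (Poly_Mapping.single x c) \<subseteq> X"
  by simp

lemma keys_sum_subset: "(\<And>i. i \<in> S \<Longrightarrow> Poly_Mapping.keys (f i) \<subseteq> X) \<Longrightarrow> Poly_Mapping.keys (sum f S) \<subseteq> X"
  using Poly_Mapping.keys_sum[of f S] by blast

lemma relations_closed: "tensor_relations (sl n) A \<subseteq> carrier (free_space pairs)"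
proof
  fix r assume "r \<in> tensor_relations (sl n) A"
  then show "r \<in> carrier (free_space pairs)"
    unfolding tensor_relations_def free_space_simps sl_simps(3,4) mem_Collect_eq Un_iff
    by (elim disjE exE conjE; hypsubst; intro pair_diff_closed keys_single_subset; simp)
qed

lemma submodule_null: "submodule class_ring null (free_space pairs)"
  unfolding tensor_null_def by (rule FS.span_is_submodule[OF relations_closed])

lemma quotient_null: "quotient_module class_ring (free_space pairs) null"
  by (intro quotient_module.intro module_free_space quotient_module_axioms.intro submodule_null)

text \<open>
  The universal property of the tensor product, modulo a subspace \<open>V\<close>: if \<open>h\<close> is bilinear modulo \<open>V\<close>, its
  linear extension takes the null space of the tensor product into \<open>V\<close>.
\<close>

lemma lin_ext_null:
  assumes "vector_space sc" "module.subspace sc V"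
    and "\<And>x y a. x \<in> \<g> \<Longrightarrow> y \<in> \<g> \<Longrightarrow> a \<in> carrier A \<Longrightarrow> h (x + y) a - h x a - h y a \<in> V"
    and "\<And>x a b. x \<in> \<g> \<Longrightarrow> a \<in> carrier A \<Longrightarrow> b \<in> carrier A \<Longrightarrow> h x (a \<oplus>\<^bsub>A\<^esub> b) - h x a - h x b \<in> V"
    and "\<And>c x a. x \<in> \<g> \<Longrightarrow> a \<in> carrier A \<Longrightarrow> h (c \<cdot>\<^sub>m x) a - sc c (h x a) \<in> V"
    and "\<And>c x a. x \<in> \<g> \<Longrightarrow> a \<in> carrier A \<Longrightarrow> h x (c \<odot>\<^bsub>A\<^esub> a) - sc c (h x a) \<in> V"
    and "p \<in> null"
  shows "lin_ext sc (\<lambda>(z, a). h z a) p \<in> V"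
proof -
  interpret V: vector_space sc by fact
  let ?f = "lin_ext sc (\<lambda>(z, a). h z a)"
  note L = linear_simps[OF linear_lin_ext[OF assms(1)]] lin_ext_single[OF assms(1)]
  have "submodule class_ring {p \<in> carrier (free_space pairs). ?f p \<in> V} (free_space pairs)"
    using FS.M.add.m_closed FS.smult_closed FS.M.zero_closed
    by (intro submodule.intro module_free_space)
      (auto simp: free_space_simps L V.subspace_add[OF assms(2)] V.subspace_scale[OF assms(2)] V.subspace_0[OF assms(2)])
  moreover have "tensor_relations (sl n) A \<subseteq> {p \<in> carrier (free_space pairs). ?f p \<in> V}"
  proof
    fix r assume r: "r \<in> tensor_relations (sl n) A"
    then have "?f r \<in> V"
      unfolding tensor_relations_def sl_simps(3,4) mem_Collect_eq Un_iff
      by (elim disjE exE conjE; simp add: L assms(3-6))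
    with r show "r \<in> {p \<in> carrier (free_space pairs). ?f p \<in> V}" using relations_closed by auto
  qed
  ultimately have "null \<subseteq> {p \<in> carrier (free_space pairs). ?f p \<in> V}"
    unfolding tensor_null_def by (rule FS.span_is_subset[rotated])
  with assms(7) show ?thesis by auto
qed

lemma formal_bracket_eq: "formal_bracket (sl n) A p q =
  lin_ext pm_scale (\<lambda>(z, a). lin_ext pm_scale (\<lambda>(w, b). Poly_Mapping.single (z * w - w * z, a \<otimes>\<^bsub>A\<^esub> b) 1) q) p"
  unfolding formal_bracket_def lin_ext_def sl_simps
  by (intro sum.cong refl) (auto simp: pm.scale_sum_right intro!: sum.cong)

lemma linear_formal_bracket:
  "Vector_Spaces.linear pm_scale pm_scale (\<lambda>q. formal_bracket (sl n) A p q)"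
  "Vector_Spaces.linear pm_scale pm_scale (\<lambda>p. formal_bracket (sl n) A p q)"
proof -
  show "Vector_Spaces.linear pm_scale pm_scale (\<lambda>q. formal_bracket (sl n) A p q)"
    unfolding formal_bracket_eq lin_ext_def[of _ _ p] case_prod_beta
    by (rule linearI) (auto simp: pm.vector_space_axioms linear_simps[OF linear_lin_ext[OF pm.vector_space_axioms]]
        pm.scale_right_distrib sum.distrib pm.scale_sum_right mult.commute)
  show "Vector_Spaces.linear pm_scale pm_scale (\<lambda>p. formal_bracket (sl n) A p q)"
    unfolding formal_bracket_eq by (rule linear_lin_ext[OF pm.vector_space_axioms])
qed

lemma formal_bracket_closed:
  assumes "Poly_Mapping.keys p \<subseteq> pairs" "Poly_Mapping.keys q \<subseteq> pairs"
  shows "Poly_Mapping.keys (formal_bracket (sl n) A p q) \<subseteq> pairs"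
proof -
  have 1: "k \<in> pairs" if "k \<in> Poly_Mapping.keys p \<or> k \<in> Poly_Mapping.keys q" for k
    using that assms by auto
  show ?thesis
    unfolding formal_bracket_def case_prod_beta
    by (intro keys_sum_subset keys_single_subset SigmaI)
      (use 1 in \<open>auto simp: sl_simps(5) mem_Times_iff\<close>)
qed

lemma null_relations:
  "x \<in> \<g> \<Longrightarrow> y \<in> \<g> \<Longrightarrow> a \<in> carrier A \<Longrightarrow>
    Poly_Mapping.single (x + y, a) 1 - Poly_Mapping.single (x, a) 1 - Poly_Mapping.single (y, a) 1 \<in> null"
  "x \<in> \<g> \<Longrightarrow> a \<in> carrier A \<Longrightarrow> b \<in> carrier A \<Longrightarrow>
    Poly_Mapping.single (x, a \<oplus>\<^bsub>A\<^esub> b) 1 - Poly_Mapping.single (x, a) 1 - Poly_Mapping.single (x, b) 1 \<in> null"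
  "x \<in> \<g> \<Longrightarrow> a \<in> carrier A \<Longrightarrow> Poly_Mapping.single (c \<cdot>\<^sub>m x, a) 1 - Poly_Mapping.single (x, a) c \<in> null"
  "x \<in> \<g> \<Longrightarrow> a \<in> carrier A \<Longrightarrow> Poly_Mapping.single (x, c \<odot>\<^bsub>A\<^esub> a) 1 - Poly_Mapping.single (x, a) c \<in> null"
  unfolding tensor_null_def
  by (rule subsetD[OF FS.in_own_span[OF relations_closed]];
      unfold tensor_relations_def sl_simps(3,4); blast)+

lemma subspace_null: "pm.subspace null"
  using submoduleD[OF submodule_null] by (intro pm.subspaceI) (auto simp: free_space_simps)

lemma A_mult_bilinear:
  assumes "a \<in> carrier A" "b \<in> carrier A" "c \<in> carrier A"
  shows "(a \<oplus>\<^bsub>A\<^esub> b) \<otimes>\<^bsub>A\<^esub> c = a \<otimes>\<^bsub>A\<^esub> c \<oplus>\<^bsub>A\<^esub> b \<otimes>\<^bsub>A\<^esub> c"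
    "c \<otimes>\<^bsub>A\<^esub> (a \<oplus>\<^bsub>A\<^esub> b) = c \<otimes>\<^bsub>A\<^esub> a \<oplus>\<^bsub>A\<^esub> c \<otimes>\<^bsub>A\<^esub> b"
    "(k \<odot>\<^bsub>A\<^esub> a) \<otimes>\<^bsub>A\<^esub> c = k \<odot>\<^bsub>A\<^esub> (a \<otimes>\<^bsub>A\<^esub> c)"
    "c \<otimes>\<^bsub>A\<^esub> (k \<odot>\<^bsub>A\<^esub> a) = k \<odot>\<^bsub>A\<^esub> (c \<otimes>\<^bsub>A\<^esub> a)"
  using assms A.smult_assoc2[of k a c] by (simp_all add: A.l_distr A.r_distr A.m_comm)

lemma formal_bracket_null_left:
  assumes "p \<in> null" "Poly_Mapping.keys q \<subseteq> pairs"
  shows "formal_bracket (sl n) A p q \<in> null"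
proof -
  let ?h = "\<lambda>q z a. lin_ext pm_scale (\<lambda>(w, b). Poly_Mapping.single (z * w - w * z, a \<otimes>\<^bsub>A\<^esub> b) 1) q"
  have 1: "formal_bracket (sl n) A p (Poly_Mapping.single k 1) \<in> null" if "k \<in> pairs" for k
  proof -
    obtain w b where k: "k = (w, b)" "w \<in> \<g>" "b \<in> carrier A" using \<open>k \<in> pairs\<close> by auto
    have "?h (Poly_Mapping.single k 1) z a = Poly_Mapping.single (z * w - w * z, a \<otimes>\<^bsub>A\<^esub> b) 1" for z a
      by (simp add: k lin_ext_single[OF pm.vector_space_axioms])
    then show ?thesis
      unfolding formal_bracket_eq
      by (intro lin_ext_null[OF pm.vector_space_axioms subspace_null _ _ _ _ assms(1)])
        (use k in \<open>simp_all add: sl_bracket_bilinear[OF g_carrier g_carrier g_carrier] A_mult_bilinear null_relations\<close>)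
  qed
  have L: "Vector_Spaces.linear pm_scale pm_scale (\<lambda>q. formal_bracket (sl n) A p q)"
    by (rule linear_formal_bracket)
  show ?thesis
    by (rule pm_induct[of "\<lambda>q. formal_bracket (sl n) A p q \<in> null" q])
      (use assms(2) 1 in \<open>auto simp: linear_simps[OF L] intro: pm.subspace_0 pm.subspace_add pm.subspace_scale subspace_null\<close>)
qed

lemma formal_bracket_null_right:
  assumes "q \<in> null" "Poly_Mapping.keys p \<subseteq> pairs"
  shows "formal_bracket (sl n) A p q \<in> null"
proof -
  have 1: "formal_bracket (sl n) A (Poly_Mapping.single k 1) q \<in> null" if k': "k \<in> pairs" for k
  proof -
    obtain z a where k: "k = (z, a)" "z \<in> \<g>" "a \<in> carrier A" using k' by auto
    have "formal_bracket (sl n) A (Poly_Mapping.single k 1) q =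
        lin_ext pm_scale (\<lambda>(w, b). Poly_Mapping.single (z * w - w * z, a \<otimes>\<^bsub>A\<^esub> b) 1) q"
      unfolding formal_bracket_eq by (simp add: k lin_ext_single[OF pm.vector_space_axioms])
    also have "\<dots> \<in> null"
      by (intro lin_ext_null[OF pm.vector_space_axioms subspace_null _ _ _ _ assms(1)])
        (use k in \<open>simp_all add: sl_bracket_bilinear[OF g_carrier g_carrier g_carrier] A_mult_bilinear null_relations\<close>)
    finally show ?thesis .
  qed
  have L: "Vector_Spaces.linear pm_scale pm_scale (\<lambda>p. formal_bracket (sl n) A p q)"
    unfolding formal_bracket_eq by (rule linear_lin_ext[OF pm.vector_space_axioms])
  show ?thesis
    by (rule pm_induct[of "\<lambda>p. formal_bracket (sl n) A p q \<in> null" p])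
      (use assms(2) 1 in \<open>auto simp: linear_simps[OF L] intro: pm.subspace_0 pm.subspace_add pm.subspace_scale subspace_null\<close>)
qed

lemma formal_bracket_diff:
  "formal_bracket (sl n) A p q - formal_bracket (sl n) A p' q' =
    formal_bracket (sl n) A (p - p') q + formal_bracket (sl n) A p' (q - q')"
proof -
  have 1: "Vector_Spaces.linear pm_scale pm_scale (\<lambda>p. formal_bracket (sl n) A p q)" for q
    unfolding formal_bracket_eq by (rule linear_lin_ext[OF pm.vector_space_axioms])
  have 2: "Vector_Spaces.linear pm_scale pm_scale (\<lambda>q. formal_bracket (sl n) A p q)" for p
    by (rule linear_formal_bracket)
  show ?thesis by (simp add: linear_simps(4)[OF 1] linear_simps(4)[OF 2])
qed

abbreviation coset :: "(complex mat \<times> 'a \<Rightarrow>\<^sub>0 complex) \<Rightarrow> (complex mat \<times> 'a \<Rightarrow>\<^sub>0 complex) set"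
  where "coset p \<equiv> null +>\<^bsub>free_space pairs\<^esub> p"

abbreviation "LA \<equiv> sl_map n A"

lemma mem_coset:
  "Poly_Mapping.keys p \<subseteq> pairs \<Longrightarrow> q \<in> coset p \<longleftrightarrow> Poly_Mapping.keys q \<subseteq> pairs \<and> q - p \<in> null"
  using quotient_module.mem_cls[OF quotient_null, of p q] free_space_minus[of q pairs p]
  by (auto simp: free_space_simps)

lemma coset_eqI:
  assumes "Poly_Mapping.keys p \<subseteq> pairs" "Poly_Mapping.keys q \<subseteq> pairs" "p - q \<in> null"
  shows "coset p = coset q"
  using quotient_module.cls_eq_iff[OF quotient_null, of p q] free_space_minus[of p pairs q] assms
  by (simp add: free_space_simps)

lemma LA_carrier: "carrier LA = coset ` {p. Poly_Mapping.keys p \<subseteq> pairs}"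
  using quotient_module.carrier_Q[OF quotient_null]
  by (simp add: map_algebra_def tensor_space_def free_space_simps)

lemma LA_coset [simp, intro]: "Poly_Mapping.keys p \<subseteq> pairs \<Longrightarrow> coset p \<in> carrier LA"
  by (simp add: LA_carrier)

lemma LA_cases:
  assumes "\<tau> \<in> carrier LA"
  obtains p where "Poly_Mapping.keys p \<subseteq> pairs" "\<tau> = coset p"
  using assms by (auto simp: LA_carrier)

lemma LA_add:
  "Poly_Mapping.keys p \<subseteq> pairs \<Longrightarrow> Poly_Mapping.keys q \<subseteq> pairs \<Longrightarrow> coset p \<oplus>\<^bsub>LA\<^esub> coset q = coset (p + q)"
  using quotient_module.Q_add[OF quotient_null, of p q]
  by (simp add: map_algebra_def tensor_space_def free_space_simps)

lemma LA_smult: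
  "Poly_Mapping.keys p \<subseteq> pairs \<Longrightarrow> c \<odot>\<^bsub>LA\<^esub> coset p = coset (pm_scale c p)"
  using quotient_module.Q_smult[OF quotient_null, of c p]
  by (simp add: map_algebra_def tensor_space_def free_space_simps)

lemma LA_bracket:
  assumes "Poly_Mapping.keys p \<subseteq> pairs" "Poly_Mapping.keys q \<subseteq> pairs"
  shows "bracket LA (coset p) (coset q) = coset (formal_bracket (sl n) A p q)"
proof -
  have "coset (formal_bracket (sl n) A p' q') = coset (formal_bracket (sl n) A p q)"
    if "p' \<in> coset p" "q' \<in> coset q" for p' q'
  proof (rule coset_eqI)
    have *: "Poly_Mapping.keys p' \<subseteq> pairs" "p' - p \<in> null" "Poly_Mapping.keys q' \<subseteq> pairs" "q' - q \<in> null"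
      using that assms by (simp_all add: mem_coset)
    show "Poly_Mapping.keys (formal_bracket (sl n) A p' q') \<subseteq> pairs"
      "Poly_Mapping.keys (formal_bracket (sl n) A p q) \<subseteq> pairs"
      by (intro formal_bracket_closed *(1,3) assms)+
    show "formal_bracket (sl n) A p' q' - formal_bracket (sl n) A p q \<in> null"
      unfolding formal_bracket_diff
      using formal_bracket_null_left[OF *(2,3)] formal_bracket_null_right[OF *(4) assms(1)]
      by (rule pm.subspace_add[OF subspace_null])
  qed
  then have "(\<Union>p'\<in>coset p. \<Union>q'\<in>coset q. coset (formal_bracket (sl n) A p' q')) =
      (\<Union>p'\<in>coset p. \<Union>q'\<in>coset q. coset (formal_bracket (sl n) A p q))"
    by (intro SUP_cong refl)
  moreover have "p \<in> coset p" "q \<in> coset q"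
    using assms pm.subspace_0[OF subspace_null] by (simp_all add: mem_coset)
  then have "coset p \<noteq> {}" "coset q \<noteq> {}" by blast+
  ultimately show ?thesis by (simp add: map_algebra_def)
qed

definition pure :: "complex mat \<Rightarrow> 'a \<Rightarrow> (complex mat \<times> 'a \<Rightarrow>\<^sub>0 complex) set"
  where "pure z a = coset (Poly_Mapping.single (z, a) 1)"

lemma pure_tensor_eq: "pure_tensor (sl n) A z a = pure z a"
  by (simp add: pure_tensor_def pure_def)

lemma pure_closed [simp, intro]: "z \<in> \<g> \<Longrightarrow> a \<in> carrier A \<Longrightarrow> pure z a \<in> carrier LA"
  unfolding pure_def by (intro LA_coset) simp

lemma pure_bilinear:
  "x \<in> \<g> \<Longrightarrow> y \<in> \<g> \<Longrightarrow> a \<in> carrier A \<Longrightarrow> pure (x + y) a = pure x a \<oplus>\<^bsub>LA\<^esub> pure y a"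
  "x \<in> \<g> \<Longrightarrow> a \<in> carrier A \<Longrightarrow> b \<in> carrier A \<Longrightarrow> pure x (a \<oplus>\<^bsub>A\<^esub> b) = pure x a \<oplus>\<^bsub>LA\<^esub> pure x b"
  "x \<in> \<g> \<Longrightarrow> a \<in> carrier A \<Longrightarrow> pure (c \<cdot>\<^sub>m x) a = c \<odot>\<^bsub>LA\<^esub> pure x a"
  "x \<in> \<g> \<Longrightarrow> a \<in> carrier A \<Longrightarrow> pure x (c \<odot>\<^bsub>A\<^esub> a) = c \<odot>\<^bsub>LA\<^esub> pure x a"
proof -
  have two: "Poly_Mapping.keys (Poly_Mapping.single k 1 + Poly_Mapping.single l 1 :: _ \<Rightarrow>\<^sub>0 complex) \<subseteq> pairs"
    if "k \<in> pairs" "l \<in> pairs" for k l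
    using that by (intro order_trans[OF Poly_Mapping.keys_add]) simp
  have one: "Poly_Mapping.keys (Poly_Mapping.single k c) \<subseteq> pairs" if "k \<in> pairs" for k and c :: complex
    using that by simp
  note [simp] = diff_diff_eq[symmetric]
  show "x \<in> \<g> \<Longrightarrow> y \<in> \<g> \<Longrightarrow> a \<in> carrier A \<Longrightarrow> pure (x + y) a = pure x a \<oplus>\<^bsub>LA\<^esub> pure y a"
    unfolding pure_def by (subst LA_add) (intro one two coset_eqI; simp add: null_relations)+
  show "x \<in> \<g> \<Longrightarrow> a \<in> carrier A \<Longrightarrow> b \<in> carrier A \<Longrightarrow> pure x (a \<oplus>\<^bsub>A\<^esub> b) = pure x a \<oplus>\<^bsub>LA\<^esub> pure x b"
    unfolding pure_def by (subst LA_add) (intro one two coset_eqI; simp add: null_relations)+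
  show "x \<in> \<g> \<Longrightarrow> a \<in> carrier A \<Longrightarrow> pure (c \<cdot>\<^sub>m x) a = c \<odot>\<^bsub>LA\<^esub> pure x a"
    unfolding pure_def by (subst LA_smult, simp, rule coset_eqI; simp add: null_relations)
  show "x \<in> \<g> \<Longrightarrow> a \<in> carrier A \<Longrightarrow> pure x (c \<odot>\<^bsub>A\<^esub> a) = c \<odot>\<^bsub>LA\<^esub> pure x a"
    unfolding pure_def by (subst LA_smult, simp, rule coset_eqI; simp add: null_relations)
qed

lemma pure_bracket:
  assumes "x \<in> \<g>" "y \<in> \<g>" "a \<in> carrier A" "b \<in> carrier A"
  shows "bracket LA (pure x a) (pure y b) = pure (x * y - y * x) (a \<otimes>\<^bsub>A\<^esub> b)"
  unfolding pure_def using assms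
  by (subst LA_bracket) (simp_all add: formal_bracket_eq lin_ext_single[OF pm.vector_space_axioms])

section \<open>The enveloping algebra\<close>

lemma LA_closed:
  assumes "x \<in> carrier LA" "y \<in> carrier LA"
  shows "x \<oplus>\<^bsub>LA\<^esub> y \<in> carrier LA" "c \<odot>\<^bsub>LA\<^esub> x \<in> carrier LA" "bracket LA x y \<in> carrier LA"
proof -
  obtain p q where *: "Poly_Mapping.keys p \<subseteq> pairs" "x = coset p" "Poly_Mapping.keys q \<subseteq> pairs" "y = coset q"
    using assms by (metis LA_cases)
  have "Poly_Mapping.keys (p + q) \<subseteq> pairs"
    using * Poly_Mapping.keys_add[of p q] by blast
  then show "x \<oplus>\<^bsub>LA\<^esub> y \<in> carrier LA" by (simp only: *(2,4) LA_add[OF *(1,3)] LA_coset)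
  have "Poly_Mapping.keys (pm_scale c p) \<subseteq> pairs"
    using * keys_pm_scale[of c p] by blast
  then show "c \<odot>\<^bsub>LA\<^esub> x \<in> carrier LA" by (simp only: *(2) LA_smult[OF *(1)] LA_coset)
  show "bracket LA x y \<in> carrier LA"
    by (simp only: *(2,4) LA_bracket[OF *(1,3)] LA_coset formal_bracket_closed[OF *(1,3)])
qed

abbreviation "FX \<equiv> words_in (carrier LA)"
abbreviation "UI \<equiv> enveloping_ideal LA"
abbreviation ucls :: "_ \<Rightarrow> 'a U_elem"
  where "ucls p \<equiv> UI +>\<^bsub>free_algebra (carrier LA)\<^esub> p"

lemma enveloping_relations_closed: "enveloping_relations LA \<subseteq> FX"
  unfolding enveloping_relations_def by (auto intro!: words_in_diff words_in_mult words_in_gen words_in_scale LA_closed)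

lemma ideal_UI: "ideal UI (free_algebra (carrier LA))"
  unfolding enveloping_ideal_def
  by (rule ring.genideal_ideal[OF ring_free_algebra]) (simp add: free_algebra_simps enveloping_relations_closed)

lemma relation_in_UI: "r \<in> enveloping_relations LA \<Longrightarrow> r \<in> UI"
  unfolding enveloping_ideal_def
  using ring.genideal_self[OF ring_free_algebra, of "enveloping_relations LA" "carrier LA"] enveloping_relations_closed
  by (auto simp: free_algebra_simps)

lemma UI_subset: "UI \<subseteq> FX"
  using additive_subgroup.a_subset[OF ideal.axioms(1)[OF ideal_UI]] by (simp add: free_algebra_simps)

lemma UI_add: "p \<in> UI \<Longrightarrow> q \<in> UI \<Longrightarrow> p + q \<in> UI"
  using additive_subgroup.a_closed[OF ideal.axioms(1)[OF ideal_UI]] by (simp add: free_algebra_simps)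

lemma UI_zero: "0 \<in> UI"
  using additive_subgroup.zero_closed[OF ideal.axioms(1)[OF ideal_UI]] by (simp add: free_algebra_simps)

lemma UI_mult_left: "p \<in> UI \<Longrightarrow> q \<in> FX \<Longrightarrow> q * p \<in> UI"
  using ideal.I_l_closed[OF ideal_UI] by (simp add: free_algebra_simps)

lemma UI_mult_right: "p \<in> UI \<Longrightarrow> q \<in> FX \<Longrightarrow> p * q \<in> UI"
  using ideal.I_r_closed[OF ideal_UI] by (simp add: free_algebra_simps)

lemma UI_scale: "p \<in> UI \<Longrightarrow> pm_scale c p \<in> UI"
  using UI_mult_left[of p "pm_scale c 1"] by (simp add: pm_scale_mult_left words_in_scale)

lemma quotient_UI: "quotient_module class_ring (free_algebra (carrier LA)) UI"
  by (intro quotient_module.intro module_free_algebra quotient_module_axioms.intro submodule.intro)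
    (use UI_subset in \<open>auto simp: free_algebra_simps UI_add UI_zero UI_scale\<close>)

abbreviation "U \<equiv> U_sl n A"

lemma U_eq: "U = quotient_mod (free_algebra (carrier LA)) UI"
  by (simp add: enveloping_algebra_def)

lemma module_U: "module class_ring U"
  using quotient_module.module_Q[OF quotient_UI] by (simp add: U_eq)

lemma U_simps:
  "carrier U = ucls ` FX"
  "p \<in> FX \<Longrightarrow> q \<in> FX \<Longrightarrow> ucls p \<oplus>\<^bsub>U\<^esub> ucls q = ucls (p + q)"
  "p \<in> FX \<Longrightarrow> c \<odot>\<^bsub>U\<^esub> ucls p = ucls (pm_scale c p)"
  "\<zero>\<^bsub>U\<^esub> = ucls 0" "\<one>\<^bsub>U\<^esub> = ucls 1"
  "p \<in> FX \<Longrightarrow> q \<in> FX \<Longrightarrow> ucls p \<otimes>\<^bsub>U\<^esub> ucls q = ucls (p * q)"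
  "p \<in> FX \<Longrightarrow> q \<in> FX \<Longrightarrow> ucls p \<ominus>\<^bsub>U\<^esub> ucls q = ucls (p - q)"
proof -
  note q = quotient_UI[THEN quotient_module.carrier_Q] quotient_UI[THEN quotient_module.Q_add]
    quotient_UI[THEN quotient_module.Q_smult] quotient_UI[THEN quotient_module.Q_zero]
    quotient_UI[THEN quotient_module.cls_minus]
  note q' = q[folded U_eq, unfolded free_algebra_simps]
  show "carrier U = ucls ` FX" by (rule q')
  show add: "ucls p \<oplus>\<^bsub>U\<^esub> ucls q = ucls (p + q)" if "p \<in> FX" "q \<in> FX" for p q using q'(2) that by simp
  show "c \<odot>\<^bsub>U\<^esub> ucls p = ucls (pm_scale c p)" if "p \<in> FX" for c p using q'(3) that by simp
  show "\<zero>\<^bsub>U\<^esub> = ucls 0" by (rule q')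
  show "\<one>\<^bsub>U\<^esub> = ucls 1" by (simp add: U_eq quotient_mod_def free_algebra_simps)
  show "ucls p \<otimes>\<^bsub>U\<^esub> ucls q = ucls (p * q)" if "p \<in> FX" "q \<in> FX"
    using ideal.rcoset_mult_add[OF ideal_UI, of p q] that
    by (simp add: U_eq quotient_mod_def free_algebra_simps)
  show "ucls p \<ominus>\<^bsub>U\<^esub> ucls q = ucls (p - q)" if "p \<in> FX" "q \<in> FX"
    unfolding a_minus_def using q'(5)[of q] that
    by (simp add: free_algebra_minus(2)[of q] add words_in_uminus)
qed

lemma U_cases:
  assumes "Y \<in> carrier U"
  obtains p where "p \<in> FX" "Y = ucls p"
  using assms by (auto simp: U_simps)

lemma mem_ucls: "p \<in> FX \<Longrightarrow> q \<in> ucls p \<longleftrightarrow> q \<in> FX \<and> q - p \<in> UI"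
  using quotient_module.mem_cls[OF quotient_UI, of p q] free_algebra_minus(1)[of q "carrier LA" p]
  by (auto simp: free_algebra_simps)

lemma ucls_eqI: "p \<in> FX \<Longrightarrow> q \<in> FX \<Longrightarrow> p - q \<in> UI \<Longrightarrow> ucls p = ucls q"
  using quotient_module.cls_eq_iff[OF quotient_UI, of p q] free_algebra_minus(1)[of p "carrier LA" q]
  by (simp add: free_algebra_simps)

lemma U_pow: "p \<in> FX \<Longrightarrow> ucls p [^]\<^bsub>U\<^esub> (k :: nat) = ucls (p ^ k) \<and> p ^ k \<in> FX"
proof (induction k)
  case 0
  then show ?case by (simp add: nat_pow_def U_simps)
next
  case (Suc k)
  have "ucls p [^]\<^bsub>U\<^esub> Suc k = ucls p [^]\<^bsub>U\<^esub> k \<otimes>\<^bsub>U\<^esub> ucls p"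
    by (simp add: nat_pow_def)
  then show ?case using Suc by (auto simp: U_simps power_commutes)
qed

definition gen :: "complex mat \<Rightarrow> 'a \<Rightarrow> (complex mat \<times> 'a \<Rightarrow>\<^sub>0 complex) set free_word \<Rightarrow>\<^sub>0 complex"
  where "gen z a = free_gen (pure z a)"

lemma gen_closed [simp, intro]: "z \<in> \<g> \<Longrightarrow> a \<in> carrier A \<Longrightarrow> gen z a \<in> FX"
  unfolding gen_def by (intro words_in_gen pure_closed)

lemma U_tensor_eq: "U_tensor n A z a = ucls (gen z a)"
  by (simp add: U_tensor_def enveloping_map_def gen_def pure_tensor_eq)

lemma gen_relations:
  "x \<in> \<g> \<Longrightarrow> y \<in> \<g> \<Longrightarrow> a \<in> carrier A \<Longrightarrow> gen (x + y) a - gen x a - gen y a \<in> UI"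
  "x \<in> \<g> \<Longrightarrow> a \<in> carrier A \<Longrightarrow> b \<in> carrier A \<Longrightarrow> gen x (a \<oplus>\<^bsub>A\<^esub> b) - gen x a - gen x b \<in> UI"
  "x \<in> \<g> \<Longrightarrow> a \<in> carrier A \<Longrightarrow> gen (c \<cdot>\<^sub>m x) a - pm_scale c (gen x a) \<in> UI"
  "x \<in> \<g> \<Longrightarrow> a \<in> carrier A \<Longrightarrow> gen x (c \<odot>\<^bsub>A\<^esub> a) - pm_scale c (gen x a) \<in> UI"
  "x \<in> \<g> \<Longrightarrow> y \<in> \<g> \<Longrightarrow> a \<in> carrier A \<Longrightarrow> b \<in> carrier A \<Longrightarrow>
    gen x a * gen y b - gen y b * gen x a - gen (x * y - y * x) (a \<otimes>\<^bsub>A\<^esub> b) \<in> UI"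
  unfolding gen_def pure_bilinear pure_bracket[symmetric]
  by (rule relation_in_UI; unfold enveloping_relations_def; blast intro: pure_closed)+

end



section \<open>The Weyl relations and their universal property\<close>

context current_algebra
begin

lemma e_mat_g: "i \<noteq> j \<Longrightarrow> e_mat n i j \<in> \<g>"
  by (auto simp: sl_simps e_mat_def intro!: sum.neutral)

lemma h_mat_index: "k < n \<Longrightarrow> l < n \<Longrightarrow>
    h_mat n i $$ (k, l) = (if Suc k = i \<and> Suc l = i then 1 else 0) - (if k = i \<and> l = i then 1 else 0)"
  by (simp add: h_mat_def e_mat_def)

lemma h_mat_g: "i \<in> {1..n - 1} \<Longrightarrow> h_mat n i \<in> \<g>"
proof -
  assume i: "i \<in> {1..n - 1}"
  have "(\<Sum>k<n. h_mat n i $$ (k, k)) = (\<Sum>k<n. (if k = i - 1 then 1 else 0) - (if k = i then 1 else 0))"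
    using i by (intro sum.cong) (auto simp: h_mat_index)
  also have "\<dots> = 0" using i by (auto simp: sum_subtractf)
  finally have "(\<Sum>k<n. h_mat n i $$ (k, k)) = 0" .
  moreover have "h_mat n i \<in> carrier_mat n n"
    unfolding h_mat_def by (rule minus_carrier_mat) (simp add: e_mat_def)
  ultimately show ?thesis by (simp add: sl_simps)
qed

lemma x_minus_g: "x_minus n i \<in> \<g>"
  unfolding x_minus_def by (rule e_mat_g) simp

lemma n_plus_g: "n_plus n \<subseteq> \<g>"
  unfolding n_plus_def by (rule SL.span_is_subset2) (auto intro: e_mat_g)

lemma cartan_g: "cartan n \<subseteq> \<g>"
  unfolding cartan_def by (rule SL.span_is_subset2) (auto intro: h_mat_g)

lemma e_mat_n_plus: "1 \<le> i \<Longrightarrow> i < j \<Longrightarrow> j \<le> n \<Longrightarrow> e_mat n i j \<in> n_plus n"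
  unfolding n_plus_def by (rule subsetD[OF SL.in_own_span]) (auto intro: e_mat_g)

lemma h_mat_cartan: "i \<in> {1..n - 1} \<Longrightarrow> h_mat n i \<in> cartan n"
  unfolding cartan_def by (rule subsetD[OF SL.in_own_span]) (auto intro: h_mat_g)

abbreviation lam :: "nat \<Rightarrow> complex mat \<Rightarrow> complex"
  where "lam m \<equiv> (\<lambda>h. of_nat m * fundamental_weight 1 h)"

lemma lam_h_mat: "i \<in> {1..n - 1} \<Longrightarrow> lam m (h_mat n i) = (if i = 1 then of_nat m else 0)"
  using fundamental_weight_h_mat[of 1 n i] n2 by auto

abbreviation "wideal m \<equiv> weyl_ideal n A (lam m)"

lemma weyl_relations_eq: "weyl_relations n A (lam m) =
    {ucls (gen x a) | x a. x \<in> n_plus n \<and> a \<in> carrier A}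
  \<union> {ucls (gen h \<one>\<^bsub>A\<^esub> - pm_scale (lam m h) 1) | h. h \<in> cartan n}
  \<union> {ucls (gen (x_minus n i) \<one>\<^bsub>A\<^esub> ^ (k + 1)) | i k. i \<in> {1..n - 1} \<and> lam m (h_mat n i) = of_nat k}"
proof -
  have 1: "U_tensor n A h \<one>\<^bsub>A\<^esub> \<ominus>\<^bsub>U\<^esub> (lam m h \<odot>\<^bsub>U\<^esub> \<one>\<^bsub>U\<^esub>) = ucls (gen h \<one>\<^bsub>A\<^esub> - pm_scale (lam m h) 1)"
    if "h \<in> cartan n" for h
  proof -
    have h: "gen h \<one>\<^bsub>A\<^esub> \<in> FX" using that cartan_g by auto
    have "lam m h \<odot>\<^bsub>U\<^esub> \<one>\<^bsub>U\<^esub> = ucls (pm_scale (lam m h) 1)"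
      by (simp only: U_simps(5) U_simps(3)[OF words_in_one])
    then show ?thesis
      by (simp only: U_tensor_eq U_simps(7)[OF h words_in_scale[OF words_in_one]])
  qed
  have 2: "U_tensor n A (x_minus n i) \<one>\<^bsub>A\<^esub> [^]\<^bsub>U\<^esub> (k + 1) = ucls (gen (x_minus n i) \<one>\<^bsub>A\<^esub> ^ (k + 1))" for i k
    using U_pow[of "gen (x_minus n i) \<one>\<^bsub>A\<^esub>" "k + 1"] x_minus_g by (simp add: U_tensor_eq)
  have "{U_tensor n A h \<one>\<^bsub>A\<^esub> \<ominus>\<^bsub>U\<^esub> (lam m h \<odot>\<^bsub>U\<^esub> \<one>\<^bsub>U\<^esub>) | h. h \<in> cartan n} =
      {ucls (gen h \<one>\<^bsub>A\<^esub> - pm_scale (lam m h) 1) | h. h \<in> cartan n}"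
    by (rule Collect_cong) (metis 1)
  then show ?thesis unfolding weyl_relations_def 2 by (simp only: U_tensor_eq)
qed

text \<open>
  The Weyl module is the quotient of the free algebra by this left ideal, which contains the relations
  of the enveloping algebra. Working there avoids nested quotients.
\<close>

definition L :: "nat \<Rightarrow> _"
  where "L m = {p \<in> FX. ucls p \<in> wideal m}"

lemma wideal_iff: "Y \<in> wideal m \<longleftrightarrow> (\<forall>J. left_ideal J U \<and> weyl_relations n A (lam m) \<subseteq> J \<longrightarrow> Y \<in> J)"
  by (auto simp: weyl_ideal_def gen_left_ideal_def)

lemma L_add: "p \<in> L m \<Longrightarrow> q \<in> L m \<Longrightarrow> p + q \<in> L m"
  unfolding L_def wideal_iff
  by (auto simp: left_ideal_def U_simps(2)[symmetric] intro: additive_subgroup.a_closed)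

lemma L_mult: "p \<in> L m \<Longrightarrow> q \<in> FX \<Longrightarrow> q * p \<in> L m"
  unfolding L_def wideal_iff
  by (auto simp: left_ideal_def U_simps(6)[symmetric] U_simps(1))

lemma UI_L: "p \<in> UI \<Longrightarrow> p \<in> L m"
proof -
  assume p: "p \<in> UI"
  then have "ucls p = \<zero>\<^bsub>U\<^esub>"
    unfolding U_simps(4) using UI_subset by (intro ucls_eqI) auto
  then show ?thesis
    using p UI_subset unfolding L_def wideal_iff
    by (auto simp: left_ideal_def additive_subgroup.zero_closed)
qed

lemma L_scale: "p \<in> L m \<Longrightarrow> pm_scale c p \<in> L m"
  using L_mult[of p m "pm_scale c 1"] by (simp add: pm_scale_mult_left words_in_scale)

lemma subspace_L: "pm.subspace (L m)"
  by (intro pm.subspaceI UI_L[OF UI_zero] L_add L_scale)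

lemma L_subset: "L m \<subseteq> FX"
  by (auto simp: L_def)

lemma L_relations:
  "x \<in> n_plus n \<Longrightarrow> a \<in> carrier A \<Longrightarrow> gen x a \<in> L m"
  "h \<in> cartan n \<Longrightarrow> gen h \<one>\<^bsub>A\<^esub> - pm_scale (lam m h) 1 \<in> L m"
  "i \<in> {1..n - 1} \<Longrightarrow> lam m (h_mat n i) = of_nat k \<Longrightarrow> gen (x_minus n i) \<one>\<^bsub>A\<^esub> ^ (k + 1) \<in> L m"
proof -
  have sub: "ucls p \<in> weyl_relations n A (lam m) \<Longrightarrow> p \<in> FX \<Longrightarrow> p \<in> L m" for p
    unfolding L_def wideal_iff by auto
  show "x \<in> n_plus n \<Longrightarrow> a \<in> carrier A \<Longrightarrow> gen x a \<in> L m"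
    using n_plus_g by (intro sub) (unfold weyl_relations_eq, blast, auto)
  show "h \<in> cartan n \<Longrightarrow> gen h \<one>\<^bsub>A\<^esub> - pm_scale (lam m h) 1 \<in> L m"
    using cartan_g by (intro sub) (unfold weyl_relations_eq, blast, auto intro!: words_in_diff words_in_scale)
  show "i \<in> {1..n - 1} \<Longrightarrow> lam m (h_mat n i) = of_nat k \<Longrightarrow> gen (x_minus n i) \<one>\<^bsub>A\<^esub> ^ (k + 1) \<in> L m"
    using U_pow[of "gen (x_minus n i) \<one>\<^bsub>A\<^esub>" "k + 1"] x_minus_g
    by (intro sub) (unfold weyl_relations_eq, blast, auto)
qed

lemma weyl_relations_closed: "weyl_relations n A (lam m) \<subseteq> carrier U"
  unfolding weyl_relations_eq U_simps(1)
  using n_plus_g cartan_g x_minus_g U_pow[of "gen (x_minus n _) \<one>\<^bsub>A\<^esub>"]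
  by (auto intro!: imageI words_in_diff words_in_scale)

lemma wideal_subset: "wideal m \<subseteq> carrier U"
proof -
  interpret U: Module.module "class_ring :: complex ring" U by (rule module_U)
  have "submodule class_ring (carrier U) U"
    by (intro submodule.intro module_U) auto
  then have "abelian_subgroup (carrier U) U" by (rule U.submodule_abelian_subgroup)
  then have "left_ideal (carrier U) U"
    by (auto simp: left_ideal_def U_simps(1) U_simps(6) intro: abelian_subgroup.axioms(1))
  then show ?thesis using weyl_relations_closed wideal_iff by blast
qed

lemma submodule_wideal: "submodule class_ring (wideal m) U"
proof (intro submodule.intro module_U wideal_subset)
  have elim: "\<exists>p\<in>L m. Y = ucls p" if Y: "Y \<in> wideal m" for Y
  proof -
    obtain p where "p \<in> FX" "Y = ucls p" using Y wideal_subset[of m] U_cases by blast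
    then show ?thesis using Y by (intro bexI[of _ p]) (simp_all add: L_def)
  qed
  have intr: "ucls p \<in> wideal m" if "p \<in> L m" for p using that by (simp add: L_def)
  show "X \<oplus>\<^bsub>U\<^esub> Y \<in> wideal m" if XY: "X \<in> wideal m" "Y \<in> wideal m" for X Y
  proof -
    obtain p q where "p \<in> L m" "q \<in> L m" "X = ucls p" "Y = ucls q"
      using elim XY by meson
    then show ?thesis using intr[OF L_add[of p m q]] L_subset[of m] U_simps(2)[of p q] by (simp add: subset_iff)
  qed
  show "\<zero>\<^bsub>U\<^esub> \<in> wideal m"
    using intr[OF UI_L[OF UI_zero]] by (simp add: U_simps(4))
  show "c \<odot>\<^bsub>U\<^esub> Y \<in> wideal m" if Y: "Y \<in> wideal m" for c Y
  proof -
    obtain p where "p \<in> L m" "Y = ucls p" using elim Y by meson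
    then show ?thesis using intr[OF L_scale[of p m c]] L_subset[of m] U_simps(3)[of p c] by (simp add: subset_iff)
  qed
qed

end

text \<open>
  A representation of \<open>sl\<^sub>n \<otimes> A\<close> on a whole type. Only the action of pure tensors is given; being bilinear,
  it extends to the tensor product.
\<close>

locale current_rep = current_algebra A B n + vector_space sc
  for A :: "(complex, 'a) module" and B and n
    and sc :: "complex \<Rightarrow> 'v::ab_group_add \<Rightarrow> 'v" +
  fixes T :: "complex mat \<Rightarrow> 'a \<Rightarrow> 'v \<Rightarrow> 'v"
  assumes T_linear: "z \<in> \<g> \<Longrightarrow> a \<in> carrier A \<Longrightarrow> Vector_Spaces.linear sc sc (T z a)"
    and T_add_left: "x \<in> \<g> \<Longrightarrow> y \<in> \<g> \<Longrightarrow> a \<in> carrier A \<Longrightarrow> T (x + y) a v = T x a v + T y a v"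
    and T_add_right: "x \<in> \<g> \<Longrightarrow> a \<in> carrier A \<Longrightarrow> b \<in> carrier A \<Longrightarrow> T x (a \<oplus>\<^bsub>A\<^esub> b) v = T x a v + T x b v"
    and T_smult_left: "x \<in> \<g> \<Longrightarrow> a \<in> carrier A \<Longrightarrow> T (c \<cdot>\<^sub>m x) a v = sc c (T x a v)"
    and T_smult_right: "x \<in> \<g> \<Longrightarrow> a \<in> carrier A \<Longrightarrow> T x (c \<odot>\<^bsub>A\<^esub> a) v = sc c (T x a v)"
    and T_commutator: "x \<in> \<g> \<Longrightarrow> y \<in> \<g> \<Longrightarrow> a \<in> carrier A \<Longrightarrow> b \<in> carrier A \<Longrightarrow>
      T x a (T y b v) - T y b (T x a v) = T (x * y - y * x) (a \<otimes>\<^bsub>A\<^esub> b) v"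
begin

definition lin_T :: "(complex mat \<times> 'a \<Rightarrow>\<^sub>0 complex) \<Rightarrow> 'v \<Rightarrow> 'v"
  where "lin_T p v = lin_ext sc (\<lambda>(z, a). T z a v) p"

lemma linear_lin_T: "Vector_Spaces.linear pm_scale sc (\<lambda>p. lin_T p v)"
  unfolding lin_T_def by (rule linear_lin_ext[OF vector_space_axioms])

lemma lin_T_single: "lin_T (Poly_Mapping.single (z, a) c) v = sc c (T z a v)"
  by (simp add: lin_T_def lin_ext_single[OF vector_space_axioms])

lemma lin_T_null: "p \<in> null \<Longrightarrow> lin_T p v = 0"
proof -
  assume "p \<in> null"
  then have "lin_ext sc (\<lambda>(z, a). T z a v) p \<in> {0}"
    by (intro lin_ext_null[OF vector_space_axioms])
      (auto simp: subspace_single_0 T_add_left T_add_right T_smult_left T_smult_right)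
  then show ?thesis by (simp add: lin_T_def)
qed

lemma lin_T_linear:
  assumes "Poly_Mapping.keys p \<subseteq> pairs"
  shows "Vector_Spaces.linear sc sc (lin_T p)"
proof (rule linearI[OF vector_space_axioms vector_space_axioms])
  have T: "Vector_Spaces.linear sc sc (T (fst k) (snd k))" if "k \<in> Poly_Mapping.keys p" for k
    using that assms by (intro T_linear) auto
  show "lin_T p (x + y) = lin_T p x + lin_T p y" for x y
    unfolding lin_T_def lin_ext_def case_prod_beta sum.distrib[symmetric] scale_right_distrib[symmetric]
    by (intro sum.cong refl) (simp add: linear_simps(1)[OF T])
  show "lin_T p (sc c x) = sc c (lin_T p x)" for c x
    unfolding lin_T_def lin_ext_def case_prod_beta scale_sum_right
    by (intro sum.cong refl) (simp add: linear_simps(2)[OF T] mult.commute)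
qed

lemma lin_T_bracket:
  assumes "Poly_Mapping.keys p \<subseteq> pairs" "Poly_Mapping.keys q \<subseteq> pairs"
  shows "lin_T (formal_bracket (sl n) A p q) v = lin_T p (lin_T q v) - lin_T q (lin_T p v)"
proof (rule linear_pm_eq[of sc "\<lambda>p. lin_T (formal_bracket (sl n) A p q) v"
      "\<lambda>p. lin_T p (lin_T q v) - lin_T q (lin_T p v)" p])
  show "Vector_Spaces.linear pm_scale sc (\<lambda>p. lin_T (formal_bracket (sl n) A p q) v)"
    by (rule lin_comp[OF linear_formal_bracket(2) linear_lin_T])
  show "Vector_Spaces.linear pm_scale sc (\<lambda>p. lin_T p (lin_T q v) - lin_T q (lin_T p v))"
    by (rule lin_minus[OF linear_lin_T lin_comp[OF linear_lin_T lin_T_linear[OF assms(2)]]])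
  fix k assume k: "k \<in> Poly_Mapping.keys p"
  let ?p = "Poly_Mapping.single k 1 :: _ \<Rightarrow>\<^sub>0 complex"
  have kp: "Poly_Mapping.keys ?p \<subseteq> pairs" using k assms(1) by auto
  show "lin_T (formal_bracket (sl n) A ?p q) v = lin_T ?p (lin_T q v) - lin_T q (lin_T ?p v)"
  proof (rule linear_pm_eq[of sc "\<lambda>q. lin_T (formal_bracket (sl n) A ?p q) v"
        "\<lambda>q. lin_T ?p (lin_T q v) - lin_T q (lin_T ?p v)" q])
    show "Vector_Spaces.linear pm_scale sc (\<lambda>q. lin_T (formal_bracket (sl n) A ?p q) v)"
      by (rule lin_comp[OF linear_formal_bracket(1) linear_lin_T])
    show "Vector_Spaces.linear pm_scale sc (\<lambda>q. lin_T ?p (lin_T q v) - lin_T q (lin_T ?p v))"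
      by (rule lin_minus[OF lin_comp[OF linear_lin_T lin_T_linear[OF kp]] linear_lin_T])
    fix l assume l: "l \<in> Poly_Mapping.keys q"
    obtain x a y b where kl: "k = (x, a)" "l = (y, b)" by (cases k, cases l)
    then have "x \<in> \<g>" "a \<in> carrier A" "y \<in> \<g>" "b \<in> carrier A" using k l assms by auto
    then show "lin_T (formal_bracket (sl n) A ?p (Poly_Mapping.single l 1)) v =
        lin_T ?p (lin_T (Poly_Mapping.single l 1) v) - lin_T (Poly_Mapping.single l 1) (lin_T ?p v)"
      by (simp add: kl formal_bracket_eq lin_ext_single[OF pm.vector_space_axioms] lin_T_single T_commutator)
  qed
qed

text \<open>
  The choice of the representative is immaterial by \<open>lin_T_null\<close>.
\<close>

definition tens :: "(complex mat \<times> 'a \<Rightarrow>\<^sub>0 complex) set \<Rightarrow> 'v \<Rightarrow> 'v"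
  where "tens \<tau> = lin_T (SOME p. p \<in> \<tau>)"

lemma tens_coset:
  assumes "Poly_Mapping.keys p \<subseteq> pairs"
  shows "tens (coset p) v = lin_T p v"
proof -
  have "p \<in> coset p"
    using assms pm.subspace_0[OF subspace_null] by (simp add: mem_coset)
  then have "(SOME q. q \<in> coset p) \<in> coset p" by (rule someI)
  then have "(SOME q. q \<in> coset p) - p \<in> null" using mem_coset[OF assms] by blast
  then have "lin_T ((SOME q. q \<in> coset p) - p) v = 0" by (rule lin_T_null)
  then show ?thesis by (simp add: tens_def linear_simps(4)[OF linear_lin_T])
qed

lemma tens_pure: "z \<in> \<g> \<Longrightarrow> a \<in> carrier A \<Longrightarrow> tens (pure z a) v = T z a v"
  unfolding pure_def by (subst tens_coset) (simp_all add: lin_T_single)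

lemma tens_linear: "\<tau> \<in> carrier LA \<Longrightarrow> Vector_Spaces.linear sc sc (tens \<tau>)"
proof -
  assume "\<tau> \<in> carrier LA"
  then obtain p where p: "Poly_Mapping.keys p \<subseteq> pairs" "\<tau> = coset p" by (rule LA_cases)
  then have "tens \<tau> = lin_T p" by (auto simp: tens_coset)
  with lin_T_linear[OF p(1)] show ?thesis by simp
qed

lemma tens_relations:
  assumes "x \<in> carrier LA" "y \<in> carrier LA"
  shows "tens (x \<oplus>\<^bsub>LA\<^esub> y) v = tens x v + tens y v"
    "tens (c \<odot>\<^bsub>LA\<^esub> x) v = sc c (tens x v)"
    "tens (bracket LA x y) v = tens x (tens y v) - tens y (tens x v)"
proof -
  obtain p q where *: "Poly_Mapping.keys p \<subseteq> pairs" "x = coset p" "Poly_Mapping.keys q \<subseteq> pairs" "y = coset q"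
    using assms by (metis LA_cases)
  have k: "Poly_Mapping.keys (p + q) \<subseteq> pairs" "Poly_Mapping.keys (pm_scale c p) \<subseteq> pairs"
    using * Poly_Mapping.keys_add[of p q] keys_pm_scale[of c p] by blast+
  show "tens (x \<oplus>\<^bsub>LA\<^esub> y) v = tens x v + tens y v"
    unfolding *(2,4) LA_add[OF *(1,3)] tens_coset[OF k(1)] tens_coset[OF *(1)] tens_coset[OF *(3)]
    by (rule linear_simps(1)[OF linear_lin_T])
  show "tens (c \<odot>\<^bsub>LA\<^esub> x) v = sc c (tens x v)"
    unfolding *(2) LA_smult[OF *(1)] tens_coset[OF k(2)] tens_coset[OF *(1)]
    by (rule linear_simps(2)[OF linear_lin_T])
  show "tens (bracket LA x y) v = tens x (tens y v) - tens y (tens x v)"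
    unfolding *(2,4) LA_bracket[OF *(1,3)] tens_coset[OF formal_bracket_closed[OF *(1,3)]]
      tens_coset[OF *(1)] tens_coset[OF *(3)]
    by (rule lin_T_bracket[OF *(1,3)])
qed

definition act :: "((complex mat \<times> 'a \<Rightarrow>\<^sub>0 complex) set free_word \<Rightarrow>\<^sub>0 complex) \<Rightarrow> 'v \<Rightarrow> 'v"
  where "act p v = lin_ext sc (\<lambda>u. foldr tens (letters u) v) p"

lemma linear_act: "Vector_Spaces.linear pm_scale sc (\<lambda>p. act p v)"
  unfolding act_def by (rule linear_lin_ext[OF vector_space_axioms])

lemmas act_simps = linear_simps[OF linear_act]

lemma act_one [simp]: "act 1 v = v"
  unfolding act_def by (subst single_one[symmetric], subst lin_ext_single[OF vector_space_axioms])
    (simp add: zero_free_word_def)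

lemma act_gen_mult:
  assumes "\<tau> \<in> carrier LA"
  shows "act (free_gen \<tau> * p) v = tens \<tau> (act p v)"
proof (rule linear_pm_eq[of sc "\<lambda>p. act (free_gen \<tau> * p) v" "\<lambda>p. tens \<tau> (act p v)" p])
  show "Vector_Spaces.linear pm_scale sc (\<lambda>p. act (free_gen \<tau> * p) v)"
    by (rule lin_comp[OF linear_mult_left linear_act])
  show "Vector_Spaces.linear pm_scale sc (\<lambda>p. tens \<tau> (act p v))"
    by (rule lin_comp[OF linear_act tens_linear[OF assms]])
  fix u :: "(complex mat \<times> 'a \<Rightarrow>\<^sub>0 complex) set free_word"
  show "act (free_gen \<tau> * Poly_Mapping.single u 1) v = tens \<tau> (act (Poly_Mapping.single u 1) v)"
    by (simp add: free_gen_def mult_single act_def lin_ext_single[OF vector_space_axioms] plus_free_word_def)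
qed

lemma act_gen: "\<tau> \<in> carrier LA \<Longrightarrow> act (free_gen \<tau>) v = tens \<tau> v"
  using act_gen_mult[of \<tau> 1 v] by simp

lemma act_linear: "p \<in> FX \<Longrightarrow> Vector_Spaces.linear sc sc (act p)"
proof (rule linearI[OF vector_space_axioms vector_space_axioms])
  fix x y c assume "p \<in> FX"
  then have "act p (x + y) = act p x + act p y \<and> act p (sc c x) = sc c (act p x)"
    by (induction rule: words_in_induct)
      (simp_all add: act_gen_mult linear_simps[OF tens_linear] act_simps scale_right_distrib algebra_simps)
  then show "act p (x + y) = act p x + act p y" "act p (sc c x) = sc c (act p x)" by auto
qed

lemma act_mult: "p \<in> FX \<Longrightarrow> act (p * q) v = act p (act q v)"
  by (induction rule: words_in_induct)
    (simp_all add: act_gen_mult mult.assoc pm_scale_mult_left distrib_right act_simps)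

lemma act_power: "p \<in> FX \<Longrightarrow> act (p ^ k) v = (act p ^^ k) v"
  by (induction k) (simp_all add: act_mult)

text \<open>
  The elements that act as 0 form a two-sided ideal, which contains the enveloping relations.
\<close>

lemma act_UI: "p \<in> UI \<Longrightarrow> act p v = 0"
proof -
  let ?J = "{p \<in> FX. \<forall>v. act p v = 0}"
  have rel: "enveloping_relations LA \<subseteq> ?J"
  proof
    fix r assume r: "r \<in> enveloping_relations LA"
    then have "act r v = 0" for v
      unfolding enveloping_relations_def
      by (auto simp: act_simps act_gen_mult act_gen LA_closed tens_relations)
    then show "r \<in> ?J" using r enveloping_relations_closed by auto
  qed
  interpret F: ring "free_algebra (carrier LA)" by (rule ring_free_algebra)
  interpret FM: Module.module "class_ring :: complex ring" "free_algebra (carrier LA)" by (rule module_free_algebra)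
  have "submodule class_ring ?J (free_algebra (carrier LA))"
    by (intro submodule.intro module_free_algebra) (auto simp: free_algebra_simps act_simps)
  then have "additive_subgroup ?J (free_algebra (carrier LA))"
    by (intro abelian_subgroup.axioms(1) FM.submodule_abelian_subgroup)
  then have "ideal ?J (free_algebra (carrier LA))"
    by (intro idealI ring_free_algebra)
      (auto simp: free_algebra_simps act_mult linear_simps(3)[OF act_linear] additive_subgroup_def)
  then have "UI \<subseteq> ?J"
    unfolding enveloping_ideal_def by (rule F.genideal_minimal[OF _ rel])
  moreover assume "p \<in> UI"
  ultimately show ?thesis by auto
qed

text \<open>
  The relations of the generator of the Weyl module of weight \<open>m\<omega>\<^sub>1\<close>, imposed only on the matrices that
  span \<open>n\<^sup>+\<close> and the Cartan subalgebra. The relations on the spans follow (\<open>n_plus_kills\<close>,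
  \<open>cartan_weight\<close>).
\<close>

definition hw_vector :: "nat \<Rightarrow> 'v \<Rightarrow> bool"
  where "hw_vector m v \<longleftrightarrow>
    (\<forall>i j a. 1 \<le> i \<longrightarrow> i < j \<longrightarrow> j \<le> n \<longrightarrow> a \<in> carrier A \<longrightarrow> T (e_mat n i j) a v = 0) \<and>
    (\<forall>i\<in>{1..n - 1}. T (h_mat n i) \<one>\<^bsub>A\<^esub> v = sc (if i = 1 then of_nat m else 0) v) \<and>
    (T (x_minus n 1) \<one>\<^bsub>A\<^esub> ^^ Suc m) v = 0 \<and>
    (\<forall>i\<in>{2..n - 1}. T (x_minus n i) \<one>\<^bsub>A\<^esub> v = 0)"

lemma T_zero: "a \<in> carrier A \<Longrightarrow> T (0\<^sub>m n n) a v = 0"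
  using T_add_left[of "0\<^sub>m n n" "0\<^sub>m n n" a v] SL.M.zero_closed by (simp add: sl_simps(2))

lemma n_plus_kills:
  assumes "hw_vector m v" "x \<in> n_plus n" "a \<in> carrier A"
  shows "T x a v = 0"
proof -
  have "submodule class_ring {x \<in> \<g>. T x a v = 0} (sl n)"
    using SL.M.zero_closed assms(3)
    by (intro submodule.intro module_sl)
      (auto simp: sl_simps(2-4) T_add_left T_smult_left T_zero simp del: sl_simps(1))
  moreover have "{e_mat n i j | i j. 1 \<le> i \<and> i < j \<and> j \<le> n} \<subseteq> {x \<in> \<g>. T x a v = 0}"
    using assms by (auto simp: hw_vector_def intro: e_mat_g)
  ultimately show ?thesis
    using assms(2) SL.span_is_subset unfolding n_plus_def by blast
qed

lemma cartan_weight: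
  assumes "hw_vector m v" "h \<in> cartan n"
  shows "T h \<one>\<^bsub>A\<^esub> v = sc (lam m h) v"
proof -
  have fw: "fundamental_weight 1 (x + y) = fundamental_weight 1 x + fundamental_weight 1 y"
    "fundamental_weight 1 (c \<cdot>\<^sub>m x) = c * fundamental_weight 1 x"
    if "x \<in> \<g>" "y \<in> \<g>" for x y c
    using that[THEN g_carrier] n2 by (auto simp: fundamental_weight_def)
  have fw0: "fundamental_weight 1 (0\<^sub>m n n) = 0"
    using n2 by (simp add: fundamental_weight_def)
  have "submodule class_ring {x \<in> \<g>. T x \<one>\<^bsub>A\<^esub> v = sc (lam m x) v} (sl n)"
    using SL.M.zero_closed
    by (intro submodule.intro module_sl)
      (auto simp: sl_simps(2-4) T_add_left T_smult_left T_zero fw fw0 distrib_left scale_left_distrib mult.left_commute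
        simp del: sl_simps(1) One_nat_def)
  moreover have "h_mat n ` {1..n - 1} \<subseteq> {x \<in> \<g>. T x \<one>\<^bsub>A\<^esub> v = sc (lam m x) v}"
  proof
    fix x assume "x \<in> h_mat n ` {1..n - 1}"
    then obtain i where i: "i \<in> {1..n - 1}" "x = h_mat n i" by auto
    have "T (h_mat n i) \<one>\<^bsub>A\<^esub> v = sc (if i = 1 then of_nat m else 0) v"
      using assms(1) i(1) unfolding hw_vector_def by blast
    then show "x \<in> {x \<in> \<g>. T x \<one>\<^bsub>A\<^esub> v = sc (lam m x) v}"
      using i h_mat_g[OF i(1)] by (simp only: mem_Collect_eq lam_h_mat[OF i(1)] simp_thms)
  qed
  ultimately have "cartan n \<subseteq> {x \<in> \<g>. T x \<one>\<^bsub>A\<^esub> v = sc (lam m x) v}"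
    unfolding cartan_def by (intro SL.span_is_subset)
  with assms(2) show ?thesis by auto
qed

text \<open>
  The universal property of the Weyl module: the classes of elements that kill \<open>v\<close> form a left ideal,
  which contains the defining relations.
\<close>

theorem act_L:
  assumes hw: "hw_vector m v" and p: "p \<in> L m"
  shows "act p v = 0"
proof -
  let ?J = "ucls ` {p \<in> FX. act p v = 0}"
  interpret U: Module.module "class_ring :: complex ring" U by (rule module_U)
  have "submodule class_ring ?J U"
  proof (intro submodule.intro module_U)
    show "?J \<subseteq> carrier U" by (auto simp: U_simps(1))
    show "\<zero>\<^bsub>U\<^esub> \<in> ?J" unfolding U_simps(4) by (intro imageI) (simp add: act_simps)
    show "c \<odot>\<^bsub>U\<^esub> X \<in> ?J" if "X \<in> ?J" for c X
      using that by (auto simp: U_simps(3) act_simps intro!: imageI words_in_scale)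
    show "X \<oplus>\<^bsub>U\<^esub> Y \<in> ?J" if "X \<in> ?J" "Y \<in> ?J" for X Y
      using that by (auto simp: U_simps(2) act_simps intro!: imageI words_in_add)
  qed
  then have "additive_subgroup ?J U"
    by (intro abelian_subgroup.axioms(1) U.submodule_abelian_subgroup)
  moreover have "X \<otimes>\<^bsub>U\<^esub> Y \<in> ?J" if "X \<in> carrier U" "Y \<in> ?J" for X Y
    using that
    by (auto simp: U_simps(1,6) act_mult linear_simps(3)[OF act_linear] intro!: imageI words_in_mult)
  ultimately have "left_ideal ?J U" by (auto simp: left_ideal_def)
  moreover have "weyl_relations n A (lam m) \<subseteq> ?J"
  proof -
    have act_gen': "act (gen z a) u = T z a u" if "z \<in> \<g>" "a \<in> carrier A" for z a u
      unfolding gen_def using that by (simp add: act_gen tens_pure)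
    have 1: "ucls (gen x a) \<in> ?J" if "x \<in> n_plus n" "a \<in> carrier A" for x a
      using that n_plus_g n_plus_kills[OF hw that] by (intro imageI) (auto simp: act_gen' subset_iff)
    have 2: "ucls (gen h \<one>\<^bsub>A\<^esub> - pm_scale (lam m h) 1) \<in> ?J" if "h \<in> cartan n" for h
      using that cartan_g cartan_weight[OF hw that]
      by (intro imageI CollectI conjI words_in_diff words_in_scale) (auto simp: act_gen' act_simps subset_iff)
    have 3: "ucls (gen (x_minus n i) \<one>\<^bsub>A\<^esub> ^ (k + 1)) \<in> ?J"
      if i: "i \<in> {1..n - 1}" and k: "lam m (h_mat n i) = of_nat k" for i k
    proof (intro imageI CollectI conjI)
      have g: "gen (x_minus n i) \<one>\<^bsub>A\<^esub> \<in> FX" using x_minus_g by auto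
      show "gen (x_minus n i) \<one>\<^bsub>A\<^esub> ^ (k + 1) \<in> FX" using U_pow[OF g] by blast
      have f: "act (gen (x_minus n i) \<one>\<^bsub>A\<^esub>) = T (x_minus n i) \<one>\<^bsub>A\<^esub>"
        using x_minus_g by (auto simp: act_gen')
      show "act (gen (x_minus n i) \<one>\<^bsub>A\<^esub> ^ (k + 1)) v = 0"
      proof (cases "i = 1")
        case True
        then have "k = m" using k lam_h_mat[OF i, of m] by simp
        then show ?thesis using hw True unfolding act_power[OF g] f by (simp add: hw_vector_def)
      next
        case False
        then have "k = 0" "i \<in> {2..n - 1}" using k lam_h_mat[OF i, of m] i by auto
        then show ?thesis using hw unfolding act_power[OF g] f by (simp add: hw_vector_def)
      qed
    qed
    show ?thesis unfolding weyl_relations_eq using 1 2 3 by blast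
  qed
  ultimately have "ucls p \<in> ?J" using p unfolding L_def wideal_iff by blast
  then obtain q where q: "q \<in> FX" "act q v = 0" "ucls p = ucls q" by auto
  have pF: "p \<in> FX" using p L_subset by auto
  have "p \<in> ucls q" using mem_ucls[OF pF] pF q(3) UI_zero by auto
  then have "p - q \<in> UI" using mem_ucls[OF q(1)] by auto
  then show ?thesis using act_UI[of "p - q" v] q(2) by (simp add: act_simps)
qed

end



section \<open>Matrix units\<close>

lemma e_mat_carrier [simp]: "e_mat n i j \<in> carrier_mat n n"
  by (simp add: e_mat_def)

lemma e_mat_mult:
  assumes "1 \<le> j" "j \<le> n"
  shows "e_mat n i j * e_mat n k l = (if j = k then e_mat n i l else 0\<^sub>m n n)"
proof (rule eq_matI)
  fix r c assume rc: "r < dim_row (if j = k then e_mat n i l else 0\<^sub>m n n)" "c < dim_col (if j = k then e_mat n i l else 0\<^sub>m n n)"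
  then have rc: "r < n" "c < n" by (auto simp: e_mat_def split: if_splits)
  have "(e_mat n i j * e_mat n k l) $$ (r, c) =
      (\<Sum>s<n. (if Suc r = i \<and> Suc s = j then 1 else 0) * (if Suc s = k \<and> Suc c = l then 1 else 0))"
    using rc by (simp add: e_mat_def scalar_prod_def atLeast0LessThan)
  also have "\<dots> = (\<Sum>s<n. if s = j - 1 then (if Suc r = i \<and> j = k \<and> Suc c = l then 1 else 0) else 0)"
    using assms by (intro sum.cong) auto
  also have "\<dots> = (if Suc r = i \<and> j = k \<and> Suc c = l then 1 else 0)"
    using assms by auto
  finally show "(e_mat n i j * e_mat n k l) $$ (r, c) = (if j = k then e_mat n i l else 0\<^sub>m n n) $$ (r, c)"
    using rc by (simp add: e_mat_def)
qed (auto simp: e_mat_def)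

definition diagonal :: "nat \<Rightarrow> complex mat \<Rightarrow> bool"
  where "diagonal n d \<longleftrightarrow> d \<in> carrier_mat n n \<and> (\<forall>k<n. \<forall>l<n. k \<noteq> l \<longrightarrow> d $$ (k, l) = 0)"

lemma mult_diagonal:
  assumes "diagonal n d" "x \<in> carrier_mat n n" "r < n" "c < n"
  shows "(x * d) $$ (r, c) = x $$ (r, c) * d $$ (c, c)" "(d * x) $$ (r, c) = d $$ (r, r) * x $$ (r, c)"
proof -
  have d: "d \<in> carrier_mat n n" using assms(1) by (simp add: diagonal_def)
  have "(x * d) $$ (r, c) = (\<Sum>s<n. x $$ (r, s) * d $$ (s, c))"
    using d assms(2-4) by (simp add: scalar_prod_def atLeast0LessThan)
  also have "\<dots> = (\<Sum>s<n. if s = c then x $$ (r, c) * d $$ (c, c) else 0)"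
    using assms by (intro sum.cong) (auto simp: diagonal_def)
  finally show "(x * d) $$ (r, c) = x $$ (r, c) * d $$ (c, c)" using assms by simp
  have "(d * x) $$ (r, c) = (\<Sum>s<n. d $$ (r, s) * x $$ (s, c))"
    using d assms(2-4) by (simp add: scalar_prod_def atLeast0LessThan)
  also have "\<dots> = (\<Sum>s<n. if s = r then d $$ (r, r) * x $$ (r, c) else 0)"
    using assms by (intro sum.cong) (auto simp: diagonal_def)
  finally show "(d * x) $$ (r, c) = d $$ (r, r) * x $$ (r, c)" using assms by simp
qed

lemma diagonal_h_mat: "diagonal n (h_mat n i)"
  by (auto simp: diagonal_def h_mat_def e_mat_def)

lemma bracket_diagonal_e_mat:
  assumes "diagonal n d" "1 \<le> i" "i \<le> n" "1 \<le> j" "j \<le> n"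
  shows "d * e_mat n i j - e_mat n i j * d = (d $$ (i - 1, i - 1) - d $$ (j - 1, j - 1)) \<cdot>\<^sub>m e_mat n i j"
proof (rule eq_matI)
  have d: "d \<in> carrier_mat n n" using assms by (simp add: diagonal_def)
  fix r c assume "r < dim_row ((d $$ (i - 1, i - 1) - d $$ (j - 1, j - 1)) \<cdot>\<^sub>m e_mat n i j)"
    "c < dim_col ((d $$ (i - 1, i - 1) - d $$ (j - 1, j - 1)) \<cdot>\<^sub>m e_mat n i j)"
  then have rc: "r < n" "c < n" by (auto simp: e_mat_def)
  then have "(d * e_mat n i j - e_mat n i j * d) $$ (r, c) = d $$ (r, r) * e_mat n i j $$ (r, c) - e_mat n i j $$ (r, c) * d $$ (c, c)"
    using d carrier_matD[OF e_mat_carrier[of n i j]] mult_diagonal[OF assms(1) e_mat_carrier[of n i j] rc] by (simp del: index_mult_mat(1))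
  then show "(d * e_mat n i j - e_mat n i j * d) $$ (r, c) =
      ((d $$ (i - 1, i - 1) - d $$ (j - 1, j - 1)) \<cdot>\<^sub>m e_mat n i j) $$ (r, c)"
    using rc by (auto simp: e_mat_def)
qed (use assms(1) in \<open>auto simp: e_mat_def diagonal_def\<close>)

lemma bracket_diagonal:
  assumes "diagonal n d" "diagonal n d'"
  shows "d * d' - d' * d = 0\<^sub>m n n"
proof (rule eq_matI)
  have d: "d \<in> carrier_mat n n" "d' \<in> carrier_mat n n" using assms by (auto simp: diagonal_def)
  fix r c assume "r < dim_row (0\<^sub>m n n :: complex mat)" "c < dim_col (0\<^sub>m n n :: complex mat)"
  then have rc: "r < n" "c < n" by auto
  then have "(d * d' - d' * d) $$ (r, c) = d $$ (r, r) * d' $$ (r, c) - d' $$ (r, c) * d $$ (c, c)"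
    using d mult_diagonal[OF assms(1) d(2) rc] by (simp del: index_mult_mat(1))
  then show "(d * d' - d' * d) $$ (r, c) = 0\<^sub>m n n $$ (r, c)"
    using rc assms(2) by (cases "r = c") (auto simp: diagonal_def)
qed (use assms in \<open>auto simp: diagonal_def\<close>)

lemma bracket_e_f: "i \<in> {1..n - 1} \<Longrightarrow> e_mat n i (i + 1) * x_minus n i - x_minus n i * e_mat n i (i + 1) = h_mat n i"
  unfolding x_minus_def h_mat_def by (subst (1 2) e_mat_mult) auto

lemma bracket_f_e_mat:
  assumes "1 \<le> l" "l < k" "k < n"
  shows "x_minus n k * e_mat n k l - e_mat n k l * x_minus n k = e_mat n (k + 1) l"
  unfolding x_minus_def using assms by (subst (1 2) e_mat_mult) (auto simp: e_mat_def)

lemma bracket_h_f: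
  assumes "i \<in> {1..n - 1}"
  shows "h_mat n i * x_minus n i - x_minus n i * h_mat n i = (-2) \<cdot>\<^sub>m x_minus n i"
proof -
  have "h_mat n i $$ (i, i) = -1" "h_mat n i $$ (i - 1, i - 1) = 1"
    using assms by (auto simp: h_mat_def e_mat_def)
  moreover have "i + 1 \<le> n" "1 \<le> i" using assms by auto
  ultimately show ?thesis
    unfolding x_minus_def using bracket_diagonal_e_mat[OF diagonal_h_mat, of "i + 1" n i i] by simp
qed

section \<open>Highest weight vectors\<close>

context current_rep
begin

lemma T_swap:
  assumes "x \<in> \<g>" "y \<in> \<g>" "a \<in> carrier A" "b \<in> carrier A"
  shows "T x a (T y b v) = T y b (T x a v) + T (x * y - y * x) (a \<otimes>\<^bsub>A\<^esub> b) v"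
  using T_commutator[OF assms, of v] by (simp add: algebra_simps)

lemma e_f_swap:
  assumes "i \<in> {1..n - 1}" "a \<in> carrier A" "b \<in> carrier A"
  shows "T (e_mat n i (i + 1)) a (T (x_minus n i) b v) = T (x_minus n i) b (T (e_mat n i (i + 1)) a v) + T (h_mat n i) (a \<otimes>\<^bsub>A\<^esub> b) v"
  using T_swap[of "e_mat n i (i + 1)" "x_minus n i" a b v] assms x_minus_g e_mat_g[of i "i + 1"]
  unfolding bracket_e_f[OF assms(1)] by simp

lemma h_f_swap:
  assumes "i \<in> {1..n - 1}" "a \<in> carrier A" "b \<in> carrier A"
  shows "T (h_mat n i) a (T (x_minus n i) b v) =
    T (x_minus n i) b (T (h_mat n i) a v) + sc (-2) (T (x_minus n i) (a \<otimes>\<^bsub>A\<^esub> b) v)"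
proof -
  have "T (h_mat n i) a (T (x_minus n i) b v) =
      T (x_minus n i) b (T (h_mat n i) a v) + T ((-2) \<cdot>\<^sub>m x_minus n i) (a \<otimes>\<^bsub>A\<^esub> b) v"
    unfolding bracket_h_f[OF assms(1), symmetric] by (rule T_swap) (use assms x_minus_g h_mat_g in auto)
  then show ?thesis using assms x_minus_g by (simp add: T_smult_left)
qed

lemma f_f_swap:
  assumes "a \<in> carrier A" "b \<in> carrier A"
  shows "T (x_minus n i) a (T (x_minus n i) b v) = T (x_minus n i) b (T (x_minus n i) a v)"
  using T_swap[OF x_minus_g x_minus_g assms, of i i v] assms
  by (simp add: T_zero minus_r_inv_mat[OF mult_carrier_mat[OF g_carrier[OF x_minus_g] g_carrier[OF x_minus_g]]])

text \<open>
  From \<open>(e\<^sub>i \<otimes> a) v = 0\<close> and \<open>(f\<^sub>i \<otimes> 1) v = 0\<close>, where \<open>e\<^sub>i\<close> and \<open>f\<^sub>i\<close> are the root vectors of \<open>h\<^sub>i\<close>: their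
  bracket is \<open>h\<^sub>i \<otimes> a\<close>, and the bracket of this with \<open>f\<^sub>i \<otimes> 1\<close> is \<open>-2 f\<^sub>i \<otimes> a\<close>.
\<close>

lemma hw_kills:
  assumes hw: "hw_vector m v" and i: "i \<in> {2..n - 1}" and a: "a \<in> carrier A"
  shows "T (h_mat n i) a v = 0" "T (x_minus n i) a v = 0"
proof -
  have i': "i \<in> {1..n - 1}" using i by auto
  have e: "T (e_mat n i (i + 1)) a v = 0" using hw i a by (auto simp: hw_vector_def)
  have f: "T (x_minus n i) \<one>\<^bsub>A\<^esub> v = 0" using hw i by (auto simp: hw_vector_def)
  have zero: "T z b 0 = 0" if "z \<in> \<g>" "b \<in> carrier A" for z b
    using linear_simps(3)[OF T_linear[OF that]] .
  show h: "T (h_mat n i) a v = 0"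
    using e_f_swap[OF i' a A_closed(4), of v] e f a x_minus_g e_mat_g[of i "i + 1"] by (simp add: zero)
  show "T (x_minus n i) a v = 0"
    using h_f_swap[OF i' a A_closed(4), of v] h f a x_minus_g h_mat_g[OF i'] by (simp add: zero)
qed

lemma hw_kills_lower:
  assumes hw: "hw_vector m v" and a: "a \<in> carrier A"
  shows "2 \<le> l \<Longrightarrow> l < k \<Longrightarrow> k \<le> n \<Longrightarrow> T (e_mat n k l) a v = 0"
proof (induction k)
  case (Suc k)
  have zero: "T z b 0 = 0" if "z \<in> \<g>" "b \<in> carrier A" for z b
    using linear_simps(3)[OF T_linear[OF that]] .
  show ?case
  proof (cases "l = k")
    case True
    then have "e_mat n (Suc k) l = x_minus n l" by (simp add: x_minus_def)
    then show ?thesis using hw_kills(2)[OF hw _ a, of l] Suc.prems True by auto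
  next
    case False
    then have IH: "T (e_mat n k l) a v = 0" using Suc by simp
    have f: "T (x_minus n k) \<one>\<^bsub>A\<^esub> v = 0" using hw Suc.prems False by (auto simp: hw_vector_def)
    have "T (x_minus n k) \<one>\<^bsub>A\<^esub> (T (e_mat n k l) a v) =
        T (e_mat n k l) a (T (x_minus n k) \<one>\<^bsub>A\<^esub> v) + T (e_mat n (k + 1) l) (\<one>\<^bsub>A\<^esub> \<otimes>\<^bsub>A\<^esub> a) v"
      using T_swap[of "x_minus n k" "e_mat n k l" "\<one>\<^bsub>A\<^esub>" a v] bracket_f_e_mat[of l k n] Suc.prems False a
        x_minus_g e_mat_g[of k l] by simp
    then show ?thesis
      using IH f a False x_minus_g e_mat_g[of k l] by (simp add: zero)
  qed
qed simp

text \<open>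
  Write \<open>e, h, f\<close> for the standard basis of the first \<open>sl\<^sub>2\<close> and \<open>e\<^sub>a\<close> for \<open>e \<otimes> a\<close>, and let
  \<open>P = f\<^bsup>m+1\<^esup> h\<^sub>a v\<close> and \<open>Q = f\<^sup>m f\<^sub>a v\<close>. Applying \<open>h\<^sub>a\<close> to \<open>f\<^bsup>m+1\<^esup> v = 0\<close> gives \<open>P = 2(m + 1)Q\<close>, and applying
  \<open>e\<^sub>a\<close> to \<open>f\<^bsup>m+2\<^esup> v = 0\<close> gives \<open>P = (m + 1)Q\<close>. Hence \<open>P = 0\<close>.
\<close>

lemma hw_power_h:
  assumes hw: "hw_vector m v" and a: "a \<in> carrier A"
  shows "(T (x_minus n 1) \<one>\<^bsub>A\<^esub> ^^ Suc m) (T (h_mat n 1) a v) = 0"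
proof -
  note One_nat_def [simp del]
  let ?f = "T (x_minus n 1) \<one>\<^bsub>A\<^esub>" and ?h = "T (h_mat n 1) a" and ?fa = "T (x_minus n 1) a"
    and ?e = "T (e_mat n 1 2) a"
  have one: "1 \<in> {1..n - 1}" using n2 by auto
  have lin: "Vector_Spaces.linear sc sc ?f" by (rule T_linear[OF x_minus_g]) simp
  note L = linear_simps[OF lin]
  have hf: "?h (?f u) = ?f (?h u) + sc (-2) (?fa u)" for u
    using h_f_swap[OF one a A_closed(4), of u] a by simp
  have ef: "?e (?f u) = ?f (?e u) + ?h u" for u
    using e_f_swap[OF one a A_closed(4), of u] a by simp
  have ff: "?fa (?f u) = ?f (?fa u)" for u
    using f_f_swap[OF a A_closed(4), of 1 u] .
  have ffk: "?fa ((?f ^^ k) u) = (?f ^^ k) (?fa u)" for k u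
    by (induction k) (simp_all add: ff)
  have hk: "?h ((?f ^^ Suc k) u) = (?f ^^ Suc k) (?h u) + sc (-2 * of_nat (Suc k)) ((?f ^^ k) (?fa u))" for k u
  proof (induction k)
    case 0
    then show ?case by (simp add: hf)
  next
    case (Suc k)
    have "?h ((?f ^^ Suc (Suc k)) u) = ?f (?h ((?f ^^ Suc k) u)) + sc (-2) (?fa ((?f ^^ Suc k) u))"
      by (simp add: hf)
    also have "\<dots> = (?f ^^ Suc (Suc k)) (?h u) + sc (-2 * of_nat (Suc k)) ((?f ^^ Suc k) (?fa u))
        + sc (-2) ((?f ^^ Suc k) (?fa u))"
      unfolding Suc.IH ffk L by (simp only: funpow.simps comp_apply)
    also have "\<dots> = (?f ^^ Suc (Suc k)) (?h u) + sc (-2 * of_nat (Suc (Suc k))) ((?f ^^ Suc k) (?fa u))"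
      unfolding add.assoc scale_left_distrib[symmetric] by (simp add: algebra_simps)
    finally show ?case .
  qed
  have ev: "?e v = 0" using hw n2 a by (auto simp: hw_vector_def)
  have ek: "?e ((?f ^^ Suc (Suc k)) v) = sc (of_nat (k + 2)) ((?f ^^ Suc k) (?h v))
      + sc (- of_nat ((k + 2) * (k + 1))) ((?f ^^ k) (?fa v))" for k
  proof (induction k)
    case 0
    have "sc 2 w = w + w" for w using scale_left_distrib[of 1 1 w] by simp
    then show ?case by (simp add: ef hf ev L add.assoc)
  next
    case (Suc k)
    have "?e ((?f ^^ Suc (Suc (Suc k))) v) = ?f (?e ((?f ^^ Suc (Suc k)) v)) + ?h ((?f ^^ Suc (Suc k)) v)"
      by (simp add: ef)
    also have "\<dots> = sc (of_nat (k + 2)) ((?f ^^ Suc (Suc k)) (?h v)) + sc (- of_nat ((k + 2) * (k + 1))) ((?f ^^ Suc k) (?fa v))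
        + ((?f ^^ Suc (Suc k)) (?h v) + sc (-2 * of_nat (Suc (Suc k))) ((?f ^^ Suc k) (?fa v)))"
      unfolding Suc.IH hk L by (simp only: funpow.simps comp_apply)
    also have "\<dots> = (sc (of_nat (k + 2)) ((?f ^^ Suc (Suc k)) (?h v)) + sc 1 ((?f ^^ Suc (Suc k)) (?h v)))
        + (sc (- of_nat ((k + 2) * (k + 1))) ((?f ^^ Suc k) (?fa v)) + sc (-2 * of_nat (Suc (Suc k))) ((?f ^^ Suc k) (?fa v)))"
      by (simp only: scale_one add_ac)
    also have "\<dots> = sc (of_nat (Suc k + 2)) ((?f ^^ Suc (Suc k)) (?h v))
        + sc (- of_nat ((Suc k + 2) * (Suc k + 1))) ((?f ^^ Suc k) (?fa v))"
      unfolding scale_left_distrib[symmetric] by (intro arg_cong2[of _ _ _ _ "(+)"] arg_cong2[of _ _ _ _ sc] refl) (simp_all add: algebra_simps)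
    finally show ?case .
  qed
  have fm: "(?f ^^ Suc m) v = 0" using hw by (simp add: hw_vector_def)
  define P Q where "P = (?f ^^ Suc m) (?h v)" and "Q = (?f ^^ m) (?fa v)"
  have "?h 0 = 0" using linear_simps(3)[OF T_linear[OF h_mat_g[OF one] a]] .
  then have 1: "P + sc (-2 * of_nat (Suc m)) Q = 0"
    using hk[of m v] unfolding fm P_def Q_def by simp
  have "(?f ^^ Suc (Suc m)) v = 0" using fm L(3) by simp
  moreover have "?e 0 = 0" using linear_simps(3)[OF T_linear[OF e_mat_g a]] by simp
  ultimately have "sc (of_nat (m + 2)) P + sc (- of_nat ((m + 2) * (m + 1))) Q = 0"
    using ek[of m] unfolding P_def Q_def by simp
  also have "sc (of_nat (m + 2)) P + sc (- of_nat ((m + 2) * (m + 1))) Q =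
      sc (of_nat (m + 2)) (P + sc (- of_nat (Suc m)) Q)"
    unfolding scale_right_distrib scale_scale by (simp add: algebra_simps)
  finally have "P + sc (- of_nat (Suc m)) Q = 0"
    by (metis scale_eq_0_iff of_nat_eq_0_iff add_eq_0_iff_both_eq_0 numeral_neq_zero)
  then have "P = sc (of_nat (Suc m)) Q" by (simp add: scale_minus_left del: of_nat_Suc)
  moreover have "P = sc (of_nat (Suc m)) Q + sc (of_nat (Suc m)) Q"
    using 1 unfolding scale_left_distrib[symmetric]
    by (simp add: scale_minus_left eq_neg_iff_add_eq_0[symmetric] algebra_simps)
  ultimately have "P = P + P" by metis
  then have "P = 0" by simp
  then show ?thesis unfolding P_def .
qed

text \<open>
  Brackets with \<open>h\<^sub>1\<close> only rescale matrix units, so the linear relations pass from \<open>v\<close> to \<open>(h\<^sub>1 \<otimes> a) v\<close>. The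
  relation with the power is \<open>hw_power_h\<close>.
\<close>

lemma hw_vector_h:
  assumes hw: "hw_vector m v" and a: "a \<in> carrier A"
  shows "hw_vector m (T (h_mat n 1) a v)"
proof -
  have one: "1 \<in> {1..n - 1}" using n2 by auto
  note h1 = h_mat_g[OF one]
  have zero: "T z b 0 = 0" if "z \<in> \<g>" "b \<in> carrier A" for z b
    using linear_simps(3)[OF T_linear[OF that]] .
  have swap: "T (e_mat n i j) b (T (h_mat n 1) a v) = 0"
    if "T (e_mat n i j) b v = 0" "T (e_mat n i j) (b \<otimes>\<^bsub>A\<^esub> a) v = 0" "i \<noteq> j" "b \<in> carrier A"
      "1 \<le> i" "i \<le> n" "1 \<le> j" "j \<le> n" for i j b
  proof -
    note prem = that
    have e: "e_mat n i j \<in> \<g>" using prem by (intro e_mat_g)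
    obtain c where c: "h_mat n 1 * e_mat n i j - e_mat n i j * h_mat n 1 = c \<cdot>\<^sub>m e_mat n i j"
      using bracket_diagonal_e_mat[OF diagonal_h_mat prem(5-8)] by blast
    have "T (h_mat n 1) a (T (e_mat n i j) b v) =
      T (e_mat n i j) b (T (h_mat n 1) a v) + T (c \<cdot>\<^sub>m e_mat n i j) (a \<otimes>\<^bsub>A\<^esub> b) v"
      unfolding c[symmetric] by (rule T_swap[OF h1 e a prem(4)])
    then show ?thesis
      using prem e a h1 by (simp add: zero T_smult_left A.m_comm)
  qed
  have "T (e_mat n i j) b (T (h_mat n 1) a v) = 0" if "1 \<le> i" "i < j" "j \<le> n" "b \<in> carrier A" for i j b
    using that hw a by (intro swap) (auto simp: hw_vector_def)
  moreover have "T (h_mat n i) \<one>\<^bsub>A\<^esub> (T (h_mat n 1) a v) = sc (if i = 1 then of_nat m else 0) (T (h_mat n 1) a v)"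
    if i: "i \<in> {1..n - 1}" for i
  proof -
    have w: "T (h_mat n i) \<one>\<^bsub>A\<^esub> v = sc (if i = 1 then of_nat m else 0) v"
      using hw i unfolding hw_vector_def by blast
    have "T (h_mat n i) \<one>\<^bsub>A\<^esub> (T (h_mat n 1) a v) = T (h_mat n 1) a (T (h_mat n i) \<one>\<^bsub>A\<^esub> v)"
      using T_swap[OF h_mat_g[OF i] h1 A_closed(4) a, of v] a
      unfolding bracket_diagonal[OF diagonal_h_mat diagonal_h_mat] by (simp add: T_zero)
    also have "\<dots> = sc (if i = 1 then of_nat m else 0) (T (h_mat n 1) a v)"
      unfolding w by (rule linear_simps(2)[OF T_linear[OF h1 a]])
    finally show ?thesis .
  qed
  moreover have "T (x_minus n i) \<one>\<^bsub>A\<^esub> (T (h_mat n 1) a v) = 0" if i: "i \<in> {2..n - 1}" for i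
    unfolding x_minus_def
    using i hw_kills(2)[OF hw i] a
    by (intro swap) (auto simp: x_minus_def)
  ultimately show ?thesis
    unfolding hw_vector_def using hw_power_h[OF hw a] by blast
qed

end



section \<open>The Weyl module as a representation of \<open>gl\<^sub>n \<otimes> A\<close>\<close>

text \<open>
  The image of the projection is a complement of \<open>S\<close>, hence a copy of the quotient. Below, this provides a
  model of the Weyl module on which the operators are defined on a whole type.
\<close>

lemma (in vector_space) exists_projection_along:
  assumes S: "subspace S"
  shows "\<exists>\<kappa>. Vector_Spaces.linear scale scale \<kappa> \<and> (\<forall>x\<in>S. \<kappa> x = 0) \<and> (\<forall>x. \<kappa> x - x \<in> S)"
proof -
  interpret P: vector_space_pair scale scale by unfold_locales
  obtain C where C: "C \<subseteq> S" "independent C" "S \<subseteq> span C"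
    using maximal_independent_subset by blast
  define \<pi> where "\<pi> = P.construct C (\<lambda>b. b)"
  have lin: "Vector_Spaces.linear scale scale \<pi>"
    unfolding \<pi>_def by (rule P.linear_construct[OF C(2)])
  have id: "\<pi> x = x" if "x \<in> span C" for x
  proof (rule P.linear_eq_on_span[OF lin linear_ident _ that])
    show "\<pi> b = b" if "b \<in> C" for b
      unfolding \<pi>_def by (rule P.construct_basis[OF C(2) that])
  qed
  have "span C \<subseteq> S" by (rule span_minimal[OF C(1) S])
  then have range: "\<pi> x \<in> S" for x
    unfolding \<pi>_def using P.construct_in_span[OF C(2), of "\<lambda>b. b" x] by auto
  have "Vector_Spaces.linear scale scale (\<lambda>x. x - \<pi> x)"
    by (rule lin_minus[OF linear_ident lin])
  moreover have "\<forall>x\<in>S. x - \<pi> x = 0" using id C(3) by auto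
  moreover have "x - \<pi> x - x \<in> S" for x using subspace_neg[OF S range[of x]] by simp
  ultimately show ?thesis by (intro exI[of _ "\<lambda>x. x - \<pi> x"]) auto
qed

text \<open>
  An intertwiner between two representations is only assumed on an invariant subspace, since
  equivariance of \<open>\<Psi>\<close> holds in a single degree.
\<close>

lemma intertwining:
  assumes "current_rep A B n s T" "current_rep A B n s' T'"
    and \<delta>: "Vector_Spaces.linear s s' \<delta>"
    and S: "module.subspace s S"
    and closed: "\<And>z a x. z \<in> carrier (sl n) \<Longrightarrow> a \<in> carrier A \<Longrightarrow> x \<in> S \<Longrightarrow> T z a x \<in> S"
    and comm: "\<And>z a x. z \<in> carrier (sl n) \<Longrightarrow> a \<in> carrier A \<Longrightarrow> x \<in> S \<Longrightarrow> \<delta> (T z a x) = T' z a (\<delta> x)"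
    and "x \<in> S" "p \<in> words_in (carrier (sl_map n A))"
  shows "current_rep.act s T p x \<in> S" "\<delta> (current_rep.act s T p x) = current_rep.act s' T' p (\<delta> x)"
proof -
  interpret R: current_rep A B n s T by fact
  interpret R': current_rep A B n s' T' by fact
  note l = linear_simps[OF \<delta>]
  have tens: "R.tens \<tau> y \<in> S \<and> \<delta> (R.tens \<tau> y) = R'.tens \<tau> (\<delta> y)" if "\<tau> \<in> carrier R.LA" "y \<in> S" for \<tau> y
  proof -
    obtain q where q: "Poly_Mapping.keys q \<subseteq> R.pairs" "\<tau> = R.coset q" using \<open>\<tau> \<in> carrier R.LA\<close> by (rule R.LA_cases)
    have "R.lin_T q y \<in> S \<and> \<delta> (R.lin_T q y) = R'.lin_T q (\<delta> y)"
    proof (rule pm_induct)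
      fix k assume k: "k \<in> Poly_Mapping.keys q"
      obtain z a where "k = (z, a)" by (cases k)
      then have za: "k = (z, a)" "z \<in> carrier (sl n)" "a \<in> carrier A" using k q(1) by auto
      show "R.lin_T (Poly_Mapping.single k 1) y \<in> S \<and> \<delta> (R.lin_T (Poly_Mapping.single k 1) y) = R'.lin_T (Poly_Mapping.single k 1) (\<delta> y)"
        using closed[OF za(2,3) that(2)] comm[OF za(2,3) that(2)] by (simp add: za(1) R.lin_T_single R'.lin_T_single)
    qed (auto simp: linear_simps[OF R.linear_lin_T] linear_simps[OF R'.linear_lin_T] l
        intro: R.subspace_0[OF S] R.subspace_add[OF S] R.subspace_scale[OF S])
    then show ?thesis by (simp add: q(2) R.tens_coset[OF q(1)] R'.tens_coset[OF q(1)])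
  qed
  have "R.act p x \<in> S \<and> \<delta> (R.act p x) = R'.act p (\<delta> x)"
    using assms(8)
  proof (induction rule: words_in_induct)
    case (gen \<tau> p)
    then show ?case using tens by (simp add: R.act_gen_mult R'.act_gen_mult)
  qed (use \<open>x \<in> S\<close> in \<open>auto simp: R.act_simps R'.act_simps l intro: R.subspace_add[OF S] R.subspace_scale[OF S]\<close>)
  then show "R.act p x \<in> S" "\<delta> (R.act p x) = R'.act p (\<delta> x)" by auto
qed

definition trace_mat :: "nat \<Rightarrow> complex mat \<Rightarrow> complex"
  where "trace_mat n z = (\<Sum>k<n. z $$ (k, k))"

text \<open>
  The projection from \<open>gl\<^sub>n\<close> to \<open>sl\<^sub>n\<close> along the scalar matrices.
\<close>

definition traceless :: "nat \<Rightarrow> complex mat \<Rightarrow> complex mat"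
  where "traceless n z = mat n n (\<lambda>(r, c). z $$ (r, c) - (if r = c then trace_mat n z / of_nat n else 0))"

lemma traceless_carrier [simp]: "traceless n z \<in> carrier_mat n n"
  by (simp add: traceless_def)

lemma traceless_dim [simp]: "dim_row (traceless n z) = n" "dim_col (traceless n z) = n"
  by (simp_all add: traceless_def)

lemma traceless_index [simp]: "r < n \<Longrightarrow> c < n \<Longrightarrow>
    traceless n z $$ (r, c) = z $$ (r, c) - (if r = c then trace_mat n z / of_nat n else 0)"
  by (simp add: traceless_def)

lemma trace_mat_linear:
  assumes "x \<in> carrier_mat n n" "y \<in> carrier_mat n n"
  shows "trace_mat n (x + y) = trace_mat n x + trace_mat n y" "trace_mat n (c \<cdot>\<^sub>m x) = c * trace_mat n x"
  using assms by (auto simp: trace_mat_def sum.distrib sum_distrib_left)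

lemma traceless_linear:
  assumes "x \<in> carrier_mat n n" "y \<in> carrier_mat n n"
  shows "traceless n (x + y) = traceless n x + traceless n y" "traceless n (c \<cdot>\<^sub>m x) = c \<cdot>\<^sub>m traceless n x"
  using assms by (auto intro!: eq_matI simp: trace_mat_linear[OF assms] add_divide_distrib algebra_simps)

lemma traceless_trace_0:
  assumes "x \<in> carrier_mat n n" "trace_mat n x = 0"
  shows "traceless n x = x"
  using assms by (intro eq_matI) auto

lemma traceless_g: "0 < n \<Longrightarrow> traceless n x \<in> carrier (sl n)"
  by (simp add: sl_simps sum_subtractf trace_mat_def)

lemma traceless_bracket:
  assumes "x \<in> carrier_mat n n" "y \<in> carrier_mat n n"
  shows "traceless n x * traceless n y - traceless n y * traceless n x = x * y - y * x"
proof (rule eq_matI)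
  have entry: "(traceless n x * traceless n y) $$ (r, c) = (x * y) $$ (r, c) - trace_mat n x / of_nat n * y $$ (r, c)
      - trace_mat n y / of_nat n * x $$ (r, c) + (if r = c then trace_mat n x / of_nat n * (trace_mat n y / of_nat n) else 0)"
    if "x \<in> carrier_mat n n" "y \<in> carrier_mat n n" "r < n" "c < n" for x y r c
  proof -
    let ?\<alpha> = "trace_mat n x / of_nat n" and ?\<beta> = "trace_mat n y / of_nat n"
    have "(traceless n x * traceless n y) $$ (r, c) = (\<Sum>s<n. traceless n x $$ (r, s) * traceless n y $$ (s, c))"
      using that carrier_matD[OF traceless_carrier[of n x]] carrier_matD[OF traceless_carrier[of n y]]
      by (simp add: scalar_prod_def atLeast0LessThan del: traceless_index)
    also have "\<dots> = (\<Sum>s<n. x $$ (r, s) * y $$ (s, c) - (if s = r then ?\<alpha> * y $$ (r, c) else 0)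
        - (if s = c then ?\<beta> * x $$ (r, c) else 0) + (if s = r then (if r = c then ?\<alpha> * ?\<beta> else 0) else 0))"
      using that by (intro sum.cong) (auto simp: algebra_simps)
    also have "\<dots> = (\<Sum>s<n. x $$ (r, s) * y $$ (s, c)) - ?\<alpha> * y $$ (r, c)
      - ?\<beta> * x $$ (r, c) + (if r = c then ?\<alpha> * ?\<beta> else 0)"
      using that by (simp add: sum.distrib sum_subtractf)
    also have "(\<Sum>s<n. x $$ (r, s) * y $$ (s, c)) = (x * y) $$ (r, c)"
      using that by (simp add: scalar_prod_def atLeast0LessThan)
    finally show ?thesis .
  qed
  fix r c assume "r < dim_row (x * y - y * x)" "c < dim_col (x * y - y * x)"
  then have rc: "r < n" "c < n" using assms by auto
  then show "(traceless n x * traceless n y - traceless n y * traceless n x) $$ (r, c) = (x * y - y * x) $$ (r, c)"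
    using assms carrier_matD[OF traceless_carrier[of n x]] carrier_matD[OF traceless_carrier[of n y]]
    by (simp add: entry del: index_mult_mat(1))
qed (use assms in \<open>auto simp: traceless_def\<close>)

locale weyl_type = current_algebra A B n for A :: "(complex, 'a) module" and B n +
  fixes m :: nat
begin

text \<open>
  The Weyl module is modelled by a complement of \<open>L m\<close> in the free algebra: \<open>\<kappa>\<close> projects onto it along
  \<open>L m\<close>, and \<open>TW z a\<close> multiplies by the generator of \<open>z \<otimes> a\<close> and projects back. Words with letters outside
  \<open>sl\<^sub>n \<otimes> A\<close>, on which \<open>L m\<close> gives no control, are first removed by \<open>proj\<close>.
\<close>

definition proj where "proj p = lin_ext pm_scale (\<lambda>u. if set (letters u) \<subseteq> carrier LA then Poly_Mapping.single u 1 else 0) p"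

lemma linear_proj: "Vector_Spaces.linear pm_scale pm_scale proj"
  unfolding proj_def[abs_def] by (rule linear_lin_ext[OF pm.vector_space_axioms])

lemma proj_closed [simp]: "proj p \<in> FX"
  unfolding proj_def lin_ext_def by (intro words_in_sum words_in_scale) (simp add: words_in_def)

lemma proj_id: "p \<in> FX \<Longrightarrow> proj p = p"
  unfolding proj_def
  by (rule linear_pm_eq[OF linear_lin_ext[OF pm.vector_space_axioms] pm.linear_ident])
    (auto simp: lin_ext_single[OF pm.vector_space_axioms] words_in_def)

definition \<kappa> where "\<kappa> = (SOME \<kappa>. Vector_Spaces.linear pm_scale pm_scale \<kappa> \<and> (\<forall>x\<in>L m. \<kappa> x = 0) \<and> (\<forall>x. \<kappa> x - x \<in> L m))"

lemma kappa: "Vector_Spaces.linear pm_scale pm_scale \<kappa>" "x \<in> L m \<Longrightarrow> \<kappa> x = 0" "\<kappa> x - x \<in> L m"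
  using someI_ex[OF pm.exists_projection_along[OF subspace_L[of m]]] by (auto simp: \<kappa>_def)

lemmas kappa_simps = linear_simps[OF kappa(1)]

lemma kappa_eq_0: "\<kappa> x = 0 \<Longrightarrow> x \<in> L m"
  using kappa(3)[of x] pm.subspace_neg[OF subspace_L, of "- x" m] by simp

lemma kappa_eqI: "x - y \<in> L m \<Longrightarrow> \<kappa> x = \<kappa> y"
  using kappa(2)[of "x - y"] by (simp add: kappa_simps)

lemma kappa_closed: "p \<in> FX \<Longrightarrow> \<kappa> p \<in> FX"
  using words_in_add[of "\<kappa> p - p" "carrier LA" p] kappa(3)[of p] L_subset by auto

lemma kappa_mult: "g \<in> FX \<Longrightarrow> p \<in> FX \<Longrightarrow> \<kappa> (g * \<kappa> p) = \<kappa> (g * p)"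
  using L_mult[OF kappa(3)[of p], of g] by (intro kappa_eqI) (simp add: algebra_simps)

definition TW where "TW z a x = \<kappa> (gen z a * proj x)"

lemma TW_kappa: "z \<in> \<g> \<Longrightarrow> a \<in> carrier A \<Longrightarrow> p \<in> FX \<Longrightarrow> TW z a (\<kappa> p) = \<kappa> (gen z a * p)"
  unfolding TW_def by (simp add: proj_id kappa_closed kappa_mult)

lemma TW_TW: "z \<in> \<g> \<Longrightarrow> a \<in> carrier A \<Longrightarrow> w \<in> \<g> \<Longrightarrow> b \<in> carrier A \<Longrightarrow>
    TW z a (TW w b x) = \<kappa> (gen z a * (gen w b * proj x))"
  by (subst (2) TW_def) (simp add: TW_kappa words_in_mult)

lemma kappa_UI: "p \<in> UI \<Longrightarrow> q \<in> FX \<Longrightarrow> \<kappa> (p * q) = 0"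
  by (intro kappa(2) UI_L UI_mult_right)

sublocale W: current_rep A B n pm_scale TW
proof (intro current_rep.intro current_algebra_axioms pm.vector_space_axioms current_rep_axioms.intro)
  fix x y :: "complex mat" and a b v and c :: complex
  assume x: "x \<in> \<g>" and a: "a \<in> carrier A"
  show "Vector_Spaces.linear pm_scale pm_scale (TW x a)"
    unfolding TW_def[abs_def] by (rule lin_comp[OF lin_comp[OF linear_proj linear_mult_left] kappa(1)])
  show "TW (c \<cdot>\<^sub>m x) a v = pm_scale c (TW x a v)"
    using kappa_UI[OF gen_relations(3)[OF x a, of c], of "proj v"]
    by (simp add: TW_def left_diff_distrib kappa_simps pm_scale_mult_left)
  show "TW x (c \<odot>\<^bsub>A\<^esub> a) v = pm_scale c (TW x a v)"
    using kappa_UI[OF gen_relations(4)[OF x a, of c], of "proj v"]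
    by (simp add: TW_def left_diff_distrib kappa_simps pm_scale_mult_left)
  show "TW x (a \<oplus>\<^bsub>A\<^esub> b) v = TW x a v + TW x b v" if "b \<in> carrier A"
    using kappa_UI[OF gen_relations(2)[OF x a that], of "proj v"]
    by (simp add: TW_def left_diff_distrib kappa_simps algebra_simps)
  assume y: "y \<in> \<g>"
  show "TW (x + y) a v = TW x a v + TW y a v"
    using kappa_UI[OF gen_relations(1)[OF x y a], of "proj v"]
    by (simp add: TW_def left_diff_distrib kappa_simps algebra_simps)
  assume b: "b \<in> carrier A"
  show "TW x a (TW y b v) - TW y b (TW x a v) = TW (x * y - y * x) (a \<otimes>\<^bsub>A\<^esub> b) v"
    using kappa_UI[OF gen_relations(5)[OF x y a b], of "proj v"] x y a b
    by (simp add: TW_TW) (simp add: TW_def left_diff_distrib kappa_simps algebra_simps)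
qed

text \<open>
  Modulo the relations of the enveloping algebra, the free generator of any tensor is the same
  combination of the generators of pure tensors.
\<close>

lemma free_gen_coset:
  assumes "Poly_Mapping.keys p \<subseteq> pairs"
  shows "free_gen (coset p) - lin_ext pm_scale (\<lambda>(z, a). gen z a) p \<in> UI"
proof -
  let ?g = "\<lambda>p. lin_ext pm_scale (\<lambda>(z, a). gen z a) p"
  note l = linear_simps[OF linear_lin_ext[OF pm.vector_space_axioms]]
  have add: "free_gen (coset (q + r)) - free_gen (coset q) - free_gen (coset r) \<in> UI"
    if "Poly_Mapping.keys q \<subseteq> pairs" "Poly_Mapping.keys r \<subseteq> pairs" for q r
    unfolding LA_add[OF that, symmetric]
    by (rule relation_in_UI, unfold enveloping_relations_def)
      (use LA_coset[OF that(1)] LA_coset[OF that(2)] in blast)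
  have scale: "free_gen (coset (pm_scale c q)) - pm_scale c (free_gen (coset q)) \<in> UI"
    if "Poly_Mapping.keys q \<subseteq> pairs" for c q
    unfolding LA_smult[OF that, symmetric]
    by (rule relation_in_UI, unfold enveloping_relations_def) (use LA_coset[OF that] in blast)
  have "Poly_Mapping.keys p \<subseteq> pairs \<and> free_gen (coset p) - ?g p \<in> UI"
  proof (rule pm_induct[of "\<lambda>p. Poly_Mapping.keys p \<subseteq> pairs \<and> free_gen (coset p) - ?g p \<in> UI" p])
    show "Poly_Mapping.keys 0 \<subseteq> pairs \<and> free_gen (coset 0) - ?g 0 \<in> UI"
      using scale[of 0 0] by (simp add: l pm.scale_zero_left)
    fix k assume "k \<in> Poly_Mapping.keys p"
    then have k: "k \<in> pairs" using assms by auto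
    obtain z a where za: "k = (z, a)" by (cases k)
    have "free_gen (coset (Poly_Mapping.single k 1)) - ?g (Poly_Mapping.single k 1) = 0"
      by (simp add: za lin_ext_single[OF pm.vector_space_axioms] gen_def pure_def)
    then show "Poly_Mapping.keys (Poly_Mapping.single k 1 :: _ \<Rightarrow>\<^sub>0 complex) \<subseteq> pairs \<and>
        free_gen (coset (Poly_Mapping.single k 1)) - ?g (Poly_Mapping.single k 1) \<in> UI"
      using k UI_zero by simp
  next
    fix c q assume q: "Poly_Mapping.keys q \<subseteq> pairs \<and> free_gen (coset q) - ?g q \<in> UI"
    then have "free_gen (coset (pm_scale c q)) - pm_scale c (free_gen (coset q)) + pm_scale c (free_gen (coset q) - ?g q) \<in> UI"
      by (intro UI_add UI_scale scale) auto
    moreover have "Poly_Mapping.keys (pm_scale c q) \<subseteq> pairs" using q keys_pm_scale[of c q] by blast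
    ultimately show "Poly_Mapping.keys (pm_scale c q) \<subseteq> pairs \<and> free_gen (coset (pm_scale c q)) - ?g (pm_scale c q) \<in> UI"
      by (simp add: l pm.scale_right_diff_distrib)
  next
    fix q r assume q: "Poly_Mapping.keys q \<subseteq> pairs \<and> free_gen (coset q) - ?g q \<in> UI"
      and r: "Poly_Mapping.keys r \<subseteq> pairs \<and> free_gen (coset r) - ?g r \<in> UI"
    then have "(free_gen (coset (q + r)) - free_gen (coset q) - free_gen (coset r))
        + (free_gen (coset q) - ?g q) + (free_gen (coset r) - ?g r) \<in> UI"
      by (intro UI_add add) auto
    moreover have "Poly_Mapping.keys (q + r) \<subseteq> pairs" using q r Poly_Mapping.keys_add[of q r] by blast
    ultimately show "Poly_Mapping.keys (q + r) \<subseteq> pairs \<and> free_gen (coset (q + r)) - ?g (q + r) \<in> UI"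
      by (simp add: l algebra_simps)
  qed
  then show ?thesis by simp
qed

lemma tens_kappa:
  assumes "\<tau> \<in> carrier LA" "q \<in> FX"
  shows "W.tens \<tau> (\<kappa> q) = \<kappa> (free_gen \<tau> * q)"
proof -
  obtain p where p: "Poly_Mapping.keys p \<subseteq> pairs" "\<tau> = coset p" using assms(1) by (rule LA_cases)
  have "W.lin_T p (\<kappa> q) = \<kappa> (lin_ext pm_scale (\<lambda>(z, a). gen z a) p * q)"
  proof (rule linear_pm_eq[of pm_scale "\<lambda>p. W.lin_T p (\<kappa> q)" "\<lambda>p. \<kappa> (lin_ext pm_scale (\<lambda>(z, a). gen z a) p * q)" p])
    show "Vector_Spaces.linear pm_scale pm_scale (\<lambda>p. \<kappa> (lin_ext pm_scale (\<lambda>(z, a). gen z a) p * q))"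
      by (rule lin_comp[OF lin_comp[OF linear_lin_ext[OF pm.vector_space_axioms] linear_mult_right] kappa(1)])
    fix k assume k: "k \<in> Poly_Mapping.keys p"
    obtain z a where za: "k = (z, a)" by (cases k)
    then have "z \<in> \<g>" "a \<in> carrier A" using k p(1) by auto
    then show "W.lin_T (Poly_Mapping.single k 1) (\<kappa> q) = \<kappa> (lin_ext pm_scale (\<lambda>(z, a). gen z a) (Poly_Mapping.single k 1) * q)"
      using assms(2) by (simp add: za W.lin_T_single lin_ext_single[OF pm.vector_space_axioms] TW_kappa)
  qed (rule W.linear_lin_T)
  moreover have "\<kappa> ((free_gen (coset p) - lin_ext pm_scale (\<lambda>(z, a). gen z a) p) * q) = 0"
    by (rule kappa_UI[OF free_gen_coset[OF p(1)] assms(2)])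
  ultimately show ?thesis
    by (simp add: p(2) W.tens_coset[OF p(1)] left_diff_distrib kappa_simps)
qed

lemma W_act_kappa: "p \<in> FX \<Longrightarrow> q \<in> FX \<Longrightarrow> W.act p (\<kappa> q) = \<kappa> (p * q)"
  by (induction rule: words_in_induct)
    (simp_all add: W.act_gen_mult tens_kappa words_in_mult mult.assoc W.act_simps kappa_simps pm_scale_mult_left distrib_right)

abbreviation "w0 \<equiv> \<kappa> 1"

lemma W_act_w0: "p \<in> FX \<Longrightarrow> W.act p w0 = \<kappa> p"
  using W_act_kappa[of p 1] by simp

lemma W_hw: "W.hw_vector m w0"
proof -
  have pow: "(TW z a ^^ k) w0 = \<kappa> (gen z a ^ k) \<and> gen z a ^ k \<in> FX" if "z \<in> \<g>" "a \<in> carrier A" for z a k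
    using that by (induction k) (auto simp: TW_kappa)
  have T: "TW z a w0 = \<kappa> (gen z a)" if "z \<in> \<g>" "a \<in> carrier A" for z a
    using TW_kappa[OF that words_in_one] by simp
  have "TW (e_mat n i j) a w0 = 0" if "1 \<le> i" "i < j" "j \<le> n" "a \<in> carrier A" for i j a
    using that T[OF e_mat_g, of i j a] kappa(2)[OF L_relations(1)[OF e_mat_n_plus]] by simp
  moreover have "TW (h_mat n i) \<one>\<^bsub>A\<^esub> w0 = pm_scale (if i = 1 then of_nat m else 0) w0" if i: "i \<in> {1..n - 1}" for i
    using T[OF h_mat_g[OF i], of "\<one>\<^bsub>A\<^esub>"] kappa(2)[OF L_relations(2)[OF h_mat_cartan[OF i], of m]]
    unfolding lam_h_mat[OF i] by (simp only: A_closed kappa_simps right_minus_eq)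
  moreover have "(TW (x_minus n 1) \<one>\<^bsub>A\<^esub> ^^ Suc m) w0 = 0"
  proof -
    have one: "1 \<in> {1..n - 1}" using n2 by auto
    have "lam m (h_mat n 1) = of_nat m" using lam_h_mat[OF one, of m] by simp
    from kappa(2)[OF L_relations(3)[OF one this]] show ?thesis
      using pow[of "x_minus n 1" "\<one>\<^bsub>A\<^esub>" "Suc m", OF x_minus_g A_closed(4)] by simp
  qed
  moreover have "TW (x_minus n i) \<one>\<^bsub>A\<^esub> w0 = 0" if i: "i \<in> {2..n - 1}" for i
  proof -
    have i': "i \<in> {1..n - 1}" using i by auto
    have "lam m (h_mat n i) = of_nat 0" using lam_h_mat[OF i', of m] i by simp
    from kappa(2)[OF L_relations(3)[OF i' this]] show ?thesis
      using T[of "x_minus n i" "\<one>\<^bsub>A\<^esub>", OF x_minus_g A_closed(4)] by simp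
  qed
  ultimately show ?thesis unfolding W.hw_vector_def by blast
qed

lemma W_act_commute:
  assumes "Vector_Spaces.linear pm_scale pm_scale \<delta>"
    and "\<And>z a x. z \<in> \<g> \<Longrightarrow> a \<in> carrier A \<Longrightarrow> \<delta> (TW z a x) = TW z a (\<delta> x)"
    and "p \<in> FX"
  shows "\<delta> (W.act p x) = W.act p (\<delta> x)"
  by (rule intertwining(2)[OF W.current_rep_axioms W.current_rep_axioms assms(1) pm.subspace_UNIV])
    (use assms in auto)

text \<open>
  The endomorphism that takes the generator to \<open>v\<close>. It exists by the universal property when \<open>v\<close> satisfies
  the defining relations.
\<close>

definition endo where "endo v x = W.act (proj x) v"

lemma linear_endo: "Vector_Spaces.linear pm_scale pm_scale (endo v)"
  unfolding endo_def[abs_def] by (rule lin_comp[OF linear_proj W.linear_act])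

lemma endo_kappa:
  assumes "W.hw_vector m v" "p \<in> FX"
  shows "endo v (\<kappa> p) = W.act p v"
  using W.act_L[OF assms(1) kappa(3)[of p]] assms(2)
  by (simp add: endo_def proj_id kappa_closed W.act_simps)

lemma endo_TW:
  assumes "W.hw_vector m v" "z \<in> \<g>" "a \<in> carrier A"
  shows "endo v (TW z a x) = TW z a (endo v x)"
  unfolding TW_def[of z a x] endo_kappa[OF assms(1) words_in_mult[OF gen_closed[OF assms(2,3)] proj_closed]]
  unfolding endo_def gen_def W.act_gen_mult[OF pure_closed[OF assms(2,3)]] W.tens_pure[OF assms(2,3)] ..

text \<open>
  The endomorphism \<open>central a\<close> with \<open>w0 \<mapsto> (h\<^sub>1 \<otimes> a) w0\<close> exists since the image satisfies the defining
  relations. It is the action of the identity matrix times \<open>a\<close>: on \<open>(v\<^sub>1 \<otimes> 1)\<^sup>m\<close>, too, \<open>h\<^sub>1 \<otimes> a\<close> and the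
  identity matrix times \<open>a\<close> have the same effect.
\<close>

definition vh where "vh a = TW (h_mat n 1) a w0"

definition central where "central a = endo (vh a)"

lemma one_index: "1 \<in> {1..n - 1}" using n2 by auto

lemma vh_hw: "a \<in> carrier A \<Longrightarrow> W.hw_vector m (vh a)"
  unfolding vh_def by (rule W.hw_vector_h[OF W_hw])

lemma linear_central: "Vector_Spaces.linear pm_scale pm_scale (central a)"
  unfolding central_def by (rule linear_endo)

lemma central_TW: "b \<in> carrier A \<Longrightarrow> z \<in> \<g> \<Longrightarrow> a \<in> carrier A \<Longrightarrow> central b (TW z a x) = TW z a (central b x)"
  unfolding central_def by (rule endo_TW[OF vh_hw])

lemma central_w0: "a \<in> carrier A \<Longrightarrow> central a w0 = vh a"
  unfolding central_def using endo_kappa[OF vh_hw, of a 1] by simp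

lemma central_add: "a \<in> carrier A \<Longrightarrow> b \<in> carrier A \<Longrightarrow> central (a \<oplus>\<^bsub>A\<^esub> b) x = central a x + central b x"
  unfolding central_def endo_def vh_def
  by (simp add: W.T_add_right[OF h_mat_g[OF one_index]] linear_simps(1)[OF W.act_linear] del: One_nat_def)

lemma central_smult: "a \<in> carrier A \<Longrightarrow> central (k \<odot>\<^bsub>A\<^esub> a) x = pm_scale k (central a x)"
  unfolding central_def endo_def vh_def
  by (simp add: W.T_smult_right[OF h_mat_g[OF one_index]] linear_simps(2)[OF W.act_linear] del: One_nat_def)

text \<open>
  Endomorphisms of a cyclic module are determined by the image of the generator. Both products take it to
  \<open>(h\<^sub>1 \<otimes> a)(h\<^sub>1 \<otimes> b) w0\<close>, where the order is immaterial as \<open>[h\<^sub>1 \<otimes> a, h\<^sub>1 \<otimes> b] = 0\<close>.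
\<close>

lemma central_commute:
  assumes "a \<in> carrier A" "b \<in> carrier A"
  shows "central a (central b x) = central b (central a x)"
proof -
  have cc: "central a (central b x) = W.act (proj x) (central a (vh b))" if "a \<in> carrier A" "b \<in> carrier A" for a b
    unfolding central_def[of b] endo_def
    by (rule W_act_commute[OF linear_central]) (use that central_TW in auto)
  have cv: "central a (vh b) = TW (h_mat n 1) b (TW (h_mat n 1) a w0)" if "a \<in> carrier A" "b \<in> carrier A" for a b
    unfolding vh_def[of b] using that h_mat_g[OF one_index] by (simp add: central_TW central_w0 vh_def)
  have "central a (vh b) = central b (vh a)"
    unfolding cv[OF assms] cv[OF assms(2,1)]
    using W.T_swap[OF h_mat_g[OF one_index] h_mat_g[OF one_index] assms(2,1), of w0] assms
    unfolding bracket_diagonal[OF diagonal_h_mat diagonal_h_mat] by (simp add: W.T_zero)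
  then show ?thesis by (simp add: cc assms)
qed

text \<open>Scalar matrices act through \<^term>\<open>central\<close>, traceless ones as before.\<close>

definition \<rho> where "\<rho> z a x = TW (traceless n z) a x + pm_scale (trace_mat n z / of_nat n) (central a x)"

lemma n0: "0 < n" using n2 by simp

lemma tg: "traceless n z \<in> \<g>" by (rule traceless_g[OF n0])

lemma rho_linear: "a \<in> carrier A \<Longrightarrow> Vector_Spaces.linear pm_scale pm_scale (\<rho> z a)"
  unfolding \<rho>_def[abs_def]
  by (rule lin_plus[OF W.T_linear[OF tg] lin_comp[OF linear_central pm.linear_scale_self]])

lemma rho_add: "x \<in> carrier_mat n n \<Longrightarrow> y \<in> carrier_mat n n \<Longrightarrow> a \<in> carrier A \<Longrightarrow> \<rho> (x + y) a v = \<rho> x a v + \<rho> y a v"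
  unfolding \<rho>_def
  by (simp add: traceless_linear trace_mat_linear W.T_add_left tg add_divide_distrib pm.scale_left_distrib)

lemma rho_smult: "x \<in> carrier_mat n n \<Longrightarrow> a \<in> carrier A \<Longrightarrow> \<rho> (k \<cdot>\<^sub>m x) a v = pm_scale k (\<rho> x a v)"
  unfolding \<rho>_def
  by (simp add: traceless_linear[where y = x] trace_mat_linear[where y = x] W.T_smult_left tg pm.scale_right_distrib)

lemma rho_add_right: "a \<in> carrier A \<Longrightarrow> b \<in> carrier A \<Longrightarrow> \<rho> z (a \<oplus>\<^bsub>A\<^esub> b) v = \<rho> z a v + \<rho> z b v"
  unfolding \<rho>_def by (simp add: W.T_add_right tg central_add pm.scale_right_distrib)

lemma rho_smult_right: "a \<in> carrier A \<Longrightarrow> \<rho> z (k \<odot>\<^bsub>A\<^esub> a) v = pm_scale k (\<rho> z a v)"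
  unfolding \<rho>_def by (simp add: W.T_smult_right tg central_smult pm.scale_right_distrib mult.commute)

lemma rho_traceless: "z \<in> \<g> \<Longrightarrow> \<rho> z a v = TW z a v"
  using traceless_trace_0[OF g_carrier, of z] by (simp add: \<rho>_def sl_simps trace_mat_def pm.scale_zero_left)

lemma rho_commutator:
  assumes "x \<in> carrier_mat n n" "y \<in> carrier_mat n n" "a \<in> carrier A" "b \<in> carrier A"
  shows "\<rho> x a (\<rho> y b v) - \<rho> y b (\<rho> x a v) = \<rho> (x * y - y * x) (a \<otimes>\<^bsub>A\<^esub> b) v"
proof -
  have "\<rho> (x * y - y * x) (a \<otimes>\<^bsub>A\<^esub> b) v = TW (x * y - y * x) (a \<otimes>\<^bsub>A\<^esub> b) v"
    unfolding traceless_bracket[OF assms(1,2), symmetric] by (rule rho_traceless) (rule g_closed(3)[OF tg tg])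
  also have "\<dots> = TW (traceless n x) a (TW (traceless n y) b v) - TW (traceless n y) b (TW (traceless n x) a v)"
    using W.T_commutator[OF tg tg assms(3,4)] by (simp only: traceless_bracket[OF assms(1,2)])
  also have "\<dots> = \<rho> x a (\<rho> y b v) - \<rho> y b (\<rho> x a v)"
  proof -
    note T = linear_simps(1,2)[OF W.T_linear[OF tg]] and C = linear_simps(1,2)[OF linear_central]
    show ?thesis
      unfolding \<rho>_def
      by (simp only: T C assms(3,4) central_TW[OF _ tg] pm.scale_right_distrib pm.scale_scale central_commute[OF assms(3,4)])
        (simp add: mult.commute)
  qed
  finally show ?thesis by simp
qed

definition E where "E i j a = \<rho> (e_mat n (i + 1) (j + 1)) a"

lemma rho_decompose:
  assumes z: "z \<in> carrier_mat n n" and a: "a \<in> carrier A"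
  shows "\<rho> z a v = (\<Sum>i<n. \<Sum>j<n. pm_scale (z $$ (i, j)) (E i j a v))"
proof -
  have zero: "\<rho> (0\<^sub>m n n) a v = 0"
    using rho_smult[of "0\<^sub>m n n" a 0 v] a by (simp add: pm.scale_zero_left smult_zero_mat)
  have "\<rho> (mat n n (\<lambda>k. if k \<in> S then z $$ k else 0)) a v =
      (\<Sum>k\<in>S. pm_scale (z $$ k) (E (fst k) (snd k) a v))" if "finite S" "S \<subseteq> {..<n} \<times> {..<n}" for S
    using that
  proof (induction S)
    case empty
    have "mat n n (\<lambda>k. if k \<in> {} then z $$ k else 0) = 0\<^sub>m n n" by (intro eq_matI) auto
    then show ?case using zero by simp
  next
    case (insert k S)
    obtain i j where k: "k = (i, j)" by (cases k)
    have "mat n n (\<lambda>l. if l \<in> insert k S then z $$ l else 0) =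
        z $$ k \<cdot>\<^sub>m e_mat n (i + 1) (j + 1) + mat n n (\<lambda>l. if l \<in> S then z $$ l else 0)"
      using insert.hyps(2) by (intro eq_matI) (auto simp: k e_mat_def)
    then show ?case
      using insert a by (simp add: rho_add rho_smult E_def k)
  qed
  from this[of "{..<n} \<times> {..<n}"]
  have "\<rho> (mat n n (\<lambda>k. if k \<in> {..<n} \<times> {..<n} then z $$ k else 0)) a v =
      (\<Sum>i<n. \<Sum>j<n. pm_scale (z $$ (i, j)) (E i j a v))"
    by (simp add: sum.cartesian_product case_prod_beta)
  moreover have "mat n n (\<lambda>k. if k \<in> {..<n} \<times> {..<n} then z $$ k else 0) = z"
    using z by (intro eq_matI) auto
  ultimately show ?thesis by simp
qed

text \<open>
  The differences \<open>(e\<^sub>k\<^sub>k - e\<^bsub>k+1,k+1\<^esub>) \<otimes> a\<close> take \<open>w0\<close> to \<open>(h\<^sub>1 \<otimes> a) w0\<close> for \<open>k = 1\<close> and kill it for \<open>k > 1\<close>, so the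
  diagonal matrix units from the second on have the same value \<open>u\<close> on \<open>w0\<close>. The sum of all is the identity
  matrix, with value \<open>(h\<^sub>1 \<otimes> a) w0\<close> by definition. Hence \<open>n u = 0\<close>.
\<close>

lemma E_kills_w0:
  assumes i: "i < n" and j: "0 < j" "j < n" and a: "a \<in> carrier A"
  shows "E i j a w0 = 0" "E 0 0 a w0 = vh a"
proof -
  define u where "u k = E k k a w0" for k
  have step: "u k = u (Suc k) + (if k = 0 then vh a else 0)" if "Suc k < n" for k
  proof -
    have h: "h_mat n (Suc k) \<in> \<g>" using that by (intro h_mat_g) auto
    have "e_mat n (Suc k) (Suc k) = h_mat n (Suc k) + e_mat n (Suc (Suc k)) (Suc (Suc k))"
      by (intro eq_matI) (auto simp: h_mat_def e_mat_def)
    then have "u k = TW (h_mat n (Suc k)) a w0 + u (Suc k)"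
      unfolding u_def E_def using rho_add[OF g_carrier[OF h] e_mat_carrier a] rho_traceless[OF h] by simp
    moreover have "TW (h_mat n (Suc k)) a w0 = (if k = 0 then vh a else 0)"
      using W.hw_kills(1)[OF W_hw _ a, of "Suc k"] that by (auto simp: vh_def)
    ultimately show ?thesis by (simp add: add.commute)
  qed
  have uk: "u k = u 1" if "0 < k" "k < n" for k
    using that
  proof (induction k)
    case (Suc k)
    then show ?case using step[of k] by (cases "k = 0") auto
  qed simp
  have u0: "u 0 = u 1 + vh a" using step[of 0] n2 by simp
  have "{..<n} = insert 0 {0<..<n}" using n0 by auto
  then have "(\<Sum>k<n. u k) = u 0 + (\<Sum>k\<in>{0<..<n}. u k)" by simp
  also have "(\<Sum>k\<in>{0<..<n}. u k) = (\<Sum>k\<in>{0<..<n}. u 1)" by (intro sum.cong refl uk) auto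
  finally have "(\<Sum>k<n. u k) = vh a + (u 1 + of_nat (n - 1) * u 1)"
    using u0 by (simp add: ac_simps)
  also have "u 1 + of_nat (n - 1) * u 1 = of_nat n * u 1"
    using n0 by (metis Suc_diff_1 of_nat_Suc distrib_right mult_1)
  finally have sum: "(\<Sum>k<n. u k) = vh a + of_nat n * u 1" .
  have "(\<Sum>k<n. u k) = \<rho> (1\<^sub>m n) a w0"
    unfolding rho_decompose[OF one_carrier_mat a] u_def
    by (intro sum.cong refl) (simp add: one_mat_def if_distrib if_distribR cong: if_cong)
  also have "\<dots> = vh a"
  proof -
    have tr: "trace_mat n (1\<^sub>m n) = of_nat n" by (simp add: trace_mat_def)
    have "traceless n (1\<^sub>m n) = 0\<^sub>m n n" using n0 by (intro eq_matI) (auto simp: tr traceless_def)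
    then show ?thesis using a n0 by (simp add: \<rho>_def tr W.T_zero central_w0)
  qed
  finally have "of_nat n * u 1 = 0" using sum by simp
  moreover have "of_nat n * u 1 = pm_scale (of_nat n) (u 1)"
    unfolding mult_map_scale_conv_mult by (simp add: single_of_nat)
  ultimately have u1: "u 1 = 0" using n0 by (simp add: pm.scale_eq_0_iff)
  show "E 0 0 a w0 = vh a" using u0 u1 by (simp add: u_def)
  show "E i j a w0 = 0"
  proof (cases "i = j")
    case True
    then show ?thesis using uk[of j] u1 j by (simp add: u_def)
  next
    case False
    have "E i j a w0 = TW (e_mat n (i + 1) (j + 1)) a w0"
      unfolding E_def using False by (intro rho_traceless e_mat_g) simp
    also have "\<dots> = 0"
    proof (cases "i < j")
      case True
      then show ?thesis using W_hw i j a unfolding W.hw_vector_def by auto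
    next
      case False
      with \<open>i \<noteq> j\<close> show ?thesis using i j by (intro W.hw_kills_lower[OF W_hw a]) auto
    qed
    finally show ?thesis .
  qed
qed

sublocale G: gl_module A B pm_scale n m E w0
proof (intro gl_module.intro gl_module_axioms.intro based_algebra_axioms pm.vector_space_axioms n2)
  show "Vector_Spaces.linear pm_scale pm_scale (E i j a)" if "a \<in> carrier A" for i j a
    unfolding E_def by (rule rho_linear[OF that])
  show "E i j (a \<oplus>\<^bsub>A\<^esub> b) v = E i j a v + E i j b v" if "a \<in> carrier A" "b \<in> carrier A" for i j a b v
    unfolding E_def by (rule rho_add_right[OF that])
  show "E i j (k \<odot>\<^bsub>A\<^esub> a) v = pm_scale k (E i j a v)" if "a \<in> carrier A" for i j a k v
    unfolding E_def by (rule rho_smult_right[OF that])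
  show "E i j a w0 = 0" if "i < n" "0 < j" "j < n" "a \<in> carrier A" for i j a
    using E_kills_w0(1)[OF that] .
  show "E 0 0 \<one>\<^bsub>A\<^esub> w0 = pm_scale (of_nat m) w0"
  proof -
    have "TW (h_mat n 1) \<one>\<^bsub>A\<^esub> w0 = pm_scale (if 1 = (1::nat) then of_nat m else 0) w0"
      using W_hw one_index unfolding W.hw_vector_def by blast
    then show ?thesis using E_kills_w0(2)[of 0 1 "\<one>\<^bsub>A\<^esub>"] n2 by (simp add: vh_def)
  qed
  show "(E 1 0 \<one>\<^bsub>A\<^esub> ^^ Suc m) w0 = 0"
  proof -
    have "E 1 0 \<one>\<^bsub>A\<^esub> = TW (x_minus n 1) \<one>\<^bsub>A\<^esub>"
      using rho_traceless[OF x_minus_g[of 1]] by (auto simp: E_def x_minus_def fun_eq_iff)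
    then show ?thesis using W_hw by (simp add: W.hw_vector_def)
  qed
  fix i j k l a b v
  assume ijkl: "i < n" "j < n" "k < n" "l < n" and ab: "a \<in> carrier A" "b \<in> carrier A"
  have minus: "\<rho> (x - y) d v = \<rho> x d v - \<rho> y d v"
    if "x \<in> carrier_mat n n" "y \<in> carrier_mat n n" "d \<in> carrier A" for x y d
  proof -
    have "x - y = x + (-1) \<cdot>\<^sub>m y" using that by (intro eq_matI) auto
    then show ?thesis using that by (simp add: rho_add rho_smult pm.scale_minus_left)
  qed
  have zero: "\<rho> (0\<^sub>m n n) d v = 0" if "d \<in> carrier A" for d
    using minus[of "0\<^sub>m n n" "0\<^sub>m n n" d] that by (simp add: minus_r_inv_mat[OF zero_carrier_mat])
  have ab': "a \<otimes>\<^bsub>A\<^esub> b \<in> carrier A" "b \<otimes>\<^bsub>A\<^esub> a = a \<otimes>\<^bsub>A\<^esub> b" using ab by (auto simp: A.m_comm)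
  have "E i j a (E k l b v) - E k l b (E i j a v) =
      \<rho> (e_mat n (i + 1) (j + 1) * e_mat n (k + 1) (l + 1)) (a \<otimes>\<^bsub>A\<^esub> b) v
      - \<rho> (e_mat n (k + 1) (l + 1) * e_mat n (i + 1) (j + 1)) (a \<otimes>\<^bsub>A\<^esub> b) v"
    unfolding E_def rho_commutator[OF e_mat_carrier e_mat_carrier ab]
    by (intro minus mult_carrier_mat[OF e_mat_carrier e_mat_carrier] ab')
  also have "\<dots> = (if j = k then E i l (a \<otimes>\<^bsub>A\<^esub> b) v else 0) - (if l = i then E k j (b \<otimes>\<^bsub>A\<^esub> a) v else 0)"
    using ijkl ab' by (simp add: e_mat_mult E_def zero)
  finally show "E i j a (E k l b v) - E k l b (E i j a v) =
      (if j = k then E i l (a \<otimes>\<^bsub>A\<^esub> b) v else 0) - (if l = i then E k j (b \<otimes>\<^bsub>A\<^esub> a) v else 0)" .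
qed

end



section \<open>The Weyl module as a symmetric power\<close>

definition supported :: "'x set \<Rightarrow> 'x mpoly \<Rightarrow> bool"
  where "supported X p \<longleftrightarrow> (\<forall>\<mu>\<in>Poly_Mapping.keys p. set_mset \<mu> \<subseteq> X)"

lemma supported_simps [simp]: "supported X 0" "supported X (monomial \<mu>) \<longleftrightarrow> set_mset \<mu> \<subseteq> X"
  by (auto simp: supported_def)

lemma supported_add: "supported X p \<Longrightarrow> supported X q \<Longrightarrow> supported X (p + q)"
  using Poly_Mapping.keys_add[of p q] unfolding supported_def by blast

lemma supported_scale: "supported X p \<Longrightarrow> supported X (pm_scale c p)"
  by (auto simp: supported_def in_keys_iff)

lemma supported_sum: "(\<And>i. i \<in> S \<Longrightarrow> supported X (f i)) \<Longrightarrow> supported X (sum f S)"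
  by (induction S rule: infinite_finite_induct) (auto intro: supported_add)

lemma supported_mult: "supported X p \<Longrightarrow> supported X q \<Longrightarrow> supported X (p * q)"
  using keys_mult[of p q] by (fastforce simp: supported_def)

lemma supported_one [simp]: "supported X 1"
  by (metis supported_simps(2) monomial_empty set_mset_empty empty_subsetI)

lemma supported_power: "supported X p \<Longrightarrow> supported X (p ^ k)"
  by (induction k) (auto intro: supported_mult)

lemma supported_derivation:
  assumes d: "derivation \<delta>" and var: "\<And>x. x \<in> X \<Longrightarrow> supported X (\<delta> (var x))" and p: "supported X p"
  shows "supported X (\<delta> p)"
proof -
  have mono: "supported X (\<delta> (monomial \<mu>))" if "set_mset \<mu> \<subseteq> X" for \<mu>
    using that
  proof (induction \<mu>)
    case empty
    then show ?case by (simp add: derivation_one[OF d])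
  next
    case (add x \<mu>)
    then show ?case
      unfolding monomial_add_mset[of x \<mu>] derivation_mult[OF d]
      by (intro supported_add supported_mult) (auto intro: var)
  qed
  show ?thesis
    by (rule pm_induct[of "\<lambda>p. supported X (\<delta> p)" p])
      (use p mono in \<open>auto simp: linear_simps[OF derivation_linear[OF d]] supported_def[of X p]
        intro: supported_add supported_scale\<close>)
qed

lemma derivation_power_0: "derivation \<delta> \<Longrightarrow> \<delta> x = 0 \<Longrightarrow> \<delta> (x ^ k) = 0"
  by (induction k) (auto simp: derivation_one derivation_mult)

lemma derivation_nilpotent:
  assumes d: "derivation \<delta>" and y: "\<delta> (\<delta> x) = 0"
  shows "(\<delta> ^^ Suc k) (x ^ k) = 0"
proof (induction k)
  case 0
  then show ?case by (simp add: derivation_one[OF d])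
next
  case (Suc k)
  note l = linear_simps[OF derivation_linear[OF d]]
  have swap: "(\<delta> ^^ j) (pm_scale a (p * \<delta> x)) = pm_scale a ((\<delta> ^^ j) p * \<delta> x)" for j a p
    by (induction j) (simp_all add: l derivation_mult[OF d] y)
  have "(\<delta> ^^ Suc (Suc k)) (x ^ Suc k) = (\<delta> ^^ Suc k) (\<delta> (x ^ Suc k))"
    by (simp only: funpow_Suc_right comp_apply)
  also have "\<dots> = (\<delta> ^^ Suc k) (pm_scale (of_nat (Suc k)) (x ^ k * \<delta> x))"
    unfolding derivation_power[OF d] of_nat_mult_pm ..
  also have "\<dots> = 0" unfolding swap Suc by simp
  finally show ?case .
qed

context based_algebra
begin

lemma supported_lin: "a \<in> carrier A \<Longrightarrow> i < n \<Longrightarrow> supported ({..<n} \<times> B) (lin i a)"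
  by (induction rule: carrier_induct) (auto simp: lin_simps intro: supported_add supported_scale)

end

context weyl_type
begin

definition TP :: "complex mat \<Rightarrow> 'a \<Rightarrow> (nat \<times> 'a) mpoly \<Rightarrow> (nat \<times> 'a) mpoly"
  where "TP z a p = (\<Sum>i<n. \<Sum>j<n. pm_scale (z $$ (i, j)) (Der i j a p))"

lemma derivation_TP: "derivation (TP z a)"
  unfolding TP_def[abs_def] by (intro derivation_sum derivation_scale derivation_Der)

lemmas TP_simps = derivation_simps[OF derivation_TP]

lemma TP_lin:
  assumes "a \<in> carrier A" "b \<in> carrier A" "k < n"
  shows "TP z a (lin k b) = (\<Sum>i<n. pm_scale (z $$ (i, k)) (lin i (a \<otimes>\<^bsub>A\<^esub> b)))"
  unfolding TP_def
proof (intro sum.cong refl)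
  fix i
  have "(\<Sum>j<n. pm_scale (z $$ (i, j)) (Der i j a (lin k b))) =
      (\<Sum>j<n. if j = k then pm_scale (z $$ (i, k)) (lin i (a \<otimes>\<^bsub>A\<^esub> b)) else 0)"
    using assms by (intro sum.cong) (auto simp: Der_lin)
  then show "(\<Sum>j<n. pm_scale (z $$ (i, j)) (Der i j a (lin k b))) = pm_scale (z $$ (i, k)) (lin i (a \<otimes>\<^bsub>A\<^esub> b))"
    using assms by simp
qed

lemma TP_invalid_letter: "\<not> (k < n \<and> b \<in> B) \<Longrightarrow> TP z a (var (k, b)) = 0"
  unfolding TP_def by (intro sum.neutral ballI) (auto simp: Der_var)

lemma TP_commutator:
  assumes "x \<in> carrier_mat n n" "y \<in> carrier_mat n n" "a \<in> carrier A" "b \<in> carrier A"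
  shows "TP x a (TP y b p) - TP y b (TP x a p) = TP (x * y - y * x) (a \<otimes>\<^bsub>A\<^esub> b) p"
proof (rule derivation_eqI[OF derivation_commutator[OF derivation_TP derivation_TP] derivation_TP])
  fix v :: "nat \<times> 'a"
  obtain k c where v: "v = (k, c)" by (cases v)
  show "TP x a (TP y b (var v)) - TP y b (TP x a (var v)) = TP (x * y - y * x) (a \<otimes>\<^bsub>A\<^esub> b) (var v)"
  proof (cases "k < n \<and> c \<in> B")
    case True
    then have k: "k < n" and c: "c \<in> carrier A" and l: "var v = lin k c" by (auto simp: v lin_simps)
    have two: "TP x a (TP y b (lin k c)) = (\<Sum>l<n. pm_scale ((x * y) $$ (l, k)) (lin l ((a \<otimes>\<^bsub>A\<^esub> b) \<otimes>\<^bsub>A\<^esub> c)))"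
      if "x \<in> carrier_mat n n" "y \<in> carrier_mat n n" "a \<in> carrier A" "b \<in> carrier A" for x y a b
    proof -
      have "TP x a (TP y b (lin k c)) = (\<Sum>i<n. pm_scale (y $$ (i, k)) (\<Sum>l<n. pm_scale (x $$ (l, i)) (lin l (a \<otimes>\<^bsub>A\<^esub> (b \<otimes>\<^bsub>A\<^esub> c)))))"
        using that c k by (simp add: TP_lin TP_simps)
      also have "\<dots> = (\<Sum>l<n. \<Sum>i<n. pm_scale (x $$ (l, i) * y $$ (i, k)) (lin l (a \<otimes>\<^bsub>A\<^esub> (b \<otimes>\<^bsub>A\<^esub> c))))"
        unfolding pm.scale_sum_right pm.scale_scale by (subst sum.swap) (simp add: mult.commute)
      also have "\<dots> = (\<Sum>l<n. pm_scale ((x * y) $$ (l, k)) (lin l (a \<otimes>\<^bsub>A\<^esub> (b \<otimes>\<^bsub>A\<^esub> c))))"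
        unfolding pm.scale_sum_left[symmetric] using that k
        by (intro sum.cong) (simp_all add: scalar_prod_def atLeast0LessThan)
      finally show ?thesis using that c by (simp add: A.m_assoc)
    qed
    show ?thesis
      unfolding l two[OF assms] two[OF assms(2,1,4,3)]
      using assms c k
      by (simp add: TP_lin A.m_comm[of b a] pm.scale_left_diff_distrib sum_subtractf del: index_mult_mat(1))
  next
    case False
    then show ?thesis by (simp add: v TP_invalid_letter TP_simps)
  qed
qed

sublocale V: current_rep A B n pm_scale TP
proof (intro current_rep.intro current_algebra_axioms pm.vector_space_axioms current_rep_axioms.intro)
  show "TP (x + y) a v = TP x a v + TP y a v" if "x \<in> \<g>" "y \<in> \<g>" for x y a v
    using that[THEN g_carrier] unfolding TP_def sum.distrib[symmetric]
    by (intro sum.cong refl) (simp add: pm.scale_left_distrib)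
  show "TP (c \<cdot>\<^sub>m x) a v = pm_scale c (TP x a v)" if "x \<in> \<g>" for x a v c
    using g_carrier[OF that] unfolding TP_def pm.scale_sum_right
    by (intro sum.cong refl) simp
  show "TP x a (TP y b v) - TP y b (TP x a v) = TP (x * y - y * x) (a \<otimes>\<^bsub>A\<^esub> b) v"
    if "x \<in> \<g>" "y \<in> \<g>" "a \<in> carrier A" "b \<in> carrier A" for x y a b v
    using that by (intro TP_commutator g_carrier)
  show "Vector_Spaces.linear pm_scale pm_scale (TP z a)" for z a
    by (rule derivation_linear[OF derivation_TP])
qed (auto simp: TP_def Der_add Der_smult pm.scale_right_distrib sum.distrib pm.scale_sum_right mult.commute)

abbreviation "v0 \<equiv> lin 0 \<one>\<^bsub>A\<^esub> ^ m"

lemma e_mat_index: "r < n \<Longrightarrow> s < n \<Longrightarrow> e_mat n i j $$ (r, s) = (if Suc r = i \<and> Suc s = j then 1 else 0)"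
  by (simp add: e_mat_def)

lemma TP_e_mat:
  assumes "1 \<le> i" "i \<le> n" "k < n" "a \<in> carrier A" "b \<in> carrier A"
  shows "TP (e_mat n i j) a (lin k b) = (if Suc k = j then lin (i - 1) (a \<otimes>\<^bsub>A\<^esub> b) else 0)"
proof -
  have "TP (e_mat n i j) a (lin k b) = (\<Sum>r<n. if r = i - 1 then (if Suc k = j then lin (i - 1) (a \<otimes>\<^bsub>A\<^esub> b) else 0) else 0)"
    unfolding TP_lin[OF assms(4,5,3)] using assms
    by (intro sum.cong) (auto simp: e_mat_index pm.scale_zero_left)
  also have "\<dots> = (if Suc k = j then lin (i - 1) (a \<otimes>\<^bsub>A\<^esub> b) else 0)"
    using assms by (subst sum.delta) auto
  finally show ?thesis .
qed

lemma TP_h_mat: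
  assumes "i \<in> {1..n - 1}" "k < n" "a \<in> carrier A" "b \<in> carrier A"
  shows "TP (h_mat n i) a (lin k b) = (if k = i - 1 then lin k (a \<otimes>\<^bsub>A\<^esub> b) else if k = i then - lin k (a \<otimes>\<^bsub>A\<^esub> b) else 0)"
proof -
  have "TP (h_mat n i) a (lin k b) = (\<Sum>r<n. if r = k then
      (if k = i - 1 then lin k (a \<otimes>\<^bsub>A\<^esub> b) else if k = i then - lin k (a \<otimes>\<^bsub>A\<^esub> b) else 0) else 0)"
    unfolding TP_lin[OF assms(3,4,2)] using assms
    by (intro sum.cong) (auto simp: h_mat_index pm.scale_zero_left pm.scale_minus_left)
  also have "\<dots> = (if k = i - 1 then lin k (a \<otimes>\<^bsub>A\<^esub> b) else if k = i then - lin k (a \<otimes>\<^bsub>A\<^esub> b) else 0)"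
    using assms by (subst sum.delta) auto
  finally show ?thesis .
qed

lemma V_hw: "V.hw_vector m v0"
proof -
  have "TP (e_mat n i j) a v0 = 0" if "1 \<le> i" "i < j" "j \<le> n" "a \<in> carrier A" for i j a
    using that n0 by (intro derivation_power_0[OF derivation_TP]) (auto simp: TP_e_mat)
  moreover have "TP (x_minus n i) \<one>\<^bsub>A\<^esub> v0 = 0" if i: "i \<in> {2..n - 1}" for i
    using i n0 unfolding x_minus_def by (intro derivation_power_0[OF derivation_TP]) (auto simp: TP_e_mat)
  moreover have "(TP (x_minus n 1) \<one>\<^bsub>A\<^esub> ^^ Suc m) v0 = 0"
    unfolding x_minus_def
    by (rule derivation_nilpotent[OF derivation_TP]) (use n2 n0 in \<open>simp add: TP_e_mat\<close>)
  moreover have "TP (h_mat n i) \<one>\<^bsub>A\<^esub> v0 = pm_scale (if i = 1 then of_nat m else 0) v0" if i: "i \<in> {1..n - 1}" for i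
  proof (cases "i = 1")
    case True
    have x: "TP (h_mat n i) \<one>\<^bsub>A\<^esub> (lin 0 \<one>\<^bsub>A\<^esub>) = lin 0 \<one>\<^bsub>A\<^esub>"
      using TP_h_mat[OF i n0, of "\<one>\<^bsub>A\<^esub>" "\<one>\<^bsub>A\<^esub>"] True by simp
    show ?thesis
    proof (cases m)
      case 0
      then show ?thesis using derivation_one[OF derivation_TP] True by (simp add: pm.scale_zero_left)
    next
      case (Suc l)
      have "TP (h_mat n i) \<one>\<^bsub>A\<^esub> v0 = pm_scale (of_nat (Suc l)) (lin 0 \<one>\<^bsub>A\<^esub> ^ l * lin 0 \<one>\<^bsub>A\<^esub>)"
        unfolding Suc derivation_power[OF derivation_TP] of_nat_mult_pm x ..
      then show ?thesis using True Suc by (simp add: mult.commute)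
    qed
  next
    case False
    then have "TP (h_mat n i) \<one>\<^bsub>A\<^esub> (lin 0 \<one>\<^bsub>A\<^esub>) = 0"
      using TP_h_mat[OF i n0, of "\<one>\<^bsub>A\<^esub>" "\<one>\<^bsub>A\<^esub>"] i by auto
    then show ?thesis using False derivation_power_0[OF derivation_TP] by (simp add: pm.scale_zero_left)
  qed
  ultimately show ?thesis unfolding V.hw_vector_def by blast
qed

abbreviation "Psi \<equiv> G.S.symm_map"

lemma homogeneous_v0: "homogeneous m v0"
  using homogeneous_power[OF homogeneous_lin, of m 0 "\<one>\<^bsub>A\<^esub>"] by simp

lemma TW_Psi:
  assumes "z \<in> \<g>" "a \<in> carrier A" "homogeneous m p"
  shows "Psi (TP z a p) = TW z a (Psi p)"
proof -
  have "TW z a (Psi p) = (\<Sum>i<n. \<Sum>j<n. pm_scale (z $$ (i, j)) (E i j a (Psi p)))"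
    using rho_traceless[OF assms(1)] rho_decompose[OF g_carrier[OF assms(1)] assms(2)] by simp
  then show ?thesis
    unfolding TP_def G.Psi_simps using assms by (simp add: G.E_Psi)
qed

text \<open>
  Both sides are the images of \<open>p\<close> acting on \<open>m! w0 = \<Psi>(v0)\<close>.
\<close>

lemma kappa_eq_Psi:
  assumes "p \<in> FX"
  shows "pm_scale (fact m) (\<kappa> p) = Psi (V.act p v0)"
proof -
  have "Psi (V.act p v0) = W.act p (Psi v0)"
  proof (rule intertwining(2)[OF V.current_rep_axioms W.current_rep_axioms G.linear_Psi, of "{p. homogeneous m p}"])
    show "pm.subspace {p :: (nat \<times> 'a) mpoly. homogeneous m p}"
      by (intro pm.subspaceI) (auto intro: homogeneous_add homogeneous_scale)
    show "TP z a x \<in> {p. homogeneous m p}" if "x \<in> {p. homogeneous m p}" for z a x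
      using that unfolding TP_def mem_Collect_eq by (intro homogeneous_sum homogeneous_scale homogeneous_Der)
  qed (use assms homogeneous_v0 TW_Psi in auto)
  also have "\<dots> = pm_scale (fact m) (\<kappa> p)"
    unfolding G.Psi_lin_one_power_m by (simp add: linear_simps(2)[OF W.act_linear[OF assms]] W_act_w0 assms)
  finally show ?thesis by simp
qed

text \<open>
  The Weyl module maps to the polynomials by the universal property, and \<open>\<Psi>\<close> maps back, up to the factor
  \<open>m!\<close>. So the map to the polynomials is injective.
\<close>

theorem L_iff: "p \<in> FX \<Longrightarrow> p \<in> L m \<longleftrightarrow> V.act p v0 = 0"
  using V.act_L[OF V_hw] kappa_eq_Psi[of p] kappa_eq_0[of p]
  by (auto simp: G.Psi_simps pm.scale_eq_0_iff)

lemma V_act_supported: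
  assumes "p \<in> FX"
  shows "homogeneous m (V.act p v0) \<and> supported ({..<n} \<times> B) (V.act p v0)"
proof -
  let ?S = "{p. homogeneous m p \<and> supported ({..<n} \<times> B) p}"
  have "V.act p v0 \<in> ?S"
  proof (rule intertwining(1)[OF V.current_rep_axioms V.current_rep_axioms pm.linear_ident, of ?S])
    show "pm.subspace ?S"
      by (intro pm.subspaceI) (auto intro: homogeneous_add homogeneous_scale supported_add supported_scale)
    show "TP z a x \<in> ?S" if za: "z \<in> \<g>" "a \<in> carrier A" and x: "x \<in> ?S" for z a x
    proof -
      have var: "supported ({..<n} \<times> B) (TP z a (var v))" if "v \<in> {..<n} \<times> B" for v
      proof -
        obtain k b where v: "v = (k, b)" by (cases v)
        then have "var v = lin k b" "k < n" "b \<in> carrier A" using that by (auto simp: lin_simps)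
        then show ?thesis
          using za by (auto simp: TP_lin intro!: supported_sum supported_scale supported_lin)
      qed
      have "supported ({..<n} \<times> B) (TP z a x)"
        by (rule supported_derivation[OF derivation_TP var]) (use x in auto)
      moreover have "homogeneous m (TP z a x)"
        using x unfolding TP_def by (intro homogeneous_sum homogeneous_scale homogeneous_Der) auto
      ultimately show ?thesis by simp
    qed
  qed (use assms homogeneous_v0 n0 in \<open>auto intro!: supported_power supported_lin\<close>)
  then show ?thesis by simp
qed

section \<open>The action of the elements \<open>q\<^sub>i\<close>\<close>

definition actU :: "'a U_elem \<Rightarrow> (nat \<times> 'a) mpoly \<Rightarrow> (nat \<times> 'a) mpoly"
  where "actU Y = V.act (SOME p. p \<in> FX \<and> Y = ucls p)"

lemma actU_ucls: "p \<in> FX \<Longrightarrow> actU (ucls p) f = V.act p f"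
proof -
  assume p: "p \<in> FX"
  define q where "q = (SOME q. q \<in> FX \<and> ucls p = ucls q)"
  have q: "q \<in> FX \<and> ucls p = ucls q"
    unfolding q_def by (rule someI_ex) (use p in auto)
  then have "p \<in> ucls q" using mem_ucls[OF p, of p] p UI_zero by auto
  then have "p - q \<in> UI" using mem_ucls q by blast
  then show ?thesis
    using V.act_UI[of "p - q" f] by (simp add: actU_def q_def[symmetric] V.act_simps)
qed

lemma actU_simps:
  "actU \<one>\<^bsub>U\<^esub> f = f"
  "Y \<in> carrier U \<Longrightarrow> Z \<in> carrier U \<Longrightarrow> actU (Y \<otimes>\<^bsub>U\<^esub> Z) f = actU Y (actU Z f)"
  "Y \<in> carrier U \<Longrightarrow> Z \<in> carrier U \<Longrightarrow> actU (Y \<oplus>\<^bsub>U\<^esub> Z) f = actU Y f + actU Z f"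
  "Y \<in> carrier U \<Longrightarrow> actU (c \<odot>\<^bsub>U\<^esub> Y) f = pm_scale c (actU Y f)"
  "actU \<zero>\<^bsub>U\<^esub> f = 0"
  by (auto elim!: U_cases simp: U_simps actU_ucls V.act_simps V.act_mult words_in_mult words_in_add words_in_scale)

lemma U_mult_closed: "Y \<in> carrier U \<Longrightarrow> Z \<in> carrier U \<Longrightarrow> Y \<otimes>\<^bsub>U\<^esub> Z \<in> carrier U"
  by (auto elim!: U_cases simp: U_simps(6)) (auto simp: U_simps(1))

lemma U_one_closed: "\<one>\<^bsub>U\<^esub> \<in> carrier U"
  unfolding U_simps(1,5) by blast

lemma U_smult_closed: "Y \<in> carrier U \<Longrightarrow> c \<odot>\<^bsub>U\<^esub> Y \<in> carrier U"
  by (auto elim!: U_cases simp: U_simps(3)) (auto simp: U_simps(1))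

lemma U_tensor_closed: "z \<in> \<g> \<Longrightarrow> a \<in> carrier A \<Longrightarrow> U_tensor n A z a \<in> carrier U"
  unfolding U_tensor_eq U_simps(1) by blast

lemma actU_tensor: "z \<in> \<g> \<Longrightarrow> a \<in> carrier A \<Longrightarrow> actU (U_tensor n A z a) f = TP z a f"
  unfolding U_tensor_eq by (simp add: actU_ucls) (simp add: gen_def V.act_gen V.tens_pure)

lemma U_finsum:
  assumes "finite S" "\<And>s. s \<in> S \<Longrightarrow> g s \<in> carrier U"
  shows "finsum U g S \<in> carrier U" "actU (finsum U g S) f = (\<Sum>s\<in>S. actU (g s) f)"
proof -
  interpret U: Module.module "class_ring :: complex ring" U by (rule module_U)
  show cl: "finsum U g S \<in> carrier U" using assms by (intro U.M.finsum_closed) auto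
  have g: "g \<in> S \<rightarrow> carrier U" using assms by auto
  show "actU (finsum U g S) f = (\<Sum>s\<in>S. actU (g s) f)"
    using assms(1) g
  proof (induction S rule: finite_induct)
    case (insert x F)
    then have "g \<in> F \<rightarrow> carrier U" "g x \<in> carrier U" by auto
    with insert show ?case by (simp add: U.M.finsum_insert actU_simps U.M.finsum_closed)
  qed (simp add: actU_simps)
qed

lemma set_mset_diff_subset: "set_mset \<chi> \<subseteq> S \<Longrightarrow> set_mset (\<chi> - \<psi>) \<subseteq> S"
  by (auto dest: in_diffD)

lemma q_elem_closed:
  assumes i: "i \<in> {1..n - 1}"
  shows "set_mset \<phi> \<subseteq> carrier A \<Longrightarrow> set_mset \<chi> \<subseteq> carrier A \<Longrightarrow> q_elem n A i \<phi> \<chi> \<in> carrier U"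
proof (induction "size \<phi> + size \<chi>" arbitrary: \<phi> \<chi> rule: less_induct)
  case less
  have pi: "mset_prod A \<psi> \<in> carrier A" if "\<psi> \<subseteq># \<chi>" for \<psi>
    using that less.prems(2) by (meson mset_prod_closed order_trans set_mset_mono)
  have fin: "finite {\<psi>. \<psi> \<noteq> {#} \<and> \<psi> \<subseteq># \<chi>}"
    by (rule finite_subset[OF _ finite_subset_mset[of \<chi>]]) auto
  have size: "size (\<chi> - \<psi>) < size \<chi>" if "\<psi> \<noteq> {#}" "\<psi> \<subseteq># \<chi>" for \<psi>
    using size_Diff_submset[OF that(2)] size_mset_mono[OF that(2)] that(1) nonempty_has_size[of \<psi>] by linarith
  show ?case
  proof (cases "\<phi> = {#}")
    case True
    show ?thesis
      unfolding q_elem.simps[of n A i \<phi>] using True pi size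
      by (auto simp: U_one_closed intro!: U_smult_closed U_finsum(1) fin U_mult_closed U_tensor_closed h_mat_g[OF i]
          less.hyps set_mset_diff_subset less.prems(2))
  next
    case False
    show ?thesis
      unfolding q_elem.simps[of n A i \<phi>] using False pi less.prems
      by (auto intro!: U_smult_closed U_finsum(1) finite_subset_mset U_mult_closed U_tensor_closed x_minus_g
          less.hyps set_mset_diff_subset simp: size_Diff_submset nonempty_has_size size_mset_mono size_Diff_singleton
          intro!: add_less_le_mono)
  qed
qed

text \<open>
  Here \<open>R\<close> will be a product of letters \<open>v\<^sub>j \<otimes> c\<close> with \<open>j < i\<close>, which \<open>h\<^sub>i\<close> and \<open>x\<^sub>-\<^sub>i\<close> kill.
\<close>

lemma act_q_elem:
  assumes i: "i \<in> {1..n - 1}"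
    and R: "\<And>b. b \<in> carrier A \<Longrightarrow> TP (h_mat n i) b R = 0" "\<And>b. b \<in> carrier A \<Longrightarrow> TP (x_minus n i) b R = 0"
    and car: "set_mset \<phi> \<subseteq> carrier A" "set_mset \<chi> \<subseteq> carrier A" "size \<phi> + size \<chi> \<le> r"
  shows "actU (q_elem n A i \<phi> \<chi>) (divpow (lin (i - 1) \<one>\<^bsub>A\<^esub>) r * R) = pm_scale ((- 1) ^ (size \<phi> + size \<chi>))
      (divpow (lin (i - 1) \<one>\<^bsub>A\<^esub>) (r - size \<phi> - size \<chi>) * divpow_mset (lin (i - 1)) \<chi> * (divpow_mset (lin i) \<phi> * R))"
proof (rule q_recursion_solution[where Q = "\<lambda>\<phi> \<chi>. actU (q_elem n A i \<phi> \<chi>)" and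
      h = "TP (h_mat n i)" and e = "TP (x_minus n i)" and X = "lin (i - 1)" and Y = "lin i"])
  have i': "i < n" "i - 1 < n" "Suc (i - 1) = i" "i + 1 \<le> n" "i \<ge> 1" using i by auto
  show "TP (h_mat n i) b (lin (i - 1) c) = lin (i - 1) (b \<otimes>\<^bsub>A\<^esub> c)" if "b \<in> carrier A" "c \<in> carrier A" for b c
    using TP_h_mat[OF i i'(2) that] by simp
  show "TP (x_minus n i) b (lin (i - 1) c) = lin i (b \<otimes>\<^bsub>A\<^esub> c)" if "b \<in> carrier A" "c \<in> carrier A" for b c
    unfolding x_minus_def using TP_e_mat[of "i + 1" "i - 1" b c i] i' that by simp
  show "TP (x_minus n i) b (lin i c) = 0" if "b \<in> carrier A" "c \<in> carrier A" for b c
    unfolding x_minus_def using TP_e_mat[of "i + 1" i b c i] i' that by simp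
  show "actU (q_elem n A i {#} {#}) p = p" for p
    by (subst q_elem.simps) (simp add: actU_simps)
  have pi: "mset_prod A \<psi> \<in> carrier A" if "\<psi> \<subseteq># \<chi>" "set_mset \<chi> \<subseteq> carrier A" for \<psi> \<chi>
    using that by (meson mset_prod_closed order_trans set_mset_mono)
  note cl = U_smult_closed U_mult_closed U_tensor_closed h_mat_g[OF i] x_minus_g q_elem_closed[OF i] set_mset_diff_subset
  show "actU (q_elem n A i {#} \<chi>) p = pm_scale (- 1 / of_nat (size \<chi>))
      (\<Sum>\<psi> | \<psi> \<noteq> {#} \<and> \<psi> \<subseteq># \<chi>. pm_scale (multinom \<psi>) (TP (h_mat n i) (mset_prod A \<psi>) (actU (q_elem n A i {#} (\<chi> - \<psi>)) p)))"
    if \<chi>: "set_mset \<chi> \<subseteq> carrier A" "\<chi> \<noteq> {#}" for \<chi> p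
  proof -
    let ?S = "{\<psi>. \<psi> \<noteq> {#} \<and> \<psi> \<subseteq># \<chi>}"
    let ?g = "\<lambda>\<psi>. (multinom \<psi> \<odot>\<^bsub>U\<^esub> U_tensor n A (h_mat n i) (mset_prod A \<psi>)) \<otimes>\<^bsub>U\<^esub> q_elem n A i {#} (\<chi> - \<psi>)"
    have fin: "finite ?S" by (rule finite_subset[OF _ finite_subset_mset[of \<chi>]]) auto
    have g: "?g \<psi> \<in> carrier U" if "\<psi> \<in> ?S" for \<psi>
      using that \<chi> by (intro cl) (auto simp: pi)
    have "actU (q_elem n A i {#} \<chi>) p = pm_scale (- 1 / of_nat (size \<chi>)) (\<Sum>\<psi>\<in>?S. actU (?g \<psi>) p)"
      unfolding q_elem.simps[of n A i "{#}" \<chi>] using \<chi>(2) U_finsum[of ?S ?g, OF fin g] by (simp add: actU_simps del: times_divide_eq_left)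
    also have "(\<Sum>\<psi>\<in>?S. actU (?g \<psi>) p) = (\<Sum>\<psi>\<in>?S. pm_scale (multinom \<psi>) (TP (h_mat n i) (mset_prod A \<psi>) (actU (q_elem n A i {#} (\<chi> - \<psi>)) p)))"
    proof (intro sum.cong refl)
      fix \<psi> assume "\<psi> \<in> ?S"
      then have "mset_prod A \<psi> \<in> carrier A" using pi \<chi> by auto
      then show "actU (?g \<psi>) p = pm_scale (multinom \<psi>) (TP (h_mat n i) (mset_prod A \<psi>) (actU (q_elem n A i {#} (\<chi> - \<psi>)) p))"
        using \<chi> by (simp add: actU_simps cl actU_tensor)
    qed
    finally show ?thesis .
  qed
  show "actU (q_elem n A i \<phi> \<chi>) p = pm_scale (- 1 / of_nat (size \<phi>))
      (\<Sum>\<psi> | \<psi> \<subseteq># \<chi>. \<Sum>d\<in>set_mset \<phi>. pm_scale (multinom \<psi>)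
        (TP (x_minus n i) (d \<otimes>\<^bsub>A\<^esub> mset_prod A \<psi>) (actU (q_elem n A i (\<phi> - {#d#}) (\<chi> - \<psi>)) p)))"
    if \<phi>: "set_mset \<phi> \<subseteq> carrier A" and \<chi>: "set_mset \<chi> \<subseteq> carrier A" and ne: "\<phi> \<noteq> {#}" for \<phi> \<chi> p
  proof -
    let ?S = "{\<psi>. \<psi> \<subseteq># \<chi>}"
    let ?g = "\<lambda>\<psi> d. (multinom \<psi> \<odot>\<^bsub>U\<^esub> U_tensor n A (x_minus n i) (d \<otimes>\<^bsub>A\<^esub> mset_prod A \<psi>)) \<otimes>\<^bsub>U\<^esub> q_elem n A i (\<phi> - {#d#}) (\<chi> - \<psi>)"
    note fin = finite_subset_mset[of \<chi>]
    have prod: "d \<otimes>\<^bsub>A\<^esub> mset_prod A \<psi> \<in> carrier A" if "\<psi> \<in> ?S" "d \<in># \<phi>" for \<psi> d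
      using that pi[of \<psi> \<chi>] \<phi> \<chi> by auto
    have g: "?g \<psi> d \<in> carrier U" if "\<psi> \<in> ?S" "d \<in> set_mset \<phi>" for \<psi> d
      using prod[OF that] \<phi> \<chi> by (intro cl)
    have gs: "finsum U (?g \<psi>) (set_mset \<phi>) \<in> carrier U" if "\<psi> \<in> ?S" for \<psi>
      by (intro U_finsum(1) g that) auto
    have "actU (q_elem n A i \<phi> \<chi>) p = pm_scale (- 1 / of_nat (size \<phi>)) (\<Sum>\<psi>\<in>?S. actU (finsum U (?g \<psi>) (set_mset \<phi>)) p)"
      unfolding q_elem.simps[of n A i \<phi> \<chi>] using ne U_finsum[of ?S "\<lambda>\<psi>. finsum U (?g \<psi>) (set_mset \<phi>)", OF fin gs] by (simp add: actU_simps del: times_divide_eq_left)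
    also have "(\<Sum>\<psi>\<in>?S. actU (finsum U (?g \<psi>) (set_mset \<phi>)) p) = (\<Sum>\<psi>\<in>?S. \<Sum>d\<in>set_mset \<phi>. pm_scale (multinom \<psi>)
        (TP (x_minus n i) (d \<otimes>\<^bsub>A\<^esub> mset_prod A \<psi>) (actU (q_elem n A i (\<phi> - {#d#}) (\<chi> - \<psi>)) p)))"
    proof (intro sum.cong refl)
      fix \<psi> assume \<psi>: "\<psi> \<in> ?S"
      have "actU (finsum U (?g \<psi>) (set_mset \<phi>)) p = (\<Sum>d\<in>set_mset \<phi>. actU (?g \<psi> d) p)"
        using g[OF \<psi>] by (intro U_finsum(2)) auto
      also have "\<dots> = (\<Sum>d\<in>set_mset \<phi>. pm_scale (multinom \<psi>)
          (TP (x_minus n i) (d \<otimes>\<^bsub>A\<^esub> mset_prod A \<psi>) (actU (q_elem n A i (\<phi> - {#d#}) (\<chi> - \<psi>)) p)))"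
        using prod[OF \<psi>] \<phi> \<chi> by (intro sum.cong refl) (simp add: actU_simps cl actU_tensor)
      finally show "actU (finsum U (?g \<psi>) (set_mset \<phi>)) p = (\<Sum>d\<in>set_mset \<phi>. pm_scale (multinom \<psi>)
          (TP (x_minus n i) (d \<otimes>\<^bsub>A\<^esub> mset_prod A \<psi>) (actU (q_elem n A i (\<phi> - {#d#}) (\<chi> - \<psi>)) p)))" .
    qed
    finally show ?thesis .
  qed
qed (simp_all add: R car derivation_TP)

end



section \<open>The action of the products \<open>q\<close>\<close>

lemma derivation_prod_0:
  assumes "derivation \<delta>" "\<And>i. i \<in> S \<Longrightarrow> \<delta> (f i) = 0"
  shows "\<delta> (\<Prod>i\<in>S. f i) = 0"
  using assms(2)
  by (induction S rule: infinite_finite_induct) (simp_all add: derivation_one derivation_mult assms(1))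

lemma prod_scaled_monomials:
  "(\<Prod>i\<in>S. pm_scale (a i) (monomial (\<nu> i))) = pm_scale (\<Prod>i\<in>S. a i) (monomial (\<Sum>i\<in>S. \<nu> i))"
proof (induction S rule: infinite_finite_induct)
  case (insert x F)
  then show ?case
    by (simp add: mult_single)
qed (simp_all flip: single_one add: zero_multiset_def)

lemma prod_mset_var: "(\<Prod>c\<in>#\<chi>. var (f c)) = monomial (image_mset f \<chi>)"
proof (induction \<chi>)
  case (add x \<chi>)
  then show ?case by (simp add: mult_single)
qed simp

context weyl_type
begin

text \<open>
  The factors of \<open>q\<close> act one after the other, beginning with \<open>q\<^sub>1\<close>. Before the turn of \<open>q\<^sub>k\<close>, the letters of
  \<open>\<phi>\<^sub>1, \<dots>, \<phi>\<^bsub>k-1\<^esub>\<close> are in place, forming \<open>head_prod \<phi> k\<close>. The other letters, counted by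
  \<open>tail_size \<phi> (k - 1)\<close>, are all still equal to \<open>v\<^sub>k \<otimes> 1\<close>; of these, \<open>q\<^sub>k\<close> turns \<open>|\<phi>\<^sub>k|\<close> into the letters of
  \<open>\<phi>\<^sub>k\<close> and the rest into \<open>v\<^bsub>k+1\<^esub> \<otimes> 1\<close>.
\<close>

definition tail_size :: "(nat \<Rightarrow> 'a multiset) \<Rightarrow> nat \<Rightarrow> nat"
  where "tail_size \<phi> k = (\<Sum>j = k + 1..n. size (\<phi> j))"

lemma tail_size_step: "1 \<le> k \<Longrightarrow> k \<le> n \<Longrightarrow> tail_size \<phi> (k - 1) = tail_size \<phi> k + size (\<phi> k)"
  unfolding tail_size_def by (simp add: sum.atLeast_Suc_atMost)

definition head_prod :: "(nat \<Rightarrow> 'a multiset) \<Rightarrow> nat \<Rightarrow> (nat \<times> 'a) mpoly"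
  where "head_prod \<phi> k = (\<Prod>i = 1..<k. divpow_mset (lin (i - 1)) (\<phi> i))"

lemma head_prod_killed:
  assumes \<phi>: "\<And>i. i \<in> {1..n} \<Longrightarrow> set_mset (\<phi> i) \<subseteq> carrier A" and k: "1 \<le> k" "k \<le> n - 1" and b: "b \<in> carrier A"
  shows "TP (h_mat n k) b (head_prod \<phi> k) = 0" "TP (x_minus n k) b (head_prod \<phi> k) = 0"
proof -
  have kill: "TP z b (head_prod \<phi> k) = 0" if z: "\<And>j c. j < k - 1 \<Longrightarrow> c \<in> carrier A \<Longrightarrow> TP z b (lin j c) = 0" for z
    unfolding head_prod_def
  proof (rule derivation_prod_0[OF derivation_TP])
    fix i assume i: "i \<in> {1..<k}"
    show "TP z b (divpow_mset (lin (i - 1)) (\<phi> i)) = 0"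
      unfolding derivation_divpow_mset[OF derivation_TP]
      using i \<phi>[of i] k by (intro sum.neutral ballI) (auto simp: z subset_iff)
  qed
  show "TP (h_mat n k) b (head_prod \<phi> k) = 0"
    by (rule kill) (use k b in \<open>auto simp: TP_h_mat\<close>)
  show "TP (x_minus n k) b (head_prod \<phi> k) = 0"
    by (rule kill) (use k b in \<open>auto simp: x_minus_def TP_e_mat\<close>)
qed

lemma actU_scale: "Y \<in> carrier U \<Longrightarrow> actU Y (pm_scale a f) = pm_scale a (actU Y f)"
  by (auto elim!: U_cases simp: actU_ucls linear_simps(2)[OF V.act_linear])

definition partial_q :: "(nat \<Rightarrow> 'a multiset) \<Rightarrow> nat \<Rightarrow> 'a U_elem"
  where "partial_q \<phi> k = fold (\<lambda>i u. q_elem n A i (replicate_mset (tail_size \<phi> i) \<one>\<^bsub>A\<^esub>) (\<phi> i) \<otimes>\<^bsub>U\<^esub> u) [1..<k] \<one>\<^bsub>U\<^esub>"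

lemma act_partial_q:
  assumes \<phi>: "\<And>i. i \<in> {1..n} \<Longrightarrow> set_mset (\<phi> i) \<subseteq> carrier A"
  shows "1 \<le> k \<Longrightarrow> k \<le> n - 1 \<Longrightarrow> partial_q \<phi> k \<in> carrier U \<and>
    (\<exists>a. a \<noteq> 0 \<and> actU (partial_q \<phi> k) (divpow (lin 0 \<one>\<^bsub>A\<^esub>) (tail_size \<phi> 0)) =
      pm_scale a (divpow (lin (k - 1) \<one>\<^bsub>A\<^esub>) (tail_size \<phi> (k - 1)) * head_prod \<phi> k))"
proof (induction k rule: nat_induct_at_least)
  case base
  show ?case
    by (auto simp: partial_q_def head_prod_def U_one_closed actU_simps intro!: exI[of _ 1])
next
  case (Suc k)
  let ?q = "q_elem n A k (replicate_mset (tail_size \<phi> k) \<one>\<^bsub>A\<^esub>) (\<phi> k)"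
  have k: "k \<in> {1..n - 1}" "1 \<le> k" "k \<le> n - 1" "k \<le> n" using Suc by auto
  obtain a where IH: "partial_q \<phi> k \<in> carrier U" "a \<noteq> 0"
    "actU (partial_q \<phi> k) (divpow (lin 0 \<one>\<^bsub>A\<^esub>) (tail_size \<phi> 0)) =
      pm_scale a (divpow (lin (k - 1) \<one>\<^bsub>A\<^esub>) (tail_size \<phi> (k - 1)) * head_prod \<phi> k)"
    using Suc by auto
  have car: "set_mset (replicate_mset (tail_size \<phi> k) \<one>\<^bsub>A\<^esub>) \<subseteq> carrier A" "set_mset (\<phi> k) \<subseteq> carrier A"
    using \<phi>[of k] k by auto
  have q: "?q \<in> carrier U" by (rule q_elem_closed[OF k(1) car])
  have step: "partial_q \<phi> (Suc k) = ?q \<otimes>\<^bsub>U\<^esub> partial_q \<phi> k"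
    using k by (simp add: partial_q_def)
  define s :: complex where "s = (- 1) ^ (tail_size \<phi> k + size (\<phi> k))"
  have killed: "TP (h_mat n k) b (head_prod \<phi> k) = 0" "TP (x_minus n k) b (head_prod \<phi> k) = 0"
    if "b \<in> carrier A" for b
    using head_prod_killed[of \<phi> k b] \<phi> k(2,3) that by blast+
  have "actU ?q (divpow (lin (k - 1) \<one>\<^bsub>A\<^esub>) (tail_size \<phi> (k - 1)) * head_prod \<phi> k) =
      pm_scale s (divpow_mset (lin (k - 1)) (\<phi> k) * (divpow (lin k \<one>\<^bsub>A\<^esub>) (tail_size \<phi> k) * head_prod \<phi> k))"
    using act_q_elem[OF k(1) killed car, of "tail_size \<phi> (k - 1)"]
    unfolding tail_size_step[OF k(2,4)] s_def by (simp add: divpow_mset_replicate)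
  also have "divpow_mset (lin (k - 1)) (\<phi> k) * (divpow (lin k \<one>\<^bsub>A\<^esub>) (tail_size \<phi> k) * head_prod \<phi> k) =
      divpow (lin k \<one>\<^bsub>A\<^esub>) (tail_size \<phi> k) * head_prod \<phi> (Suc k)"
    using k by (simp add: head_prod_def mult_ac)
  finally have "actU (partial_q \<phi> (Suc k)) (divpow (lin 0 \<one>\<^bsub>A\<^esub>) (tail_size \<phi> 0)) =
      pm_scale (a * s) (divpow (lin k \<one>\<^bsub>A\<^esub>) (tail_size \<phi> k) * head_prod \<phi> (Suc k))"
    unfolding step by (simp add: actU_simps q IH(1,3) actU_scale)
  moreover have "a * s \<noteq> 0" using IH(2) by (simp add: s_def)
  ultimately show ?case
    unfolding diff_Suc_1 using U_mult_closed[OF q IH(1)] step by metis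
qed

definition mono_of :: "(nat \<Rightarrow> 'a multiset) \<Rightarrow> (nat \<times> 'a) multiset"
  where "mono_of \<phi> = (\<Sum>i = 1..n. image_mset (Pair (i - 1)) (\<phi> i))"

text \<open>
  The last factor \<open>q\<^bsub>n-1\<^esub>\<close> puts the letters of \<open>\<phi>\<^sub>n\<close> in place of powers of \<open>v\<^sub>n \<otimes> 1\<close>. The scalar collects signs
  and the factorials of divided powers.
\<close>

theorem act_q_prod:
  assumes \<phi>: "\<And>i. i \<in> {1..n} \<Longrightarrow> set_mset (\<phi> i) \<subseteq> B" and m: "(\<Sum>i = 1..n. size (\<phi> i)) = m"
  shows "q_prod n A \<phi> \<in> carrier U" "\<exists>a. a \<noteq> 0 \<and> actU (q_prod n A \<phi>) v0 = pm_scale a (monomial (mono_of \<phi>))"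
proof -
  define k where "k = n - 1"
  have k: "k \<in> {1..n - 1}" "1 \<le> k" "k \<le> n - 1" "k \<le> n" "Suc k = n" using n2 by (auto simp: k_def)
  have car: "set_mset (\<phi> i) \<subseteq> carrier A" if "i \<in> {1..n}" for i using \<phi>[OF that] B_carrier by blast
  let ?q = "q_elem n A k (\<phi> n) (\<phi> k)"
  obtain a where IH: "partial_q \<phi> k \<in> carrier U" "a \<noteq> 0"
    "actU (partial_q \<phi> k) (divpow (lin 0 \<one>\<^bsub>A\<^esub>) (tail_size \<phi> 0)) =
      pm_scale a (divpow (lin (k - 1) \<one>\<^bsub>A\<^esub>) (tail_size \<phi> (k - 1)) * head_prod \<phi> k)"
    using act_partial_q[of \<phi> k] car k(2,3) by blast
  have cars: "set_mset (\<phi> n) \<subseteq> carrier A" "set_mset (\<phi> k) \<subseteq> carrier A"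
    using car[of n] car[of k] k by auto
  have q: "?q \<in> carrier U" by (rule q_elem_closed[OF k(1) cars])
  have prod: "q_prod n A \<phi> = ?q \<otimes>\<^bsub>U\<^esub> partial_q \<phi> k"
    unfolding q_prod_def partial_q_def tail_size_def k_def foldr_conv_fold rev_rev_ident ..
  show closed: "q_prod n A \<phi> \<in> carrier U" unfolding prod by (rule U_mult_closed[OF q IH(1)])
  have tail: "tail_size \<phi> (k - 1) = size (\<phi> n) + size (\<phi> k)"
  proof -
    have "tail_size \<phi> k = size (\<phi> n)" unfolding tail_size_def using k by simp
    then show ?thesis using tail_size_step[OF k(2,4), of \<phi>] by simp
  qed
  define s :: complex where "s = (- 1) ^ (size (\<phi> n) + size (\<phi> k))"
  have killed: "TP (h_mat n k) b (head_prod \<phi> k) = 0" "TP (x_minus n k) b (head_prod \<phi> k) = 0"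
    if "b \<in> carrier A" for b
    using head_prod_killed[of \<phi> k b] car k(2,3) that by blast+
  have "actU ?q (divpow (lin (k - 1) \<one>\<^bsub>A\<^esub>) (tail_size \<phi> (k - 1)) * head_prod \<phi> k) =
      pm_scale s (divpow_mset (lin (k - 1)) (\<phi> k) * (divpow_mset (lin k) (\<phi> n) * head_prod \<phi> k))"
    using act_q_elem[OF k(1) killed cars, of "tail_size \<phi> (k - 1)"]
    unfolding tail s_def by simp
  also have "divpow_mset (lin (k - 1)) (\<phi> k) * (divpow_mset (lin k) (\<phi> n) * head_prod \<phi> k) =
      (\<Prod>i = 1..n. divpow_mset (lin (i - 1)) (\<phi> i))"
  proof -
    have "{1..n} = insert n (insert k {1..<k})" using k by auto
    moreover have "n \<noteq> k" "n - 1 = k" using k by auto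
    ultimately show ?thesis using k by (simp add: head_prod_def mult_ac)
  qed
  also have "\<dots> = (\<Prod>i = 1..n. pm_scale (1 / fact_mset (\<phi> i)) (monomial (image_mset (Pair (i - 1)) (\<phi> i))))"
  proof (intro prod.cong refl)
    fix i assume "i \<in> {1..n}"
    then have "(\<Prod>c\<in>#\<phi> i. lin (i - 1) c) = (\<Prod>c\<in>#\<phi> i. var (i - 1, c))"
      using \<phi>[of i] by (intro arg_cong[of _ _ prod_mset] image_mset_cong) (auto simp: lin_simps)
    then show "divpow_mset (lin (i - 1)) (\<phi> i) = pm_scale (1 / fact_mset (\<phi> i)) (monomial (image_mset (Pair (i - 1)) (\<phi> i)))"
      by (simp add: divpow_mset_def prod_mset_var)
  qed
  also have "\<dots> = pm_scale (\<Prod>i = 1..n. 1 / fact_mset (\<phi> i)) (monomial (mono_of \<phi>))"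
    unfolding prod_scaled_monomials mono_of_def ..
  finally have main: "actU ?q (divpow (lin (k - 1) \<one>\<^bsub>A\<^esub>) (tail_size \<phi> (k - 1)) * head_prod \<phi> k) =
      pm_scale s (pm_scale (\<Prod>i = 1..n. 1 / fact_mset (\<phi> i)) (monomial (mono_of \<phi>)))" .
  have "tail_size \<phi> 0 = m" using m by (simp add: tail_size_def)
  then have v0: "v0 = pm_scale (fact m) (divpow (lin 0 \<one>\<^bsub>A\<^esub>) (tail_size \<phi> 0))"
    by (simp add: divpow_def)
  define d where "d = fact m * (a * (s * (\<Prod>i = 1..n. 1 / fact_mset (\<phi> i))))"
  have "actU (q_prod n A \<phi>) v0 = pm_scale d (monomial (mono_of \<phi>))"
    unfolding v0 actU_scale[OF closed] unfolding prod actU_simps(2)[OF q IH(1)] IH(3) actU_scale[OF q] main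
    by (simp only: pm.scale_scale d_def)
  moreover have "d \<noteq> 0" using IH(2) by (simp add: d_def s_def)
  ultimately show "\<exists>a. a \<noteq> 0 \<and> actU (q_prod n A \<phi>) v0 = pm_scale a (monomial (mono_of \<phi>))" by blast
qed

text \<open>
  The monomial determines \<open>\<phi>\<close> on \<open>{1..n}\<close>. Values elsewhere are arbitrary, but \<open>q_prod\<close> does not see
  them (\<open>q_prod_cong\<close>).
\<close>

lemma mono_of_component:
  assumes "i \<in> {1..n}"
  shows "image_mset snd (filter_mset (\<lambda>x. fst x = i - 1) (mono_of \<phi>)) = \<phi> i"
proof -
  have f: "filter_mset P (\<Sum>j\<in>S. g j) = (\<Sum>j\<in>S. filter_mset P (g j))" for P and S :: "nat set" and g :: "nat \<Rightarrow> (nat \<times> 'a) multiset"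
    by (induction S rule: infinite_finite_induct) auto
  have "filter_mset (\<lambda>x. fst x = i - 1) (mono_of \<phi>) = (\<Sum>j = 1..n. if j = i then image_mset (Pair (i - 1)) (\<phi> i) else {#})"
    unfolding mono_of_def f
  proof (intro sum.cong refl)
    fix j assume j: "j \<in> {1..n}"
    have "j - 1 = i - 1 \<longleftrightarrow> j = i" using j assms by auto
    then show "filter_mset (\<lambda>x. fst x = i - 1) (image_mset (Pair (j - 1)) (\<phi> j)) = (if j = i then image_mset (Pair (i - 1)) (\<phi> i) else {#})"
      by (auto simp: filter_mset_image_mset)
  qed
  also have "\<dots> = image_mset (Pair (i - 1)) (\<phi> i)"
    using assms by (simp flip: zero_multiset_def)
  finally show ?thesis by (simp add: image_mset.compositionality comp_def)
qed

lemma mono_of_surj: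
  assumes "set_mset \<nu> \<subseteq> {..<n} \<times> B" "size \<nu> = m"
  obtains \<phi> where "mono_of \<phi> = \<nu>" "\<forall>i\<in>{1..n}. set_mset (\<phi> i) \<subseteq> B" "(\<Sum>i = 1..n. size (\<phi> i)) = m"
proof
  define \<phi> where "\<phi> i = image_mset snd (filter_mset (\<lambda>x. fst x = i - 1) \<nu>)" for i
  have "mono_of \<phi> = (\<Sum>i = 1..n. filter_mset (\<lambda>x. fst x = i - 1) \<nu>)"
    unfolding mono_of_def
  proof (intro sum.cong refl)
    fix i
    have "image_mset (Pair (i - 1)) (\<phi> i) = image_mset (\<lambda>x. x) (filter_mset (\<lambda>x. fst x = i - 1) \<nu>)"
      unfolding \<phi>_def image_mset.compositionality by (intro image_mset_cong) auto
    then show "image_mset (Pair (i - 1)) (\<phi> i) = filter_mset (\<lambda>x. fst x = i - 1) \<nu>" by simp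
  qed
  also have "\<dots> = \<nu>"
  proof (rule multiset_eqI)
    fix x
    have "count (\<Sum>i = 1..n. filter_mset (\<lambda>x. fst x = i - 1) \<nu>) x = (\<Sum>i = 1..n. if fst x = i - 1 then count \<nu> x else 0)"
      by (simp add: count_sum)
    also have "\<dots> = count \<nu> x"
    proof (cases "x \<in># \<nu>")
      case True
      then have "fst x < n" using assms(1) by auto
      have "(\<Sum>i = 1..n. if fst x = i - 1 then count \<nu> x else 0) = (\<Sum>i = 1..n. if i = Suc (fst x) then count \<nu> x else 0)"
        by (intro sum.cong) auto
      then show ?thesis using \<open>fst x < n\<close> by simp
    next
      case False
      then show ?thesis by (simp add: not_in_iff)
    qed
    finally show "count (\<Sum>i = 1..n. filter_mset (\<lambda>x. fst x = i - 1) \<nu>) x = count \<nu> x" .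
  qed
  finally show mono: "mono_of \<phi> = \<nu>" .
  show "\<forall>i\<in>{1..n}. set_mset (\<phi> i) \<subseteq> B"
    using assms(1) by (auto simp: \<phi>_def)
  have "size (mono_of \<phi>) = (\<Sum>i = 1..n. size (\<phi> i))"
    unfolding mono_of_def by (simp add: size_multiset_sum)
  then show "(\<Sum>i = 1..n. size (\<phi> i)) = m" using mono assms(2) by simp
qed

section \<open>The basis\<close>

(* The weight is written with the numeral 1 and has to keep this form under rewriting. *)
declare One_nat_def [simp del]

abbreviation "WM \<equiv> global_weyl_module n A (lam m)"
abbreviation wcls :: "'a U_elem \<Rightarrow> 'a U_elem set" where "wcls Y \<equiv> wideal m +>\<^bsub>U\<^esub> Y"

lemma quotient_wideal: "quotient_module class_ring U (wideal m)"
  by (intro quotient_module.intro module_U quotient_module_axioms.intro submodule_wideal)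

lemma vectorspace_WM: "vectorspace class_ring WM"
  using quotient_module.module_Q[OF quotient_wideal] class_field
  by (simp add: vectorspace_def global_weyl_module_def)

lemma WM_simps:
  "carrier WM = wcls ` carrier U"
  "Y \<in> carrier U \<Longrightarrow> Z \<in> carrier U \<Longrightarrow> wcls Y \<oplus>\<^bsub>WM\<^esub> wcls Z = wcls (Y \<oplus>\<^bsub>U\<^esub> Z)"
  "Y \<in> carrier U \<Longrightarrow> k \<odot>\<^bsub>WM\<^esub> wcls Y = wcls (k \<odot>\<^bsub>U\<^esub> Y)"
  "\<zero>\<^bsub>WM\<^esub> = wcls \<zero>\<^bsub>U\<^esub>"
  unfolding global_weyl_module_def
  using quotient_module.carrier_Q[OF quotient_wideal] quotient_module.Q_add[OF quotient_wideal]
    quotient_module.Q_smult[OF quotient_wideal] quotient_module.Q_zero[OF quotient_wideal]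
  by auto

lemma wcls_eq_iff: "p \<in> FX \<Longrightarrow> q \<in> FX \<Longrightarrow> wcls (ucls p) = wcls (ucls q) \<longleftrightarrow> p - q \<in> L m"
  using quotient_module.cls_eq_iff[OF quotient_wideal, of "ucls p" "ucls q"]
  by (auto simp: U_simps(1,7) L_def words_in_diff)

lemma weyl_act_vector:
  assumes "Y \<in> carrier U"
  shows "weyl_act n A (lam m) Y (weyl_vector n A (lam m)) = wcls Y"
proof -
  obtain p where p: "p \<in> FX" "Y = ucls p" using assms by (rule U_cases)
  have one: "\<one>\<^bsub>U\<^esub> \<in> wcls \<one>\<^bsub>U\<^esub>"
    using quotient_module.self_cls[OF quotient_wideal U_one_closed] .
  have "wcls (Y \<otimes>\<^bsub>U\<^esub> Z) = wcls Y" if Z: "Z \<in> wcls \<one>\<^bsub>U\<^esub>" for Z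
  proof -
    have "Z \<in> carrier U" "Z \<ominus>\<^bsub>U\<^esub> \<one>\<^bsub>U\<^esub> \<in> wideal m"
      using quotient_module.mem_cls[OF quotient_wideal U_one_closed] Z by auto
    then obtain r where r: "r \<in> FX" "Z = ucls r" "r - 1 \<in> L m"
      by (auto elim!: U_cases simp: U_simps(5,7) L_def words_in_diff)
    have "p * (r - 1) \<in> L m" by (rule L_mult[OF r(3) p(1)])
    then show ?thesis
      using p r by (simp add: U_simps(6) wcls_eq_iff words_in_mult right_diff_distrib)
  qed
  then have "(\<Union>Z\<in>wcls \<one>\<^bsub>U\<^esub>. wcls (Y \<otimes>\<^bsub>U\<^esub> Z)) = (\<Union>Z\<in>wcls \<one>\<^bsub>U\<^esub>. wcls Y)"
    by (rule SUP_cong[OF refl])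
  then show ?thesis using one by (auto simp: weyl_act_def weyl_vector_def)
qed

text \<open>
  The injection of the Weyl module into the polynomials. It takes the class of \<open>Y\<close>, which is \<open>Y w\<close>, to
  \<open>Y v0\<close>, for any choice of the representative \<open>Y\<close> (\<open>realize_wcls\<close>).
\<close>

definition realize :: "'a U_elem set \<Rightarrow> (nat \<times> 'a) mpoly"
  where "realize X = actU (SOME Y. Y \<in> carrier U \<and> X = wcls Y) v0"

lemma realize_wcls:
  assumes "Y \<in> carrier U"
  shows "realize (wcls Y) = actU Y v0"
proof -
  define Z where "Z = (SOME Z. Z \<in> carrier U \<and> wcls Y = wcls Z)"
  have "Z \<in> carrier U \<and> wcls Y = wcls Z"
    unfolding Z_def by (rule someI_ex) (use assms in auto)
  then obtain p q where "p \<in> FX" "Y = ucls p" "q \<in> FX" "Z = ucls q" "p - q \<in> L m"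
    using assms by (metis U_cases wcls_eq_iff)
  then show ?thesis
    using V.act_L[OF V_hw, of "p - q"]
    unfolding realize_def Z_def[symmetric] by (simp add: actU_ucls V.act_simps)
qed

lemma WM_cases:
  assumes "X \<in> carrier WM"
  obtains Y where "Y \<in> carrier U" "X = wcls Y"
  using assms by (auto simp: WM_simps(1))

lemma U_add_closed: "Y \<in> carrier U \<Longrightarrow> Z \<in> carrier U \<Longrightarrow> Y \<oplus>\<^bsub>U\<^esub> Z \<in> carrier U"
  by (auto elim!: U_cases simp: U_simps(2)) (auto simp: U_simps(1))

lemma U_zero_closed: "\<zero>\<^bsub>U\<^esub> \<in> carrier U"
  unfolding U_simps(1,4) by blast

lemma realize_simps:
  "X \<in> carrier WM \<Longrightarrow> Y \<in> carrier WM \<Longrightarrow> realize (X \<oplus>\<^bsub>WM\<^esub> Y) = realize X + realize Y"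
  "X \<in> carrier WM \<Longrightarrow> realize (k \<odot>\<^bsub>WM\<^esub> X) = pm_scale k (realize X)"
  "realize \<zero>\<^bsub>WM\<^esub> = 0"
  by (auto elim!: WM_cases simp: WM_simps realize_wcls actU_simps U_add_closed U_smult_closed U_zero_closed)

lemma realize_eq_0:
  assumes "X \<in> carrier WM" "realize X = 0"
  shows "X = \<zero>\<^bsub>WM\<^esub>"
proof -
  obtain p where p: "p \<in> FX" "ucls p \<in> carrier U" "X = wcls (ucls p)"
    using assms(1) by (metis WM_cases U_cases)
  have "p - 0 \<in> L m" using assms(2) p by (simp add: realize_wcls actU_ucls L_iff)
  then show ?thesis
    unfolding WM_simps(4) U_simps(4) p(3) using p(1) by (subst wcls_eq_iff) auto
qed

abbreviation "index_set \<equiv> {\<phi>. (\<forall>i\<in>{1..n}. set_mset (\<phi> i) \<subseteq> B) \<and> (\<Sum>i = 1..n. size (\<phi> i)) = m}"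

abbreviation "q_basis \<equiv> {weyl_act n A (lam m) (q_prod n A \<phi>) (weyl_vector n A (lam m)) | \<phi>. \<phi> \<in> index_set}"

lemma q_basis_elem:
  assumes "X \<in> q_basis"
  shows "\<exists>\<phi>\<in>index_set. \<exists>a. a \<noteq> 0 \<and> X = wcls (q_prod n A \<phi>) \<and> X \<in> carrier WM \<and> realize X = pm_scale a (monomial (mono_of \<phi>))"
proof -
  obtain \<phi> where \<phi>: "\<phi> \<in> index_set" and X: "X = weyl_act n A (lam m) (q_prod n A \<phi>) (weyl_vector n A (lam m))"
    using assms by blast
  have q: "q_prod n A \<phi> \<in> carrier U" "\<exists>a. a \<noteq> 0 \<and> actU (q_prod n A \<phi>) v0 = pm_scale a (monomial (mono_of \<phi>))"
    using act_q_prod[of \<phi>] \<phi> by auto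
  have "X = wcls (q_prod n A \<phi>)" unfolding X by (rule weyl_act_vector[OF q(1)])
  then show ?thesis
    using q \<phi> realize_wcls[OF q(1)] WM_simps(1) by (intro bexI[OF _ \<phi>]) auto
qed

lemma q_basis_in: "\<phi> \<in> index_set \<Longrightarrow> wcls (q_prod n A \<phi>) \<in> q_basis"
  using act_q_prod(1)[of \<phi>] weyl_act_vector[of "q_prod n A \<phi>"] by force

lemma q_prod_cong: "(\<And>i. i \<in> {1..n} \<Longrightarrow> \<phi> i = \<phi>' i) \<Longrightarrow> q_prod n A \<phi> = q_prod n A \<phi>'"
proof -
  assume eq: "\<And>i. i \<in> {1..n} \<Longrightarrow> \<phi> i = \<phi>' i"
  have "(\<Sum>j = i + 1..n. size (\<phi> j)) = (\<Sum>j = i + 1..n. size (\<phi>' j))" for i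
    using eq by (intro sum.cong) auto
  then show ?thesis
    unfolding q_prod_def using eq n2 by (intro arg_cong2[where f = "\<lambda>x y. x \<otimes>\<^bsub>U\<^esub> y"] foldr_cong refl) auto
qed

text \<open>
  The injection \<open>realize\<close> takes the elements of the set to non-zero multiples of monomials. Distinct
  elements give distinct monomials, hence independence. Every value of \<open>realize\<close> is a form of degree
  \<open>m\<close> in the letters \<open>v\<^sub>i \<otimes> b\<close>, so it is a combination of these monomials, and injectivity carries the
  combination back to the module.
\<close>

theorem q_basis_is_basis: "vectorspace.basis class_ring WM q_basis"
proof -
  interpret WS: vectorspace "class_ring :: complex ring" WM by (rule vectorspace_WM)
  have sub: "q_basis \<subseteq> carrier WM" using q_basis_elem by blast
  have lincomb: "realize (WS.lincomb k S) = (\<Sum>X\<in>S. pm_scale (k X) (realize X))"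
    if "finite S" "S \<subseteq> carrier WM" for k S
    using that
  proof (induction S)
    case empty
    then show ?case by (simp add: WS.lincomb_def realize_simps)
  next
    case (insert X S)
    then have "WS.lincomb k (insert X S) = k X \<odot>\<^bsub>WM\<^esub> X \<oplus>\<^bsub>WM\<^esub> WS.lincomb k S"
      using WS.lincomb_insert[of S k X] by auto
    moreover have "WS.lincomb k S \<in> carrier WM" "k X \<odot>\<^bsub>WM\<^esub> X \<in> carrier WM"
      using insert by auto
    ultimately show ?case using insert by (simp add: realize_simps)
  qed
  (* Compare the coefficients at the monomial of X. *)
  have indep: "WS.lin_indpt q_basis"
  proof
    assume "WS.lin_dep q_basis"
    then obtain S k X where S: "finite S" "S \<subseteq> q_basis" "WS.lincomb k S = \<zero>\<^bsub>WM\<^esub>" "X \<in> S" "k X \<noteq> 0"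
      unfolding WS.lin_dep_def by auto
    have "\<exists>\<phi> a. a \<noteq> 0 \<and> Y = wcls (q_prod n A \<phi>) \<and> realize Y = pm_scale a (monomial (mono_of \<phi>))" if "Y \<in> S" for Y
      using q_basis_elem[of Y] S(2) that by blast
    then obtain \<phi> a where \<phi>: "\<And>Y. Y \<in> S \<Longrightarrow> a Y \<noteq> 0 \<and> Y = wcls (q_prod n A (\<phi> Y)) \<and> realize Y = pm_scale (a Y) (monomial (mono_of (\<phi> Y)))"
      by metis
    have inj: "mono_of (\<phi> Y) = mono_of (\<phi> X) \<longleftrightarrow> Y = X" if "Y \<in> S" for Y
    proof
      assume "mono_of (\<phi> Y) = mono_of (\<phi> X)"
      then have "\<phi> Y i = \<phi> X i" if "i \<in> {1..n}" for i
        using mono_of_component[OF that, of "\<phi> Y"] mono_of_component[OF that, of "\<phi> X"] by simp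
      then have "q_prod n A (\<phi> Y) = q_prod n A (\<phi> X)" by (rule q_prod_cong)
      then show "Y = X" using \<phi>[OF that] \<phi>[OF S(4)] by metis
    qed simp
    have "0 = (\<Sum>Y\<in>S. pm_scale (k Y) (realize Y))"
      using lincomb[OF S(1), of k] S(2,3) sub realize_simps(3) by auto
    then have "0 = Poly_Mapping.lookup (\<Sum>Y\<in>S. pm_scale (k Y) (realize Y)) (mono_of (\<phi> X))" by (metis lookup_zero)
    also have "\<dots> = (\<Sum>Y\<in>S. if Y = X then k X * a X else 0)"
      unfolding lookup_sum
    proof (intro sum.cong refl)
      fix Y assume Y: "Y \<in> S"
      have "realize Y = pm_scale (a Y) (monomial (mono_of (\<phi> Y)))" using \<phi>[OF Y] by blast
      then show "Poly_Mapping.lookup (pm_scale (k Y) (realize Y)) (mono_of (\<phi> X)) = (if Y = X then k X * a X else 0)"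
        using inj[OF Y] by (auto simp: lookup_single when_def)
    qed
    also have "\<dots> = k X * a X" using S(1,4) by simp
    finally show False using S(5) \<phi>[OF S(4)] by simp
  qed
  have "X \<in> WS.span q_basis" if X: "X \<in> carrier WM" for X
  proof -
    note sp = submoduleD[OF WS.span_is_submodule[OF sub]]
    have own: "Y \<in> WS.span q_basis" if "Y \<in> q_basis" for Y using WS.in_own_span[OF sub] that by auto
    obtain p where p: "p \<in> FX" "X = wcls (ucls p)"
      using X by (auto elim!: WM_cases U_cases)
    have f: "homogeneous m (realize X) \<and> supported ({..<n} \<times> B) (realize X)"
      using V_act_supported[OF p(1)] p by (simp add: realize_wcls U_simps(1) actU_ucls)
    have "\<exists>Y\<in>WS.span q_basis. realize Y = realize X"
    proof (rule pm_induct[of "\<lambda>f. \<exists>Y\<in>WS.span q_basis. realize Y = f" "realize X"])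
      show "\<exists>Y\<in>WS.span q_basis. realize Y = 0" using sp(2) realize_simps(3) by blast
      show "\<exists>Y\<in>WS.span q_basis. realize Y = monomial \<nu>" if "\<nu> \<in> Poly_Mapping.keys (realize X)" for \<nu>
      proof -
        have "set_mset \<nu> \<subseteq> {..<n} \<times> B" "size \<nu> = m"
          using f that by (auto simp: homogeneous_def supported_def)
        then obtain \<phi> where \<phi>: "mono_of \<phi> = \<nu>" "\<forall>i\<in>{1..n}. set_mset (\<phi> i) \<subseteq> B" "(\<Sum>i = 1..n. size (\<phi> i)) = m"
          by (rule mono_of_surj)
        then have \<phi>i: "\<phi> \<in> index_set" by simp
        have q: "q_prod n A \<phi> \<in> carrier U" using act_q_prod(1)[of \<phi>] \<phi> by auto
        obtain a where a: "a \<noteq> 0" "actU (q_prod n A \<phi>) v0 = pm_scale a (monomial (mono_of \<phi>))"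
          using act_q_prod(2)[of \<phi>] \<phi> by auto
        let ?Y = "wcls (q_prod n A \<phi>)"
        have Y: "?Y \<in> WS.span q_basis" "?Y \<in> carrier WM"
          using own[OF q_basis_in[OF \<phi>i]] q by (auto simp: WM_simps(1))
        have "realize ((1 / a) \<odot>\<^bsub>WM\<^esub> ?Y) = monomial \<nu>"
          unfolding realize_simps(2)[OF Y(2)] realize_wcls[OF q] a(2) pm.scale_scale \<phi>(1) using a(1) by simp
        moreover have "(1 / a) \<odot>\<^bsub>WM\<^esub> ?Y \<in> WS.span q_basis" using sp(4)[OF _ Y(1), of "1 / a"] by simp
        ultimately show ?thesis by blast
      qed
      show "\<exists>Y\<in>WS.span q_basis. realize Y = pm_scale k g" if g: "\<exists>Y\<in>WS.span q_basis. realize Y = g" for k g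
      proof -
        obtain Y where Y: "Y \<in> WS.span q_basis" "realize Y = g" using g by blast
        then have "realize (k \<odot>\<^bsub>WM\<^esub> Y) = pm_scale k g" "k \<odot>\<^bsub>WM\<^esub> Y \<in> WS.span q_basis"
          using sp(1) sp(4)[of k Y] by (auto simp: realize_simps(2) subset_iff)
        then show ?thesis by blast
      qed
      show "\<exists>Y\<in>WS.span q_basis. realize Y = g + h"
        if g: "\<exists>Y\<in>WS.span q_basis. realize Y = g" and h: "\<exists>Y\<in>WS.span q_basis. realize Y = h" for g h
      proof -
        obtain Y Z where Y: "Y \<in> WS.span q_basis" "realize Y = g" and Z: "Z \<in> WS.span q_basis" "realize Z = h"
          using g h by blast
        then have "realize (Y \<oplus>\<^bsub>WM\<^esub> Z) = g + h" using sp(1) by (auto simp: realize_simps(1) subset_iff)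
        moreover have "Y \<oplus>\<^bsub>WM\<^esub> Z \<in> WS.span q_basis" using sp(3)[OF Y(1) Z(1)] .
        ultimately show ?thesis by blast
      qed
    qed
    then obtain Y where Y: "Y \<in> WS.span q_basis" "realize Y = realize X" by blast
    have Yc: "Y \<in> carrier WM" using Y(1) sp(1) by auto
    have mc: "(-1) \<odot>\<^bsub>WM\<^esub> Y \<in> carrier WM" using Yc WS.smult_closed[of "-1" Y] by simp
    have "realize (X \<oplus>\<^bsub>WM\<^esub> (-1) \<odot>\<^bsub>WM\<^esub> Y) = 0"
      unfolding realize_simps(1)[OF X mc] realize_simps(2)[OF Yc] Y(2) by (simp add: pm.scale_minus_left)
    then have z: "X \<oplus>\<^bsub>WM\<^esub> (-1) \<odot>\<^bsub>WM\<^esub> Y = \<zero>\<^bsub>WM\<^esub>"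
      using X mc WS.M.a_closed by (intro realize_eq_0) auto
    have "(-1) \<odot>\<^bsub>WM\<^esub> Y = \<ominus>\<^bsub>WM\<^esub> Y"
    proof -
      have "(-1) \<odot>\<^bsub>WM\<^esub> Y \<oplus>\<^bsub>WM\<^esub> Y = \<zero>\<^bsub>WM\<^esub>"
        by (rule realize_eq_0) (use Yc mc in \<open>auto simp: realize_simps pm.scale_minus_left WS.M.a_closed\<close>)
      then show ?thesis using WS.M.minus_equality[OF _ Yc mc] by simp
    qed
    then have "X = Y" using z X Yc WS.M.minus_unique by (metis WS.M.minus_equality WS.M.minus_minus WS.M.a_inv_closed)
    then show ?thesis using Y(1) by simp
  qed
  then have "WS.span q_basis = carrier WM" using WS.span_is_subset2[OF sub] by blast
  then show ?thesis unfolding WS.basis_def using indep sub by blast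
qed

end

theorem theorem3p0p1:
  fixes n m :: nat
    and A :: "(complex, 'a) module"
    and B :: "'a set"
  assumes "n \<ge> 2"
    and "algebra (class_ring :: complex ring) A"
    and "vectorspace.basis (class_ring :: complex ring) A B"
    and "m > 0"
  shows "let lam = (\<lambda>h. of_nat m * fundamental_weight 1 h) in
    vectorspace.basis (class_ring :: complex ring) (global_weyl_module n A lam)
    {weyl_act n A lam (q_prod n A \<phi>) (weyl_vector n A lam) | \<phi>.
      (\<forall>i\<in>{1..n}. set_mset (\<phi> i) \<subseteq> B) \<and> (\<Sum>i = 1..n. size (\<phi> i)) = m}"
proof -
  interpret weyl_type A B n m
    by (intro weyl_type.intro current_algebra.intro based_algebra.intro current_algebra_axioms.intro assms(1-3))
  show ?thesis using q_basis_is_basis by (simp only: Let_def mem_Collect_eq)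
qed

end
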